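(* Let $\Gamma$ be a connected signed graph with $c(\Gamma)\geq1$. Then $\eta(\Gamma)=2c(\Gamma)+p(\Gamma)-1$ if and only if $\Gamma$ has one of the following forms: (1) a signed graph obtained from a signed tree $T$ with $\eta(T)=p(T)-1$ and $p(T)\geq c(\Gamma)$ by attaching $c(\Gamma)$ pairwise disjoint signed cycles, each of nullity $2$, at $c(\Gamma)$ distinct leaves of $T$ (each such leaf identified with a vertex of its cycle); (2) an $\infty$-graph $\infty(p,q,1)$ in which each cycle has nullity $2$; (3) a $\theta$-graph $\theta(p,q,l)$ in which each cycle has nullity $2$.
   Context: A signed graph $\Gamma=(G,\sigma)$ is a simple finite graph $G$ with a map $\sigma:E(G)\to\{+,-\}$; its adjacency matrix has entry $\sigma(v_iv_j)$ if $v_i\sim v_j$ and $0$ otherwise; $\eta(\Gamma)$ is the multiplicity of the eigenvalue $0$ of this matrix. The nullity of a cycle of $\Gamma$ is the nullity of that signed cycle with signs inherited from $\Gamma$. $c(\Gamma)=|E(G)|-|V(G)|+\omega(G)$ with $\omega(G)$ the number of components, and $p(\Gamma)$ is the number of vertices of degree one. $\infty(p,q,1)$ is the graph obtained from two vertex-disjoint cycles $C_p$ and $C_q$ by identifying a vertex of $C_p$ with a vertex of $C_q$. $\theta(p,q,l)$ is the union of three internally disjoint paths of lengths $p,q,l$ with common end vertices, where $p,q,l\geq1$ and at most one of them equals $1$ (with arbitrary signs on edges). *)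

theory Defs
  imports "Jordan_Normal_Form.Char_Poly"
begin

section \<open>Signed graphs\<close>

record 'a signed_graph =
  verts :: "'a set"
  edges :: "'a set set"
  edge_sign :: "'a set \<Rightarrow> real"

text \<open>The signs are encoded as \<open>1\<close> and \<open>-1\<close>. Values of \<^const>\<open>edge_sign\<close> outside the edge set carry
  no information, so two records may represent the same signed graph.\<close>

definition signed_graph :: "'a signed_graph \<Rightarrow> bool" where
  "signed_graph G \<longleftrightarrow> finite (verts G) \<and> (\<forall>e\<in>edges G. e \<subseteq> verts G \<and> card e = 2)
     \<and> (\<forall>e\<in>edges G. edge_sign G e \<in> {1, -1})"

definition signed_subgraph :: "'a signed_graph \<Rightarrow> 'a signed_graph \<Rightarrow> bool" where
  "signed_subgraph H G \<longleftrightarrow> signed_graph H \<and> verts H \<subseteq> verts G \<and> edges H \<subseteq> edges G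
     \<and> (\<forall>e\<in>edges H. edge_sign H e = edge_sign G e)"

definition is_union :: "'a signed_graph \<Rightarrow> 'a signed_graph set \<Rightarrow> bool" where
  "is_union G F \<longleftrightarrow> (\<forall>H\<in>F. signed_subgraph H G)
     \<and> verts G = (\<Union>H\<in>F. verts H) \<and> edges G = (\<Union>H\<in>F. edges H)"

definition reachable :: "'a signed_graph \<Rightarrow> ('a \<times> 'a) set" where
  "reachable G = {(u, v). u \<in> verts G \<and> v \<in> verts G \<and> (u, v) \<in> {(x, y). {x, y} \<in> edges G}\<^sup>*}"

definition components :: "'a signed_graph \<Rightarrow> 'a set set" where
  "components G = verts G // reachable G"

definition connected_graph :: "'a signed_graph \<Rightarrow> bool" where
  "connected_graph G \<longleftrightarrow> verts G \<noteq> {} \<and> (\<forall>u\<in>verts G. \<forall>v\<in>verts G. (u, v) \<in> reachable G)"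

definition vertex_degree :: "'a signed_graph \<Rightarrow> 'a \<Rightarrow> nat" where
  "vertex_degree G v = card {e \<in> edges G. v \<in> e}"

definition leaves :: "'a signed_graph \<Rightarrow> 'a set" where
  "leaves G = {v \<in> verts G. vertex_degree G v = 1}"

definition num_pendant :: "'a signed_graph \<Rightarrow> nat" where
  "num_pendant G = card (leaves G)"

definition cyclomatic :: "'a signed_graph \<Rightarrow> int" where
  "cyclomatic G = int (card (edges G)) - int (card (verts G)) + int (card (components G))"

section \<open>Nullity\<close>

definition adj_matrix :: "'a signed_graph \<Rightarrow> 'a list \<Rightarrow> real mat" where
  "adj_matrix G vs = mat (length vs) (length vs)
     (\<lambda>(i, j). if {vs ! i, vs ! j} \<in> edges G then edge_sign G {vs ! i, vs ! j} else 0)"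

text \<open>The vertices are enumerated in an arbitrary order; \<open>nullity_eq\<close> below shows that the
  choice is irrelevant.\<close>

definition nullity :: "'a signed_graph \<Rightarrow> nat" where
  "nullity G = Polynomial.order 0
     (char_poly (adj_matrix G (SOME vs. distinct vs \<and> set vs = verts G)))"

lemma char_poly_reorder:
  assumes "distinct xs" "distinct ys" "set xs = set ys"
  shows "char_poly (adj_matrix G xs) = char_poly (adj_matrix G ys)"
proof -
  define n where "n = length ys"
  have len: "length xs = n"
    using assms by (metis distinct_card n_def)
  have "mset ys = mset xs"
    using assms by (simp add: set_eq_iff_mset_eq_distinct)
  then obtain p where p: "p permutes {..<length ys}" and pl: "permute_list p ys = xs"
    using mset_eq_permutation by metis
  have p0: "p permutes {0..<n}"
    using p by (simp add: n_def atLeast0LessThan)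
  have nth: "xs ! i = ys ! p i" if "i < n" for i
    using permute_list_nth[OF p] that pl by (simp add: n_def)
  have pn: "p i < n" if "i < n" for i
    using permutes_in_image[OF p0, of i] that by simp
  have pinj: "p i = p j \<longleftrightarrow> i = j" for i j
    using permutes_inj[OF p0] by (simp add: inj_eq)
  define A where "A = char_poly_matrix (adj_matrix G ys)"
  have Ac: "A \<in> carrier_mat n n"
    by (simp add: A_def adj_matrix_def char_poly_matrix_def n_def)
  define B where "B = mat n n (\<lambda>(i, j). A $$ (p i, j))"
  define C where "C = mat n n (\<lambda>(i, j). transpose_mat B $$ (p i, j))"
  have Bc: "B \<in> carrier_mat n n" by (simp add: B_def)
  have "det C = signof p * det (transpose_mat B)"
    unfolding C_def by (rule det_permute_rows[OF _ p0]) (use Bc in simp)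
  also have "det (transpose_mat B) = det B"
    by (rule det_transpose[OF Bc])
  also have "det B = signof p * det A"
    unfolding B_def by (rule det_permute_rows[OF Ac p0])
  finally have detC: "det C = det A"
    by (simp add: sign_def)
  have "char_poly_matrix (adj_matrix G xs) = transpose_mat C"
    by (rule eq_matI)
      (auto simp: C_def B_def A_def char_poly_matrix_def adj_matrix_def len n_def[symmetric]
        pn nth pinj)
  moreover have "det (transpose_mat C) = det C"
    by (rule det_transpose[of _ n]) (simp add: C_def)
  ultimately show ?thesis
    using detC by (simp add: char_poly_def A_def)
qed

lemma nullity_eq:
  assumes "distinct xs" "set xs = verts G"
  shows "nullity G = Polynomial.order 0 (char_poly (adj_matrix G xs))"
proof -
  have "\<exists>vs. distinct vs \<and> set vs = verts G" using assms by blast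
  from someI_ex[OF this] show ?thesis
    unfolding nullity_def using assms by (metis char_poly_reorder)
qed

section \<open>Cycles and trees\<close>

definition path_edges :: "'a list \<Rightarrow> 'a set set" where
  "path_edges vs = {{vs ! i, vs ! Suc i} | i. Suc i < length vs}"

definition cycle_edges :: "'a list \<Rightarrow> 'a set set" where
  "cycle_edges vs = insert {last vs, hd vs} (path_edges vs)"

definition signed_cycle :: "nat \<Rightarrow> 'a signed_graph \<Rightarrow> bool" where
  "signed_cycle n C \<longleftrightarrow> signed_graph C \<and> n \<ge> 3
     \<and> (\<exists>vs. distinct vs \<and> length vs = n \<and> verts C = set vs \<and> edges C = cycle_edges vs)"

definition signed_tree :: "'a signed_graph \<Rightarrow> bool" where
  "signed_tree T \<longleftrightarrow> signed_graph T \<and> connected_graph T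
     \<and> \<not> (\<exists>n C. signed_cycle n C \<and> signed_subgraph C T)"

definition cycles_have_nullity_2 :: "'a signed_graph \<Rightarrow> bool" where
  "cycles_have_nullity_2 G \<longleftrightarrow>
     (\<forall>n C. signed_cycle n C \<and> signed_subgraph C G \<longrightarrow> nullity C = 2)"

section \<open>The three families\<close>

text \<open>The gluing constructions are described inside the resulting graph: the pieces are signed
  subgraphs of it whose union is the whole graph and which overlap exactly in the
  identified vertices.\<close>

text \<open>\<open>L\<close> is the set of leaves of \<open>T\<close> used for attaching, and \<open>C v\<close> is the cycle attached at \<open>v\<close>.\<close>

definition tree_with_cycles ::
  "'a signed_graph \<Rightarrow> 'a signed_graph \<Rightarrow> 'a set \<Rightarrow> ('a \<Rightarrow> 'a signed_graph) \<Rightarrow> bool" where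
  "tree_with_cycles G T L C \<longleftrightarrow>
     signed_tree T \<and> L \<subseteq> leaves T
     \<and> (\<forall>v\<in>L. (\<exists>n. signed_cycle n (C v)) \<and> verts T \<inter> verts (C v) = {v})
     \<and> (\<forall>v\<in>L. \<forall>w\<in>L. v \<noteq> w \<longrightarrow> verts (C v) \<inter> verts (C w) = {})
     \<and> is_union G (insert T (C ` L))"

definition infinity_graph :: "nat \<Rightarrow> nat \<Rightarrow> 'a signed_graph \<Rightarrow> bool" where
  "infinity_graph p q G \<longleftrightarrow> signed_graph G
     \<and> (\<exists>A B x. signed_cycle p A \<and> signed_cycle q B \<and> verts A \<inter> verts B = {x}
          \<and> is_union G {A, B})"

text \<open>A path of length \<open>k\<close> is given by the list of its \<open>k + 1\<close> vertices.\<close>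

definition path_between :: "'a \<Rightarrow> 'a \<Rightarrow> nat \<Rightarrow> 'a list \<Rightarrow> bool" where
  "path_between u v k vs \<longleftrightarrow> distinct vs \<and> length vs = Suc k \<and> hd vs = u \<and> last vs = v"

definition theta_graph :: "nat \<Rightarrow> nat \<Rightarrow> nat \<Rightarrow> 'a signed_graph \<Rightarrow> bool" where
  "theta_graph p q l G \<longleftrightarrow> signed_graph G
     \<and> p \<ge> 1 \<and> q \<ge> 1 \<and> l \<ge> 1
     \<and> \<not> (p = 1 \<and> q = 1) \<and> \<not> (p = 1 \<and> l = 1) \<and> \<not> (q = 1 \<and> l = 1)
     \<and> (\<exists>u v P Q R. path_between u v p P \<and> path_between u v q Q \<and> path_between u v l R
          \<and> set P \<inter> set Q = {u, v} \<and> set P \<inter> set R = {u, v} \<and> set Q \<inter> set R = {u, v}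
          \<and> verts G = set P \<union> set Q \<union> set R
          \<and> edges G = path_edges P \<union> path_edges Q \<union> path_edges R)"

end

theory Submission
  imports Defs
begin

text \<open>
  A set \<open>S\<close> of vertices is forcing if a kernel vector of the adjacency matrix that vanishes on \<open>S\<close>
  vanishes everywhere; the nullity is the least size of a forcing set, because a minimal one carries
  a dual basis of the kernel. For a spanning tree \<open>T\<close> of a connected graph, the ends of the \<open>c\<close>
  edges outside \<open>T\<close> together with the leaves of the graph form a forcing set of size at most
  \<open>2c + p\<close>, since zeros propagate from the leaves of \<open>T\<close> to its root. One vertex is lost if two of
  these edges share an end, or if a leaf, or an end of degree at least three, can be dropped.

  If the nullity is \<open>2c + p - 1\<close>, at most one such loss occurs for any choice of \<open>T\<close>. Suppose that an
  edge off some cycle, but with an end on it, is not a bridge. Removing it along with an edge of the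
  cycle at the same end shows \<open>p = 0\<close> and \<open>c = 2\<close>, and the graph is a theta graph or two cycles
  sharing a vertex. Otherwise two bridges at the same cycle would lead to two losses, so every cycle
  is pendant. In both cases a kernel vector that vanishes on the forcing set except at one end of the
  removed edge of a cycle is supported on that cycle, which therefore has nullity 2. A pendant cycle
  of nullity 2 contributes exactly 1 to the nullity, so it can be cut off and one concludes by
  induction on \<open>c\<close>.
\<close>

section \<open>Symmetric matrices with a given kernel\<close>

text \<open>\<open>nullity\<close> is an algebraic multiplicity, while the combinatorial arguments
  are about kernel vectors. The two agree because adjacency matrices are symmetric. Once a nullity
  is the size of a minimal forcing set, an upper bound needs only a set and a propagation argument,
  and a lower bound comes from writing down kernel vectors. Why the induction closes: cutting off a
  pendant cycle turns the attaching vertex into a new leaf, so p grows by one while c and the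
  nullity drop by one, and equality is inherited. For c = 0 it reads p - 1, the condition on the
  tree of the first family. What remains after cutting has a leaf, so the theta and infinity graphs,
  which have none, occur only as the whole graph. A lone cycle would need nullity 1, but signed
  cycles have nullity 0 or 2.\<close>

lemma char_poly_four_block_lower_left_zero:
  fixes A :: "'a :: field mat"
  assumes "A \<in> carrier_mat n n" "B \<in> carrier_mat n m" "D \<in> carrier_mat m m"
  shows "char_poly (four_block_mat A B (0\<^sub>m m n) D) = char_poly A * char_poly D"
proof -
  let ?cm = "\<lambda> A. [:0, 1:] \<cdot>\<^sub>m 1\<^sub>m (dim_row A) + map_mat (\<lambda>a. [:- a:]) A"
  have "char_poly (four_block_mat A B (0\<^sub>m m n) D) = det (?cm (four_block_mat A B (0\<^sub>m m n) D))"
    unfolding char_poly_defs using assms by simp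
  also have "?cm (four_block_mat A B (0\<^sub>m m n) D)
      = four_block_mat (?cm A) (map_mat (\<lambda>a. [:- a:]) B) (0\<^sub>m m n) (?cm D)"
    by (rule eq_matI) (use assms in \<open>auto simp: one_poly_def\<close>)
  also have "det \<dots> = det (?cm A) * det (?cm D)"
    by (rule det_four_block_mat_lower_left_zero[of _ n _ m]) (use assms in auto)
  also have "\<dots> = char_poly A * char_poly D"
    unfolding char_poly_defs ..
  finally show ?thesis .
qed

lemma order_0_char_poly_0: "Polynomial.order 0 (char_poly (0\<^sub>m k k :: real mat)) = k"
proof -
  have "upper_triangular (0\<^sub>m k k :: real mat)" by auto
  then have "char_poly (0\<^sub>m k k :: real mat) = (\<Prod>a\<leftarrow>diag_mat (0\<^sub>m k k :: real mat). [:- a, 1:])"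
    using char_poly_upper_triangular[of "0\<^sub>m k k" k] by simp
  also have "diag_mat (0\<^sub>m k k :: real mat) = replicate k 0"
    by (auto simp: diag_mat_def intro!: nth_equalityI)
  also have "(\<Prod>a\<leftarrow>replicate k (0 :: real). [:- a, 1:]) = [:0, 1:] ^ k"
    by (induction k) auto
  finally show ?thesis
    using order_power_n_n[of "0::real" k] by simp
qed

lemma order_0_char_poly_nonsingular:
  fixes M :: "real mat"
  assumes M: "M \<in> carrier_mat n n"
    and inj: "\<And>w. w \<in> carrier_vec n \<Longrightarrow> M *\<^sub>v w = 0\<^sub>v n \<Longrightarrow> w = 0\<^sub>v n"
  shows "Polynomial.order 0 (char_poly M) = 0"
proof -
  have "det M \<noteq> 0"
    using det_0_iff_vec_prod_zero[OF M] inj by blast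
  moreover have "0 \<cdot>\<^sub>v v = 0\<^sub>v n" if "v \<in> carrier_vec n" for v :: "real vec"
    using that by auto
  ultimately have "\<not> eigenvalue M 0"
    unfolding eigenvalue_def eigenvector_def
    using inj M by auto
  then have "poly (char_poly M) 0 \<noteq> 0"
    using eigenvalue_root_char_poly[OF M] by simp
  then show ?thesis by (simp add: order_0I)
qed

text \<open>The columns of \<open>X\<close>, each with a unit vector on top, form a basis of the kernel.
  Completing them by unit vectors conjugates the matrix to a block triangular one, whose lower
  right block is \<open>(1 + X X\<^sup>T) D\<close> by symmetry.\<close>

lemma order_0_char_poly_symmetric:
  fixes A B C D X :: "real mat"
  assumes A: "A \<in> carrier_mat k k" and B: "B \<in> carrier_mat k m"
    and C: "C = transpose_mat B" and D: "D \<in> carrier_mat m m" and D_sym: "transpose_mat D = D"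
    and X: "X \<in> carrier_mat m k"
    and ker1: "A + B * X = 0\<^sub>m k k" and ker2: "C + D * X = 0\<^sub>m m k"
    and inj: "\<And>w. w \<in> carrier_vec m \<Longrightarrow> B *\<^sub>v w = 0\<^sub>v k \<Longrightarrow> D *\<^sub>v w = 0\<^sub>v m \<Longrightarrow> w = 0\<^sub>v m"
  shows "Polynomial.order 0 (char_poly (four_block_mat A B C D)) = k"
proof -
  define M where "M = D - X * B"
  have C': "C \<in> carrier_mat m k" using B C by simp
  have M: "M \<in> carrier_mat m m" unfolding M_def by (rule minus_carrier_mat, rule mult_carrier_mat[OF X B])
  have XX: "X + - X = 0\<^sub>m m k" "- X + X = 0\<^sub>m m k" using X by auto
  define P where "P = four_block_mat (1\<^sub>m k) (0\<^sub>m k m) X (1\<^sub>m m)"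
  define Q where "Q = four_block_mat (1\<^sub>m k) (0\<^sub>m k m) (- X) (1\<^sub>m m)"
  define G where "G = four_block_mat (0\<^sub>m k k) B (0\<^sub>m m k) M"
  let ?H = "four_block_mat A B C D"
  have carr: "P \<in> carrier_mat (k+m) (k+m)" "Q \<in> carrier_mat (k+m) (k+m)"
     "G \<in> carrier_mat (k+m) (k+m)" "?H \<in> carrier_mat (k+m) (k+m)"
    using X B C' D M A unfolding P_def Q_def G_def by (auto intro!: four_block_carrier_mat)
  have "P * Q = four_block_mat (1\<^sub>m k) (0\<^sub>m k m) (X + - X) (1\<^sub>m m)"
    unfolding P_def Q_def using X
    by (subst mult_four_block_mat[of _ k k _ m _ m]) auto
  then have PQ: "P * Q = 1\<^sub>m (k + m)" using XX by simp
  have "Q * P = four_block_mat (1\<^sub>m k) (0\<^sub>m k m) (- X + X) (1\<^sub>m m)"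
    unfolding P_def Q_def using X
    by (subst mult_four_block_mat[of _ k k _ m _ m]) auto
  then have QP: "Q * P = 1\<^sub>m (k + m)" using XX by simp
  have "?H * P = four_block_mat (A + B * X) B (C + D * X) D"
    unfolding P_def using X A B C' D
    by (subst mult_four_block_mat[of _ k k _ m _ m]) auto
  moreover have "X * B + M = D"
    unfolding M_def by (rule eq_matI) (use X B D in auto)
  then have "P * G = four_block_mat (0\<^sub>m k k) B (0\<^sub>m m k) D"
    unfolding P_def G_def using X B M
    by (subst mult_four_block_mat[of _ k k _ m _ m]) auto
  ultimately have HP: "?H * P = P * G" using ker1 ker2 by simp
  have "?H = ?H * (P * Q)"
    unfolding PQ by (rule right_mult_one_mat[OF carr(4), symmetric])
  also have "\<dots> = ?H * P * Q" using carr by (simp add: assoc_mult_mat)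
  finally have "?H = P * G * Q" unfolding HP .
  then have "similar_mat_wit ?H G P Q"
    using carr PQ QP by (intro similar_mat_witI) auto
  then have "char_poly ?H = char_poly G"
    by (intro char_poly_similar) (auto simp: similar_mat_def)
  also have "\<dots> = char_poly (0\<^sub>m k k) * char_poly M"
    unfolding G_def by (rule char_poly_four_block_lower_left_zero) (use B M in auto)
  finally have cp: "char_poly ?H = char_poly (0\<^sub>m k k) * char_poly M" .
  have nz: "char_poly ?H \<noteq> 0"
    using degree_monic_char_poly[OF carr(4)] by auto
  have "Polynomial.order 0 (char_poly M) = 0"
  proof (rule order_0_char_poly_nonsingular[OF M])
    fix w assume w: "w \<in> carrier_vec m" and Mw: "M *\<^sub>v w = 0\<^sub>v m"
    \<comment> \<open>From \<open>ker2\<close>, C = - D X, hence B = - X^T D by symmetry and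
      \<open>B w = - z\<close>. The equation \<open>M w = 0\<close> becomes u + X z = 0, and its
      scalar product with u reads |u|^2 + |z|^2 = 0.\<close>
    define u where "u = D *\<^sub>v w"
    have u: "u \<in> carrier_vec m" using D w by (simp add: u_def)
    define z where "z = transpose_mat X *\<^sub>v u"
    have z: "z \<in> carrier_vec k"
      unfolding z_def by (rule mult_mat_vec_carrier[OF _ u]) (use X in simp)
    have "C $$ (i, j) + (D * X) $$ (i, j) = 0" if "i < m" "j < k" for i j
      using arg_cong[OF ker2, of "\<lambda>M. M $$ (i, j)"] that D X
      by (simp del: index_mult_mat(1))
    then have "C = - (D * X)"
      by (intro eq_matI) (use C' D X in \<open>auto simp del: index_mult_mat(1) simp: eq_neg_iff_add_eq_0\<close>)
    have "B = transpose_mat C" by (simp add: C)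
    also have "\<dots> = - (transpose_mat (D * X))"
      unfolding \<open>C = - (D * X)\<close> by (rule transpose_uminus)
    also have "\<dots> = - (transpose_mat X * D)"
      using transpose_mult[OF D X] D_sym by simp
    finally have "B *\<^sub>v w = - (transpose_mat X * D *\<^sub>v w)"
      using w X D by auto
    also have "transpose_mat X * D *\<^sub>v w = z"
      unfolding z_def u_def by (rule assoc_mult_mat_vec) (use X D w in auto)
    finally have Bw: "B *\<^sub>v w = - z" .
    have "M *\<^sub>v w = D *\<^sub>v w - (X * B) *\<^sub>v w"
      unfolding M_def by (rule minus_mult_distrib_mat_vec) (use D X B w in auto)
    also have "(X * B) *\<^sub>v w = X *\<^sub>v (- z)"
      unfolding Bw[symmetric] by (rule assoc_mult_mat_vec) (use B X w in auto)
    finally have "u - X *\<^sub>v (- z) = 0\<^sub>v m" using Mw by (simp add: u_def)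
    then have "u \<bullet> (u - X *\<^sub>v (- z)) = 0" using u by simp
    then have "u \<bullet> u - u \<bullet> (X *\<^sub>v (- z)) = 0"
      using u X z by (subst (asm) scalar_prod_minus_distrib[of _ m]) auto
    moreover have "u \<bullet> (X *\<^sub>v (- z)) = z \<bullet> (- z)"
      unfolding z_def
      by (rule transpose_vec_mult_scalar[symmetric]) (use X u in \<open>auto simp: z_def[symmetric] z\<close>)
    moreover have "z \<bullet> (- z) = - (z \<bullet> z)" using z by simp
    ultimately have "u \<bullet> u + z \<bullet> z = 0" by simp
    moreover have "u \<bullet> u \<ge> 0" "z \<bullet> z \<ge> 0"
      by (auto simp: scalar_prod_def intro!: sum_nonneg)
    ultimately have "u \<bullet> u = 0" "z \<bullet> z = 0" by linarith+
    then have "u = 0\<^sub>v m" "z = 0\<^sub>v k"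
      using u z by (auto simp: scalar_prod_def sum_nonneg_eq_0_iff)
    then show "w = 0\<^sub>v m" using inj[OF w] Bw u_def by auto
  qed
  then show ?thesis
    using nz cp order_0_char_poly_0[of k] by (simp add: order_mult)
qed

section \<open>Forcing sets\<close>

definition weight :: "'a signed_graph \<Rightarrow> 'a \<Rightarrow> 'a \<Rightarrow> real" where
  "weight G u v = (if {u, v} \<in> edges G then edge_sign G {u, v} else 0)"

definition null_fun :: "'a signed_graph \<Rightarrow> ('a \<Rightarrow> real) \<Rightarrow> bool" where
  "null_fun G f \<longleftrightarrow> (\<forall>v\<in>verts G. (\<Sum>u\<in>verts G. weight G v u * f u) = 0)"

text \<open>Restriction to \<open>S\<close> is injective on the kernel: the semantic counterpart of
  the zero forcing sets of combinatorial matrix theory, whose propagation rule is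
  \<open>null_fun_force\<close>.\<close>

definition forcing :: "'a signed_graph \<Rightarrow> 'a set \<Rightarrow> bool" where
  "forcing G S \<longleftrightarrow> (\<forall>f. null_fun G f \<longrightarrow> (\<forall>s\<in>S. f s = 0) \<longrightarrow> (\<forall>v\<in>verts G. f v = 0))"

lemma weight_sym: "weight G u v = weight G v u"
  by (simp add: weight_def insert_commute)

lemma null_fun_scale: "null_fun G f \<Longrightarrow> null_fun G (\<lambda>v. c * f v)"
  by (simp add: null_fun_def mult.left_commute[of _ c] flip: sum_distrib_left)

text \<open>Scaled to be dual to \<open>S\<close>, the functions of \<open>interp\<close> supply the
  columns of \<open>X\<close> in \<open>order_0_char_poly_symmetric\<close> when the vertices of
  \<open>S\<close> are listed first. The forcing property supplies its injectivity
  hypothesis.\<close>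

lemma nullity_eq_card:
  assumes fin: "finite (verts G)" and S: "S \<subseteq> verts G" and forc: "forcing G S"
    and interp: "\<And>s. s \<in> S \<Longrightarrow> \<exists>f. null_fun G f \<and> f s \<noteq> 0 \<and> (\<forall>t\<in>S - {s}. f t = 0)"
  shows "nullity G = card S"
proof -
  have "\<exists>f. null_fun G f \<and> f s = 1 \<and> (\<forall>t\<in>S - {s}. f t = 0)" if s: "s \<in> S" for s
  proof -
    obtain f where "null_fun G f" "f s \<noteq> 0" "\<forall>t\<in>S - {s}. f t = 0" using interp[OF s] by blast
    then have "null_fun G (\<lambda>v. inverse (f s) * f v) \<and> inverse (f s) * f s = 1
        \<and> (\<forall>t\<in>S - {s}. inverse (f s) * f t = 0)"
      by (auto intro: null_fun_scale)
    then show ?thesis by blast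
  qed
  then obtain h where h: "\<And>s. s \<in> S \<Longrightarrow> null_fun G (h s)" "\<And>s. s \<in> S \<Longrightarrow> h s s = 1"
    "\<And>s t. s \<in> S \<Longrightarrow> t \<in> S \<Longrightarrow> s \<noteq> t \<Longrightarrow> h s t = 0"
    by (metis DiffI singletonD)
  obtain xs where xs: "set xs = S" "distinct xs"
    using finite_distinct_list fin S finite_subset by metis
  obtain ys where ys: "set ys = verts G - S" "distinct ys"
    using finite_distinct_list fin by (metis finite_Diff)
  define k where "k = length xs"
  define m where "m = length ys"
  let ?w = "weight G"
  define A where "A = mat k k (\<lambda>(i, j). ?w (xs ! i) (xs ! j))"
  define B where "B = mat k m (\<lambda>(i, j). ?w (xs ! i) (ys ! j))"
  define C where "C = mat m k (\<lambda>(i, j). ?w (ys ! i) (xs ! j))"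
  define D where "D = mat m m (\<lambda>(i, j). ?w (ys ! i) (ys ! j))"
  define X where "X = mat m k (\<lambda>(i, j). h (xs ! j) (ys ! i))"
  have xsS: "xs ! i \<in> S" if "i < k" for i using that xs by (auto simp: k_def)
  have ysV: "ys ! i \<in> verts G" if "i < m" for i using that ys nth_mem[of i ys] by (auto simp: m_def)
  have sumV: "(\<Sum>u\<in>verts G. g u) = (\<Sum>i<k. g (xs ! i)) + (\<Sum>i<m. g (ys ! i))" for g :: "'a \<Rightarrow> real"
  proof -
    have "(\<Sum>u\<in>verts G. g u) = (\<Sum>u\<in>S. g u) + (\<Sum>u\<in>verts G - S. g u)"
      using sum.subset_diff[OF S fin, of g] by simp
    also have "(\<Sum>u\<in>S. g u) = (\<Sum>i<k. g (xs ! i))"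
      using sum.reindex_bij_betw[OF bij_betw_nth[OF xs(2) _ xs(1)[symmetric]], of "{..<k}" g]
      by (simp add: k_def)
    also have "(\<Sum>u\<in>verts G - S. g u) = (\<Sum>i<m. g (ys ! i))"
      using sum.reindex_bij_betw[OF bij_betw_nth[OF ys(2) _ ys(1)[symmetric]], of "{..<m}" g]
      by (simp add: m_def)
    finally show ?thesis .
  qed
  have carr: "A \<in> carrier_mat k k" "B \<in> carrier_mat k m" "C \<in> carrier_mat m k"
    "D \<in> carrier_mat m m" "X \<in> carrier_mat m k"
    by (simp_all add: A_def B_def C_def D_def X_def)
  \<comment> \<open>Duality reduces the part over \<open>S\<close> of the kernel equation of
    \<open>h (xs ! j)\<close> to a single entry; what is left are the block equations A + B X = 0
    and C + D X = 0, entry by entry.\<close>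
  have *: "?w v (xs ! j) + (\<Sum>l<m. ?w v (ys ! l) * h (xs ! j) (ys ! l)) = 0"
    if "v \<in> verts G" "j < k" for v j
  proof -
    have "(\<Sum>l<k. ?w v (xs ! l) * h (xs ! j) (xs ! l)) = (\<Sum>l<k. if l = j then ?w v (xs ! l) else 0)"
      by (rule sum.cong) (use h xsS that xs(2) in \<open>auto simp: k_def nth_eq_iff_index_eq\<close>)
    also have "\<dots> = ?w v (xs ! j)" using that by simp
    finally show ?thesis
      using h(1)[OF xsS[OF that(2)]] that(1) sumV[of "\<lambda>u. ?w v u * h (xs ! j) u"]
      by (simp add: null_fun_def)
  qed
  have "Polynomial.order 0 (char_poly (four_block_mat A B C D)) = k"
  proof (rule order_0_char_poly_symmetric[OF carr(1) carr(2) _ carr(4) _ carr(5)])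
    show "C = transpose_mat B" by (auto simp: C_def B_def weight_sym)
    show "transpose_mat D = D" by (auto simp: D_def weight_sym)
    show "A + B * X = 0\<^sub>m k k"
    proof (rule eq_matI)
      fix i j assume "i < dim_row (0\<^sub>m k k :: real mat)" "j < dim_col (0\<^sub>m k k :: real mat)"
      then have ij: "i < k" "j < k" by auto
      then show "(A + B * X) $$ (i, j) = 0\<^sub>m k k $$ (i, j)"
        using *[of "xs ! i" j] S xsS[of i]
        by (auto simp: A_def B_def X_def scalar_prod_def lessThan_atLeast0)
    qed (auto simp: X_def B_def)
    show "C + D * X = 0\<^sub>m m k"
    proof (rule eq_matI)
      fix i j assume "i < dim_row (0\<^sub>m m k :: real mat)" "j < dim_col (0\<^sub>m m k :: real mat)"
      then have ij: "i < m" "j < k" by auto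
      then show "(C + D * X) $$ (i, j) = 0\<^sub>m m k $$ (i, j)"
        using *[of "ys ! i" j] ysV[of i]
        by (auto simp: C_def D_def X_def scalar_prod_def lessThan_atLeast0)
    qed (auto simp: X_def D_def)
    fix w :: "real vec" assume w: "w \<in> carrier_vec m" "B *\<^sub>v w = 0\<^sub>v k" "D *\<^sub>v w = 0\<^sub>v m"
    \<comment> \<open>Extension of \<open>w\<close> by zero on \<open>S\<close>: if \<open>B\<close>
      and \<open>D\<close> annihilate \<open>w\<close>, this is a kernel function vanishing on
      \<open>S\<close>.\<close>
    define f where "f u = (if u \<in> S then 0 else w $ the_inv_into {..<m} ((!) ys) u)" for u
    have fy: "f (ys ! l) = w $ l" if "l < m" for l
    proof -
      have "inj_on ((!) ys) {..<m}" using ys(2) by (auto simp: m_def inj_on_def nth_eq_iff_index_eq)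
      moreover have "ys ! l \<notin> S" using that ys nth_mem[of l ys] by (auto simp: m_def)
      ultimately show ?thesis using that by (simp add: f_def the_inv_into_f_f)
    qed
    have fx: "f (xs ! l) = 0" if "l < k" for l using xsS[OF that] by (simp add: f_def)
    have eq: "(\<Sum>u\<in>verts G. ?w v u * f u) = (\<Sum>l<m. ?w v (ys ! l) * w $ l)" for v
      unfolding sumV using fx fy by simp
    have Bw: "(\<Sum>l<m. ?w (xs ! i) (ys ! l) * w $ l) = 0" if "i < k" for i
      using arg_cong[OF w(2), of "\<lambda>v. v $ i"] that w(1)
      by (simp add: B_def scalar_prod_def lessThan_atLeast0)
    have Dw: "(\<Sum>l<m. ?w (ys ! i) (ys ! l) * w $ l) = 0" if "i < m" for i
      using arg_cong[OF w(3), of "\<lambda>v. v $ i"] that w(1)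
      by (simp add: D_def scalar_prod_def lessThan_atLeast0)
    have "null_fun G f"
      unfolding null_fun_def
    proof
      fix v assume "v \<in> verts G"
      then have "v \<in> set xs \<or> v \<in> set ys" using xs ys by blast
      then show "(\<Sum>u\<in>verts G. ?w v u * f u) = 0"
        unfolding eq using Bw Dw by (auto simp: in_set_conv_nth k_def m_def)
    qed
    moreover have "\<forall>s\<in>S. f s = 0" by (simp add: f_def)
    ultimately have "\<forall>v\<in>verts G. f v = 0" using forc unfolding forcing_def by blast
    then have "w $ l = 0" if "l < m" for l using fy[OF that] ysV[OF that] by simp
    then show "w = 0\<^sub>v m" using w(1) by (intro eq_vecI) auto
  qed
  moreover have "four_block_mat A B C D = adj_matrix G (xs @ ys)"
    by (rule eq_matI)
      (auto simp: A_def B_def C_def D_def adj_matrix_def weight_def k_def m_def nth_append)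
  moreover have "nullity G = Polynomial.order 0 (char_poly (adj_matrix G (xs @ ys)))"
    by (rule nullity_eq) (use xs ys S in auto)
  ultimately show ?thesis
    using xs by (simp add: k_def distinct_card[symmetric])
qed

lemma forcing_verts: "forcing G (verts G)"
  by (simp add: forcing_def)

lemma minimal_forcing_interp:
  assumes "forcing G S" "s \<in> S" "\<not> forcing G (S - {s})"
  shows "\<exists>f. null_fun G f \<and> f s \<noteq> 0 \<and> (\<forall>t\<in>S - {s}. f t = 0)"
proof -
  obtain f where f: "null_fun G f" "\<forall>t\<in>S - {s}. f t = 0" "\<exists>v\<in>verts G. f v \<noteq> 0"
    using assms(3) unfolding forcing_def by blast
  then have "f s \<noteq> 0" using assms(1) unfolding forcing_def by (metis DiffI singletonD)
  with f show ?thesis by blast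
qed

text \<open>Inclusion-minimality provides, for each vertex of the set, a kernel function vanishing
  on all the others. So every minimal forcing set has the same size, as bases of a matroid
  do.\<close>

lemma forcing_contains_nullity:
  assumes "finite (verts G)" "S \<subseteq> verts G" "forcing G S"
  shows "\<exists>S'\<subseteq>S. forcing G S' \<and> card S' = nullity G"
proof -
  have "finite S" using assms finite_subset by blast
  then have "finite {S'. S' \<subseteq> S \<and> forcing G S'}" by simp
  moreover have "{S'. S' \<subseteq> S \<and> forcing G S'} \<noteq> {}" using assms by blast
  ultimately obtain S' where "S' \<in> {S'. S' \<subseteq> S \<and> forcing G S'}"
    and min': "\<forall>S''\<in>{S'. S' \<subseteq> S \<and> forcing G S'}. S'' \<le> S' \<longrightarrow> S' = S''"
    using finite_has_minimal by meson
  then have S': "S' \<subseteq> S" "forcing G S'" by auto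
  have min: "S'' = S'" if "forcing G S''" "S'' \<subseteq> S'" for S''
    using min' that S' by auto
  have "nullity G = card S'"
  proof (rule nullity_eq_card)
    show "finite (verts G)" "S' \<subseteq> verts G" "forcing G S'" using assms S' by auto
    show "\<exists>f. null_fun G f \<and> f s \<noteq> 0 \<and> (\<forall>t\<in>S' - {s}. f t = 0)" if "s \<in> S'" for s
      using minimal_forcing_interp[OF S'(2) that] min[of "S' - {s}"] S'(1) that by blast
  qed
  with S' show ?thesis by metis
qed

lemma nullity_le_card:
  assumes "finite (verts G)" "S \<subseteq> verts G" "forcing G S"
  shows "nullity G \<le> card S"
  using forcing_contains_nullity[OF assms] assms by (metis card_mono finite_subset)

text \<open>A forcing set of the least possible size cannot lose a vertex. In an extremal graph this
  is a source of nonzero kernel vectors with many prescribed zeros.\<close>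

lemma forcing_nullity_interp:
  assumes "finite (verts G)" "S \<subseteq> verts G" "forcing G S" "nullity G = card S" "s \<in> S"
  shows "\<exists>f. null_fun G f \<and> f s \<noteq> 0 \<and> (\<forall>t\<in>S - {s}. f t = 0)"
proof (rule minimal_forcing_interp[OF assms(3,5)])
  have "card (S - {s}) < card S"
    using assms finite_subset by (metis card_Diff1_less)
  then show "\<not> forcing G (S - {s})"
    using nullity_le_card[of G "S - {s}"] assms by auto
qed

text \<open>The kernel equation at \<open>u\<close> has only the term of \<open>v\<close> left, and
  its coefficient is 1 or -1.\<close>

lemma null_fun_force:
  assumes G: "signed_graph G" and f: "null_fun G f" and e: "{u, v} \<in> edges G"
    and z: "\<And>w. {u, w} \<in> edges G \<Longrightarrow> w \<noteq> v \<Longrightarrow> f w = 0"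
  shows "f v = 0"
proof -
  have uv: "u \<in> verts G" "v \<in> verts G" and fin: "finite (verts G)"
    using G e unfolding signed_graph_def by auto
  have "weight G u w * f w = 0" if "w \<noteq> v" for w
    using z[OF _ that] by (auto simp: weight_def)
  then have "(\<Sum>w\<in>verts G. weight G u w * f w) = weight G u v * f v"
    by (subst sum.remove[OF fin uv(2)]) (simp add: sum.neutral)
  then have "weight G u v * f v = 0" using f uv by (simp add: null_fun_def)
  moreover have "weight G u v \<noteq> 0" using G e unfolding signed_graph_def weight_def by auto
  ultimately show ?thesis by simp
qed

section \<open>Connectivity and rooted spanning trees\<close>

text \<open>Works on bare edge sets, so that edges can be deleted without building a new graph;
  unlike \<open>reachable\<close> it is reflexive on the whole type.\<close>

definition reach :: "'a set set \<Rightarrow> ('a \<times> 'a) set" where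
  "reach E = {(x, y). {x, y} \<in> E}\<^sup>*"

definition conn :: "'a set \<Rightarrow> 'a set set \<Rightarrow> bool" where
  "conn V E \<longleftrightarrow> (\<forall>u\<in>V. \<forall>v\<in>V. (u, v) \<in> reach E)"

definition pairs :: "'a set \<Rightarrow> 'a set set" where
  "pairs V = {e. e \<subseteq> V \<and> card e = 2}"

lemma pairsD: "E \<subseteq> pairs V \<Longrightarrow> {u, v} \<in> E \<Longrightarrow> u \<in> V \<and> v \<in> V \<and> u \<noteq> v"
  by (auto simp: pairs_def card_insert_if split: if_splits)

lemma pairsE:
  assumes "E \<subseteq> pairs V" "e \<in> E"
  obtains u v where "e = {u, v}" "u \<in> V" "v \<in> V" "u \<noteq> v"
  using assms by (auto simp: pairs_def card_2_iff)

lemma reach_refl [simp]: "(u, u) \<in> reach E"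
  by (simp add: reach_def)

lemma reach_edge: "{u, v} \<in> E \<Longrightarrow> (u, v) \<in> reach E"
  by (auto simp: reach_def)

lemma reach_trans: "(u, v) \<in> reach E \<Longrightarrow> (v, w) \<in> reach E \<Longrightarrow> (u, w) \<in> reach E"
  by (simp add: reach_def)

lemma reach_sym: "(u, v) \<in> reach E \<Longrightarrow> (v, u) \<in> reach E"
  unfolding reach_def
  by (rule symD[OF sym_rtrancl]) (auto simp: sym_def insert_commute)

lemma reach_subst:
  assumes "(u, v) \<in> reach E" "\<And>x y. {x, y} \<in> E \<Longrightarrow> (x, y) \<in> reach E'"
  shows "(u, v) \<in> reach E'"
  using assms(1) unfolding reach_def[of E]
proof (induction rule: rtrancl_induct)
  case (step y z)
  then show ?case using assms(2)[of y z] reach_trans by fastforce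
qed simp

lemma reach_mono: "E \<subseteq> E' \<Longrightarrow> (u, v) \<in> reach E \<Longrightarrow> (u, v) \<in> reach E'"
  by (erule reach_subst) (auto intro: reach_edge)

lemma conn_mono: "E \<subseteq> E' \<Longrightarrow> conn V E \<Longrightarrow> conn V E'"
  by (auto simp: conn_def intro: reach_mono)

lemma connI_from:
  assumes "\<And>v. v \<in> V \<Longrightarrow> (r, v) \<in> reach E"
  shows "conn V E"
  using assms unfolding conn_def by (meson reach_sym reach_trans)

lemma conn_cut:
  assumes "conn V E" "E \<subseteq> pairs V" "x \<in> X" "X \<subseteq> V" "y \<in> V" "y \<notin> X"
  obtains u v where "u \<in> X" "v \<in> V" "v \<notin> X" "{u, v} \<in> E"
proof -
  note obtained = that
  have "(x, y) \<in> {(x, y). {x, y} \<in> E}\<^sup>*" using assms by (auto simp: conn_def reach_def)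
  moreover have "z \<in> X \<or> thesis" if "(x, z) \<in> {(x, y). {x, y} \<in> E}\<^sup>*" for z
    using that
  proof (induction rule: rtrancl_induct)
    case base then show ?case using assms by simp
  next
    case (step z w)
    then have "{z, w} \<in> E" by simp
    then show ?case using step.IH obtained pairsD[OF assms(2)] by blast
  qed
  ultimately show thesis using assms(6) by blast
qed

lemma conn_neighbour:
  assumes "conn V E" "E \<subseteq> pairs V" "v \<in> V" "w \<in> V" "w \<noteq> v"
  obtains u where "{v, u} \<in> E"
proof -
  obtain x u where "x \<in> {v}" "{x, u} \<in> E"
    using conn_cut[OF assms(1,2), of v "{v}" w] assms(3-5) by blast
  then show thesis using that by simp
qed

text \<open>Take the vertices that \<open>w\<close> no longer reaches once \<open>e\<close> is
  deleted: any other edge across would enlarge the reachable part.\<close>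

lemma bridge_side:
  assumes "conn V E" "\<not> conn V (E - {e})" "w \<in> V"
  obtains D where "D \<subseteq> V" "w \<notin> D" "D \<noteq> {}"
    "\<And>u v. u \<in> D \<Longrightarrow> v \<in> V \<Longrightarrow> {u, v} \<in> E \<Longrightarrow> v \<notin> D \<Longrightarrow> {u, v} = e"
    "\<And>v. v \<in> V \<Longrightarrow> (w, v) \<in> reach (E - {e}) \<Longrightarrow> v \<notin> D"
proof
  let ?D = "V - {z. (w, z) \<in> reach (E - {e})}"
  show "?D \<subseteq> V" "w \<notin> ?D" by auto
  show "?D \<noteq> {}" using connI_from[of V w "E - {e}"] assms by auto
  show "{u, v} = e" if "u \<in> ?D" "v \<in> V" "{u, v} \<in> E" "v \<notin> ?D" for u v
  proof (rule ccontr)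
    assume "{u, v} \<noteq> e"
    then have "(u, v) \<in> reach (E - {e})" using that by (auto intro: reach_edge)
    then show False using that by (auto dest: reach_sym reach_trans)
  qed
qed auto

text \<open>\<open>d\<close> is any rank that decreases towards the root, not necessarily a
  distance. It serves for induction towards the root and for choosing a deepest vertex.\<close>

definition rooted :: "'a set \<Rightarrow> 'a set set \<Rightarrow> 'a \<Rightarrow> ('a \<Rightarrow> 'a) \<Rightarrow> ('a \<Rightarrow> nat) \<Rightarrow> bool" where
  "rooted V T r par d \<longleftrightarrow> finite V \<and> r \<in> V \<and> (\<forall>v\<in>V - {r}. par v \<in> V \<and> d (par v) < d v)
     \<and> T = (\<lambda>v. {v, par v}) ` (V - {r})"

text \<open>The form without a root, by counting edges. Through \<open>sptree_rooted\<close> one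
  edge set can be rooted at whichever vertex an argument wants to reach last, while the forcing set
  attached to the tree stays the same.\<close>

definition sptree :: "'a set \<Rightarrow> 'a set set \<Rightarrow> bool" where
  "sptree V T \<longleftrightarrow> finite V \<and> V \<noteq> {} \<and> T \<subseteq> pairs V \<and> conn V T \<and> Suc (card T) = card V"

lemma rooted_par: "rooted V T r par d \<Longrightarrow> v \<in> V \<Longrightarrow> v \<noteq> r \<Longrightarrow> par v \<in> V \<and> d (par v) < d v \<and> {v, par v} \<in> T"
  by (auto simp: rooted_def)

lemma rooted_edge:
  assumes "rooted V T r par d" "{u, v} \<in> T"
  shows "u \<in> V \<and> v \<in> V \<and> (u \<noteq> r \<and> v = par u \<or> v \<noteq> r \<and> u = par v)"
proof -
  have "T = (\<lambda>v. {v, par v}) ` (V - {r})" using assms(1) unfolding rooted_def by blast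
  then obtain q where "q \<in> V" "q \<noteq> r" "{u, v} = {q, par q}" using assms(2) by blast
  then show ?thesis using rooted_par[OF assms(1), of q] by (auto simp: doubleton_eq_iff)
qed

lemma rooted_sptree:
  assumes "rooted V T r par d" shows "sptree V T"
proof -
  have fin: "finite V" and r: "r \<in> V" and T: "T = (\<lambda>v. {v, par v}) ` (V - {r})"
    using assms by (auto simp: rooted_def)
  have "inj_on (\<lambda>v. {v, par v}) (V - {r})"
  proof (rule inj_onI)
    fix u v assume "u \<in> V - {r}" "v \<in> V - {r}" "{u, par u} = {v, par v}"
    then show "u = v"
      using rooted_par[OF assms, of u] rooted_par[OF assms, of v] by (auto simp: doubleton_eq_iff)
  qed
  then have "card T = card (V - {r})" unfolding T by (rule card_image)
  then have "Suc (card T) = card V" using fin r by (metis card_Suc_Diff1)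
  moreover have "T \<subseteq> pairs V"
    using rooted_par[OF assms] by (force simp: T pairs_def card_insert_if)
  moreover have "(r, v) \<in> reach T" if "v \<in> V" for v
    using that
  proof (induction "d v" arbitrary: v rule: less_induct)
    case less
    show ?case
    proof (cases "v = r")
      case False
      then have "(r, par v) \<in> reach T" "(v, par v) \<in> reach T"
        using less rooted_par[OF assms, of v] by (auto intro: reach_edge)
      then show ?thesis by (meson reach_sym reach_trans)
    qed simp
  qed
  ultimately show ?thesis
    using fin r connI_from[of V r T] by (auto simp: sptree_def)
qed

text \<open>The rank is the distance to \<open>r\<close>, and the parent is the next vertex on a
  shortest walk.\<close>

lemma breadth_first_tree:
  assumes fin: "finite V" and E: "E \<subseteq> pairs V" and c: "conn V E" and r: "r \<in> V"
  obtains T par d where "T \<subseteq> E" "rooted V T r par d"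
proof -
  define R where "R = {(x, y). {x, y} \<in> E}"
  define d where "d v = (LEAST n. (v, r) \<in> R ^^ n)" for v
  have d: "(v, r) \<in> R ^^ d v" if "v \<in> V" for v
  proof -
    have "(v, r) \<in> R\<^sup>*" using c r that by (auto simp: conn_def reach_def R_def)
    then show ?thesis unfolding d_def by (auto simp: rtrancl_power intro: LeastI)
  qed
  have "\<exists>u. u \<in> V \<and> d u < d v \<and> {v, u} \<in> E" if v: "v \<in> V - {r}" for v
  proof -
    have "d v \<noteq> 0" using d[of v] v by (intro notI) auto
    then obtain m where m: "d v = Suc m" using not0_implies_Suc by blast
    then obtain u where u: "(v, u) \<in> R" "(u, r) \<in> R ^^ m"
      using d[of v] v by (metis DiffD1 relpow_Suc_E2)
    have "d u \<le> m" unfolding d_def by (rule Least_le) fact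
    then show ?thesis using u m pairsD[OF E, of v u] by (auto simp: R_def)
  qed
  then obtain par where "\<And>v. v \<in> V - {r} \<Longrightarrow> par v \<in> V \<and> d (par v) < d v \<and> {v, par v} \<in> E"
    by metis
  then show thesis
    using that[of "(\<lambda>v. {v, par v}) ` (V - {r})" par d] fin r by (auto simp: rooted_def)
qed

text \<open>A tree grown inside \<open>T\<close> from \<open>r\<close> has as many edges as
  \<open>T\<close>, so it is all of \<open>T\<close>.\<close>

lemma sptree_rooted:
  assumes "sptree V T" "r \<in> V"
  obtains par d where "rooted V T r par d"
proof -
  have T: "finite V" "T \<subseteq> pairs V" "conn V T" "Suc (card T) = card V"
    using assms(1) by (auto simp: sptree_def)
  obtain T' par d where T': "T' \<subseteq> T" "rooted V T' r par d"
    using breadth_first_tree[OF T(1,2,3) assms(2)] by blast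
  have "Suc (card T') = card V" using rooted_sptree[OF T'(2)] by (simp add: sptree_def)
  moreover have "finite T" using T(1,2) by (auto simp: pairs_def intro: finite_subset[of _ "Pow V"])
  ultimately have "T' = T" using T' T(4) by (metis card_subset_eq nat.inject)
  then show thesis using that T' by blast
qed

lemma sptree_exists:
  assumes "finite V" "V \<noteq> {}" "E \<subseteq> pairs V" "conn V E"
  obtains T where "T \<subseteq> E" "sptree V T"
  using assms breadth_first_tree[OF assms(1,3,4)] rooted_sptree by (metis all_not_in_conv)

lemma finite_pairs: "finite V \<Longrightarrow> E \<subseteq> pairs V \<Longrightarrow> finite E"
  by (auto simp: pairs_def intro: finite_subset[of _ "Pow V"])

lemma conn_card:
  assumes "finite V" "V \<noteq> {}" "E \<subseteq> pairs V" "conn V E"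
  shows "card V \<le> Suc (card E)"
proof -
  obtain T where "T \<subseteq> E" "sptree V T" using sptree_exists[OF assms] .
  then show ?thesis
    using finite_pairs[OF assms(1,3)] by (auto simp: sptree_def dest!: sym[of "Suc _"] intro: card_mono)
qed

text \<open>A single edge leads from \<open>Y\<close> towards the root, so no other one can lead away from it.\<close>

lemma rooted_children_closed:
  assumes T: "rooted V T r par d" and Y: "Y \<subseteq> V" "r \<notin> Y"
    and cut: "\<And>u v. u \<in> Y \<Longrightarrow> v \<in> V \<Longrightarrow> {u, v} \<in> T \<Longrightarrow> v \<notin> Y \<Longrightarrow> {u, v} = e"
    and v: "v \<in> V" "v \<noteq> r" "par v \<in> Y"
  shows "v \<in> Y"
proof (rule ccontr)
  assume nv: "v \<notin> Y"
  obtain z where z: "z \<in> Y" "\<And>y. y \<in> Y \<Longrightarrow> d z \<le> d y"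
    using ex_has_least_nat[of "\<lambda>z. z \<in> Y" "par v" d] v(3) by blast
  have zV: "z \<in> V" "z \<noteq> r" using z(1) Y by auto
  note pz = rooted_par[OF T zV]
  have "par z \<notin> Y" using z(2)[of "par z"] pz by auto
  then have "{z, par z} = e" using cut[of z "par z"] z(1) pz by auto
  moreover have "{par v, v} = e"
    using cut[OF v(3) v(1) _ nv] rooted_par[OF T v(1,2)] by (simp add: insert_commute)
  ultimately have "{z, par z} = {par v, v}" by simp
  then have "par z = v" "z = par v" using z(1) nv by (auto simp: doubleton_eq_iff)
  then show False using rooted_par[OF T v(1,2)] pz by auto
qed

section \<open>Ancestors and connected parts of a rooted tree\<close>

definition ancestors :: "'a set \<Rightarrow> 'a \<Rightarrow> ('a \<Rightarrow> 'a) \<Rightarrow> 'a \<Rightarrow> 'a set" where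
  "ancestors V r par w = {v. (w, v) \<in> {(v, par v) | v. v \<in> V - {r}}\<^sup>*}"

lemma ancestors_refl: "w \<in> ancestors V r par w"
  by (simp add: ancestors_def)

lemma ancestors_par: "v \<in> ancestors V r par w \<Longrightarrow> v \<in> V \<Longrightarrow> v \<noteq> r \<Longrightarrow> par v \<in> ancestors V r par w"
  unfolding ancestors_def by (auto intro: rtrancl_into_rtrancl)

lemma root_in_ancestors:
  assumes "rooted V T r par d" "w \<in> V"
  shows "r \<in> ancestors V r par w"
  using assms(2)
proof (induction "d w" arbitrary: w rule: less_induct)
  case less
  show ?case
  proof (cases "w = r")
    case False
    then have "r \<in> ancestors V r par (par w)"
      using less rooted_par[OF assms(1), of w] by auto
    then show ?thesis using False less(2)
      unfolding ancestors_def by (auto intro: converse_rtrancl_into_rtrancl)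
  qed (simp add: ancestors_refl)
qed

text \<open>Inside \<open>EW\<close>, the descendants of \<open>z\<close> lying in \<open>W\<close>
  must be connected to the root, and the parent edge of \<open>z\<close> is the only tree edge
  leading out of them.\<close>

lemma parent_in_connected_part:
  assumes T: "rooted V T r par d" and W: "conn W EW" "EW \<subseteq> T" "EW \<subseteq> pairs W" "W \<subseteq> V" "r \<in> W"
    and z: "z \<in> W" "z \<noteq> r"
  shows "{z, par z} \<in> EW \<and> par z \<in> W"
proof -
  define R where "R = {(v, par v) | v. v \<in> V - {r}}"
  define X where "X = {y \<in> W. (y, z) \<in> R\<^sup>*}"
  have "(r, z) \<notin> R\<^sup>*"
  proof
    assume "(r, z) \<in> R\<^sup>*"
    then show False by (cases rule: converse_rtranclE) (use z in \<open>auto simp: R_def\<close>)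
  qed
  then obtain u v where uv: "u \<in> X" "v \<in> W" "v \<notin> X" "{u, v} \<in> EW"
    using conn_cut[OF W(1,3), of z X r] z W by (auto simp: X_def)
  have "{u, v} \<in> T" using uv W by auto
  then consider "u \<noteq> r" "v = par u" "u \<in> V" | "v \<noteq> r" "u = par v" "v \<in> V"
    using rooted_edge[OF T] by blast
  then show ?thesis
  proof cases
    case 1
    have "(u, z) \<in> R\<^sup>*" using uv by (simp add: X_def)
    then have "u = z"
    proof (cases rule: converse_rtranclE)
      case (step y)
      then have "y = par u" by (auto simp: R_def)
      then show ?thesis using step 1 uv by (auto simp: X_def)
    qed
    then show ?thesis using 1 uv by simp
  next
    case 2
    then have "(v, u) \<in> R" by (auto simp: R_def)
    then have "v \<in> X" using uv by (auto simp: X_def intro: converse_rtrancl_into_rtrancl)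
    then show ?thesis using uv by simp
  qed
qed

section \<open>Paths and cycles\<close>

lemma path_edges_Nil [simp]: "path_edges [] = {}"
  and path_edges_single [simp]: "path_edges [x] = {}"
  by (auto simp: path_edges_def)

lemma path_edges_Cons [simp]: "path_edges (x # y # vs) = insert {x, y} (path_edges (y # vs))"
proof -
  have "{i. Suc i < length (x # y # vs)} = insert 0 (Suc ` {i. Suc i < length (y # vs)})"
    by (auto simp: image_iff gr0_conv_Suc less_Suc_eq_0_disj)
  moreover have "path_edges ws = (\<lambda>i. {ws ! i, ws ! Suc i}) ` {i. Suc i < length ws}" for ws :: "'a list"
    by (auto simp: path_edges_def)
  ultimately show ?thesis by (simp add: image_image)
qed

lemma path_edges_append:
  "xs \<noteq> [] \<Longrightarrow> ys \<noteq> [] \<Longrightarrow>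
    path_edges (xs @ ys) = insert {last xs, hd ys} (path_edges xs \<union> path_edges ys)"
proof (induction xs)
  case (Cons x xs)
  then show ?case by (cases xs; cases ys) auto
qed simp

lemma path_edges_rev [simp]: "path_edges (rev vs) = path_edges vs"
proof (induction vs)
  case (Cons x vs)
  have "path_edges (rev vs @ [x]) = insert {hd vs, x} (path_edges vs)" if "vs \<noteq> []"
    using that Cons path_edges_append[of "rev vs" "[x]"] by (simp add: last_rev)
  then show ?case by (cases vs) (simp_all add: insert_commute)
qed simp

lemma path_edges_subset: "e \<in> path_edges vs \<Longrightarrow> e \<subseteq> set vs"
  by (auto simp: path_edges_def)

lemma path_edges_pairs: "distinct vs \<Longrightarrow> path_edges vs \<subseteq> pairs (set vs)"
  by (auto simp: path_edges_def pairs_def card_insert_if nth_eq_iff_index_eq)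

lemma finite_path_edges [simp]: "finite (path_edges vs)"
  by (rule finite_subset[of _ "Pow (set vs)"]) (auto dest: path_edges_subset)

lemma card_path_edges: "distinct vs \<Longrightarrow> card (path_edges vs) = length vs - 1"
proof (induction vs)
  case (Cons x vs)
  show ?case
  proof (cases vs)
    case (Cons y ws)
    then have "{x, y} \<notin> path_edges vs" using Cons.prems path_edges_subset[of "{x, y}" vs] by auto
    then show ?thesis using Cons.IH Cons.prems Cons by simp
  qed simp
qed simp

lemma reach_path_edges: "v \<in> set vs \<Longrightarrow> (hd vs, v) \<in> reach (path_edges vs)"
proof (induction vs)
  case (Cons x vs)
  show ?case
  proof (cases vs)
    case (Cons y ws)
    have "(x, y) \<in> reach (path_edges (x # vs))" using Cons by (auto intro: reach_edge)
    moreover have "v \<in> set vs \<Longrightarrow> (y, v) \<in> reach (path_edges (x # vs))"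
      using Cons.IH Cons by (auto intro: reach_mono[of "path_edges vs"])
    ultimately show ?thesis using Cons.prems by (auto intro: reach_trans)
  qed (use Cons.prems in simp)
qed simp

lemma conn_path_edges: "conn (set vs) (path_edges vs)"
  by (rule connI_from[of _ "hd vs"]) (rule reach_path_edges)

lemma reach_obtain_path:
  assumes "(u, v) \<in> reach E"
  obtains vs where "vs \<noteq> []" "distinct vs" "hd vs = u" "last vs = v" "path_edges vs \<subseteq> E"
proof -
  have "\<exists>vs. vs \<noteq> [] \<and> distinct vs \<and> hd vs = u \<and> last vs = v \<and> path_edges vs \<subseteq> E"
    using assms unfolding reach_def
  proof (induction rule: converse_rtrancl_induct)
    case base
    show ?case by (rule exI[of _ "[v]"]) simp
  next
    case (step x y)
    then obtain vs where vs: "vs \<noteq> []" "distinct vs" "hd vs = y" "last vs = v" "path_edges vs \<subseteq> E"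
      by blast
    show ?case
    proof (cases "x \<in> set vs")
      case True
      then obtain as bs where ab: "vs = as @ x # bs" by (meson split_list)
      have "path_edges (x # bs) \<subseteq> path_edges vs"
        unfolding ab by (cases "as = []") (auto simp: path_edges_append)
      then show ?thesis using vs ab by (intro exI[of _ "x # bs"]) auto
    next
      case False
      then show ?thesis using vs step(1) by (intro exI[of _ "x # vs"], cases vs) auto
    qed
  qed
  then show thesis using that by blast
qed

lemma obtain_path_to_set:
  assumes "(u, v) \<in> reach E" "v \<in> X"
  obtains vs where "vs \<noteq> []" "distinct vs" "hd vs = u" "last vs \<in> X" "path_edges vs \<subseteq> E"
    "set (butlast vs) \<inter> X = {}"
proof -
  obtain vs where vs: "vs \<noteq> []" "distinct vs" "hd vs = u" "last vs = v" "path_edges vs \<subseteq> E"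
    using reach_obtain_path[OF assms(1)] .
  then have "\<exists>x\<in>set vs. x \<in> X" using assms(2) last_in_set by metis
  then obtain as x bs where ab: "vs = as @ x # bs" "x \<in> X" "\<forall>y\<in>set as. y \<notin> X"
    using split_list_first_prop[of vs "\<lambda>x. x \<in> X"] by blast
  have "path_edges (as @ [x]) \<subseteq> path_edges vs"
    unfolding ab(1) by (cases "as = []") (auto simp: path_edges_append)
  then show thesis using that[of "as @ [x]"] vs ab by (cases as) auto
qed

text \<open>The list singles out the closing edge \<open>{last vs, hd vs}\<close>, which is the edge
  deleted to break the cycle; \<open>is_cycle_rotate\<close> moves it to any chosen vertex.\<close>

definition is_cycle :: "'a set set \<Rightarrow> 'a list \<Rightarrow> bool" where
  "is_cycle E vs \<longleftrightarrow> distinct vs \<and> length vs \<ge> 3 \<and> cycle_edges vs \<subseteq> E"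

lemma closing_edge_notin_path:
  assumes "distinct vs" "length vs \<ge> 3"
  shows "{last vs, hd vs} \<notin> path_edges vs"
proof -
  obtain x y z ws where vs: "vs = x # y # z # ws"
    using assms(2) by (metis One_nat_def Suc_le_length_iff numeral_3_eq_3)
  have "last vs \<noteq> y" using assms(1) vs last_in_set[of "z # ws"] by auto
  moreover have "x \<notin> set (y # z # ws)" using assms(1) vs by auto
  ultimately show ?thesis
    using path_edges_subset[of "{last vs, hd vs}" "y # z # ws"] vs
    by (auto simp: doubleton_eq_iff)
qed

lemma finite_cycle_edges [simp]: "finite (cycle_edges vs)"
  by (simp add: cycle_edges_def)

lemma cycle_edges_subset: "vs \<noteq> [] \<Longrightarrow> e \<in> cycle_edges vs \<Longrightarrow> e \<subseteq> set vs"
  using path_edges_subset[of e vs] by (auto simp: cycle_edges_def)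

lemma card_cycle_edges: "distinct vs \<Longrightarrow> length vs \<ge> 3 \<Longrightarrow> card (cycle_edges vs) = length vs"
  using closing_edge_notin_path[of vs] by (simp add: cycle_edges_def card_path_edges)

lemma cycle_edges_pairs: "distinct vs \<Longrightarrow> length vs \<ge> 3 \<Longrightarrow> cycle_edges vs \<subseteq> pairs (set vs)"
proof -
  assume vs: "distinct vs" "length vs \<ge> 3"
  obtain x y ws where "vs = x # y # ws"
    using vs(2) by (metis One_nat_def Suc_le_length_iff numeral_3_eq_3)
  then have "last vs \<noteq> hd vs" "vs \<noteq> []"
    using vs(1) last_in_set[of "y # ws"] by auto
  then show ?thesis
    using vs path_edges_pairs[of vs] by (auto simp: cycle_edges_def pairs_def card_insert_if)
qed

lemma rotate_cycle:
  assumes "x \<in> set vs"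
  obtains ws where "hd ws = x" "set ws = set vs" "length ws = length vs"
    "distinct ws \<longleftrightarrow> distinct vs" "cycle_edges ws = cycle_edges vs" "ws \<noteq> []"
proof -
  obtain as bs where ab: "vs = as @ x # bs" using assms by (meson split_list)
  have "cycle_edges ((x # bs) @ as) = cycle_edges vs"
  proof (cases "as = []")
    case False
    have "path_edges (as @ (x # bs)) = insert {last as, x} (path_edges as \<union> path_edges (x # bs))"
      "path_edges ((x # bs) @ as) = insert {last (x # bs), hd as} (path_edges (x # bs) \<union> path_edges as)"
      using False path_edges_append[of as "x # bs"] path_edges_append[of "x # bs" as] by simp_all
    moreover have "last (as @ x # bs) = last (x # bs)" "hd (as @ x # bs) = hd as"
      "last ((x # bs) @ as) = last as" "hd ((x # bs) @ as) = x"
      using False by simp_all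
    ultimately show ?thesis unfolding ab cycle_edges_def by (simp only: insert_commute Un_commute)
  qed (simp add: ab)
  then show thesis using that[of "(x # bs) @ as"] ab by auto
qed

lemma is_cycle_rotate:
  assumes "is_cycle E vs" "x \<in> set vs"
  obtains ws where "is_cycle E ws" "hd ws = x" "set ws = set vs" "cycle_edges ws = cycle_edges vs"
    "length ws = length vs"
  using rotate_cycle[OF assms(2)] assms(1) unfolding is_cycle_def by metis

lemma conn_cycle_edges: "conn (set vs) (cycle_edges vs)"
  by (rule conn_mono[OF _ conn_path_edges]) (auto simp: cycle_edges_def)

text \<open>A walk through the closing edge can be rerouted along \<open>path_edges vs\<close>,
  which does not contain that edge.\<close>

lemma conn_remove_cycle_edge:
  assumes "conn V E" "is_cycle E vs"
  shows "conn V (E - {{hd vs, last vs}})"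
proof -
  let ?e = "{hd vs, last vs}"
  have vs: "distinct vs" "length vs \<ge> 3" "path_edges vs \<subseteq> E"
    using assms(2) by (auto simp: is_cycle_def cycle_edges_def)
  then have "path_edges vs \<subseteq> E - {?e}"
    using closing_edge_notin_path[of vs] by (auto simp: insert_commute)
  moreover have "vs \<noteq> []" using vs(2) by auto
  then have "(hd vs, last vs) \<in> reach (path_edges vs)"
    by (intro reach_path_edges last_in_set)
  ultimately have r: "(hd vs, last vs) \<in> reach (E - {?e})" by (rule reach_mono)
  show ?thesis
    unfolding conn_def
  proof (intro ballI)
    fix u v assume "u \<in> V" "v \<in> V"
    then have "(u, v) \<in> reach E" using assms(1) by (simp add: conn_def)
    then show "(u, v) \<in> reach (E - {?e})"
    proof (rule reach_subst)
      fix x y assume "{x, y} \<in> E"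
      then show "(x, y) \<in> reach (E - {?e})"
        using r reach_sym[OF r] by (cases "{x, y} = ?e") (auto simp: doubleton_eq_iff intro: reach_edge)
    qed
  qed
qed

text \<open>A path from \<open>t\<close> to \<open>w\<close> in \<open>E'\<close> avoids the edge
  \<open>{t, w}\<close>, so it has at least three vertices and that edge closes it.\<close>

lemma cycle_through_edge:
  assumes e: "{t, w} \<in> E" "t \<noteq> w" and r: "(t, w) \<in> reach E'" and E': "E' \<subseteq> E - {{t, w}}"
  obtains vs where "is_cycle E vs" "hd vs = t" "last vs = w" "path_edges vs \<subseteq> E'"
proof -
  obtain vs where vs: "vs \<noteq> []" "distinct vs" "hd vs = t" "last vs = w" "path_edges vs \<subseteq> E'"
    using reach_obtain_path[OF r] .
  have "length vs \<ge> 3"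
  proof (rule ccontr)
    assume "\<not> length vs \<ge> 3"
    moreover have "length vs > 0" using vs(1) by simp
    ultimately have "length vs = 1 \<or> length vs = 2" by linarith
    then show False
      using vs e E' by (auto simp: length_Suc_conv numeral_2_eq_2)
  qed
  then show thesis
    using that[of vs] vs e E' by (auto simp: is_cycle_def cycle_edges_def insert_commute)
qed

lemma cycle_exists:
  assumes V: "finite V" "V \<noteq> {}" "E \<subseteq> pairs V" "conn V E" and card: "card V \<le> card E"
  obtains vs where "is_cycle E vs"
proof -
  obtain T where T: "T \<subseteq> E" "sptree V T" using sptree_exists[OF V] .
  then have "T \<noteq> E" using card by (auto simp: sptree_def)
  then obtain t w where tw: "{t, w} \<in> E - T" "t \<noteq> w" "t \<in> V" "w \<in> V"
    using T(1) V(3) by (metis DiffI psubsetI pairsE psubset_imp_ex_mem DiffD1)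
  have "(t, w) \<in> reach T" using T(2) tw by (auto simp: sptree_def conn_def)
  then show thesis using cycle_through_edge[of t w E T] tw T that by blast
qed

lemma is_cycle_mono: "is_cycle E vs \<Longrightarrow> E \<subseteq> E' \<Longrightarrow> is_cycle E' vs"
  by (auto simp: is_cycle_def)

lemma is_cycle_set: "is_cycle E vs \<Longrightarrow> E \<subseteq> pairs V \<Longrightarrow> set vs \<subseteq> V"
proof
  fix v assume c: "is_cycle E vs" "E \<subseteq> pairs V" and v: "v \<in> set vs"
  obtain ws where ws: "is_cycle E ws" "hd ws = v" using is_cycle_rotate[OF c(1) v] by metis
  then have "{last ws, v} \<in> E" by (auto simp: is_cycle_def cycle_edges_def)
  then show "v \<in> V" using pairsD[OF c(2)] by blast
qed

text \<open>Deleting a cycle edge would leave a connected graph with fewer than |V| - 1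
  edges.\<close>

lemma sptree_no_cycle:
  assumes "sptree V T" shows "\<not> is_cycle T vs"
proof
  assume c: "is_cycle T vs"
  let ?e = "{hd vs, last vs}"
  have T: "finite V" "V \<noteq> {}" "T \<subseteq> pairs V" "conn V T" "Suc (card T) = card V"
    using assms by (auto simp: sptree_def)
  have "?e \<in> T" using c by (auto simp: is_cycle_def cycle_edges_def insert_commute)
  moreover have "card V \<le> Suc (card (T - {?e}))"
    by (rule conn_card) (use T conn_remove_cycle_edge[OF T(4) c] in auto)
  ultimately show False
    using T(5) finite_pairs[OF T(1,3)] by (simp add: card_Diff_singleton) (metis card_gt_0_iff empty_iff
        not_less_eq_eq Suc_pred le_refl)
qed

lemma cycle_second:
  assumes "is_cycle E vs"
  obtains y where "{hd vs, y} \<in> path_edges vs" "y \<noteq> last vs"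
proof -
  have vs: "distinct vs" "length vs \<ge> 3" using assms by (auto simp: is_cycle_def)
  obtain x y z ws where xyz: "vs = x # y # z # ws"
    using vs(2) by (metis One_nat_def Suc_le_length_iff numeral_3_eq_3)
  have "last vs \<in> set (z # ws)" unfolding xyz by (metis last_ConsR last_in_set list.distinct(1))
  then show thesis using that[of y] vs xyz by auto
qed

section \<open>Forcing along a spanning tree\<close>

lemma signed_graph_pairs: "signed_graph G \<Longrightarrow> edges G \<subseteq> pairs (verts G)"
  and signed_graph_finite: "signed_graph G \<Longrightarrow> finite (verts G)"
  by (auto simp: signed_graph_def pairs_def)

lemma path_edges_cover: "length vs \<ge> 2 \<Longrightarrow> v \<in> set vs \<Longrightarrow> \<exists>e\<in>path_edges vs. v \<in> e"
proof (induction vs)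
  case (Cons x vs)
  show ?case
  proof (cases vs)
    case (Cons y ws)
    show ?thesis
    proof (cases "v \<in> {x, y}")
      case False
      then have "v \<in> set ws" using Cons.prems Cons by simp
      then have "length vs \<ge> 2" "v \<in> set vs" using Cons by (auto simp: Suc_le_eq length_greater_0_conv[symmetric] simp del: length_greater_0_conv intro: length_pos_if_in_set)
      then show ?thesis using Cons.IH Cons by auto
    qed (use Cons in auto)
  qed (use Cons.prems in simp)
qed simp

text \<open>Does not refer to a root: the same set is used with different rootings of
  \<open>T\<close>, and the choice of the root decides which vertex receives its value by
  propagation.\<close>

definition cut_set :: "'a signed_graph \<Rightarrow> 'a set set \<Rightarrow> 'a set" where
  "cut_set G T = \<Union>(edges G - T) \<union> leaves G"

lemma cut_setI: "{v, w} \<in> edges G - T \<Longrightarrow> v \<in> cut_set G T" "{w, v} \<in> edges G - T \<Longrightarrow> v \<in> cut_set G T"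
  by (auto simp: cut_set_def)

lemma cut_set_subset: "signed_graph G \<Longrightarrow> cut_set G T \<subseteq> verts G"
  by (auto simp: cut_set_def leaves_def signed_graph_def)

text \<open>In \<open>T\<close> such a vertex meets only its parent edge. Either this is its only
  edge in \<open>G\<close>, or it is an end of an edge outside \<open>T\<close>.\<close>

lemma childless_in_cut_set:
  assumes G: "signed_graph G" and T: "rooted (verts G) T r par d" "T \<subseteq> edges G"
    and v: "v \<in> verts G" "v \<noteq> r" and childless: "\<And>u. u \<in> verts G \<Longrightarrow> u \<noteq> r \<Longrightarrow> par u \<noteq> v"
  shows "v \<in> cut_set G T"
proof (rule ccontr)
  assume nv: "v \<notin> cut_set G T"
  have "{e \<in> edges G. v \<in> e} = {{v, par v}}"
  proof (intro equalityI subsetI)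
    fix e assume "e \<in> {e \<in> edges G. v \<in> e}"
    then obtain w where e: "e = {v, w}" "e \<in> edges G"
      using pairsE[OF signed_graph_pairs[OF G], of e] by (metis (no_types, lifting) doubleton_eq_iff empty_iff insertE mem_Collect_eq)
    then have "{v, w} \<in> T" using nv cut_setI(1)[of v w G T] by blast
    then show "e \<in> {{v, par v}}" using rooted_edge[OF T(1), of v w] childless e by auto
  qed (use rooted_par[OF T(1) v] T(2) in auto)
  then have "vertex_degree G v = 1" by (simp add: vertex_degree_def)
  then show False using nv v by (simp add: cut_set_def leaves_def)
qed

lemma force_parent:
  assumes G: "signed_graph G" and f: "null_fun G f"
    and T: "rooted (verts G) T r par d" "T \<subseteq> edges G" and v: "v \<in> verts G" "v \<noteq> r"
    and children: "\<And>u. u \<in> verts G \<Longrightarrow> u \<noteq> r \<Longrightarrow> par u = v \<Longrightarrow> f u = 0"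
    and off: "\<And>w. {v, w} \<in> edges G - T \<Longrightarrow> f w = 0"
  shows "f (par v) = 0"
proof (rule null_fun_force[OF G f])
  show "{v, par v} \<in> edges G" using rooted_par[OF T(1) v] T(2) by auto
  show "f w = 0" if "{v, w} \<in> edges G" "w \<noteq> par v" for w
    using that off[of w] children[of w] rooted_edge[OF T(1), of v w] by blast
qed

text \<open>At a deepest vertex \<open>z\<close> of \<open>D\<close> with nonzero value, take a
  child \<open>u\<close>: the children of \<open>u\<close> are deeper still and the neighbours of
  \<open>u\<close> outside the tree are zero by \<open>off\<close>, so the equation at
  \<open>u\<close> forces \<open>f z = 0\<close>. The vertices \<open>w\<close> in
  \<open>off\<close> may lie outside \<open>D\<close>; this is the condition to be checked whenever
  part of the cut set is given up.\<close>

lemma branch_zero: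
  assumes G: "signed_graph G" and f: "null_fun G f"
    and T: "rooted (verts G) T r par d" "T \<subseteq> edges G" and D: "D \<subseteq> verts G"
    and closed: "\<And>v. v \<in> verts G \<Longrightarrow> v \<noteq> r \<Longrightarrow> par v \<in> D \<Longrightarrow> v \<in> D"
    and childless: "\<And>v. v \<in> D \<Longrightarrow> (\<And>u. u \<in> verts G \<Longrightarrow> u \<noteq> r \<Longrightarrow> par u \<noteq> v) \<Longrightarrow> f v = 0"
    and off: "\<And>v w. v \<in> D \<Longrightarrow> {v, w} \<in> edges G - T \<Longrightarrow> f w = 0"
  shows "v \<in> D \<Longrightarrow> f v = 0" and "v \<in> D \<Longrightarrow> v \<noteq> r \<Longrightarrow> f (par v) = 0"
proof -
  have zero: "f v = 0" if "v \<in> D" for v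
  proof (rule ccontr)
    assume "f v \<noteq> 0"
    then have "{v \<in> D. f v \<noteq> 0} \<noteq> {}" using that by auto
    moreover have fin: "finite {v \<in> D. f v \<noteq> 0}"
      using D signed_graph_finite[OF G] finite_subset by fastforce
    ultimately have "Max (d ` {v \<in> D. f v \<noteq> 0}) \<in> d ` {v \<in> D. f v \<noteq> 0}" by (intro Max_in) auto
    then obtain z where z: "z \<in> D" "f z \<noteq> 0" "d z = Max (d ` {v \<in> D. f v \<noteq> 0})" by auto
    have deeper: "f y = 0" if "y \<in> D" "d y > d z" for y
    proof (rule ccontr)
      assume "f y \<noteq> 0"
      then have "d y \<le> Max (d ` {v \<in> D. f v \<noteq> 0})" using that fin by (intro Max_ge) auto
      then show False using that z by simp
    qed
    obtain u where u: "u \<in> verts G" "u \<noteq> r" "par u = z" using childless[OF z(1)] z(2) by blast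
    then have uD: "u \<in> D" using closed z(1) by blast
    have "f (par u) = 0"
    proof (rule force_parent[OF G f T u(1,2)])
      show "f w = 0" if "w \<in> verts G" "w \<noteq> r" "par w = u" for w
        using deeper[of w] closed[of w] that uD u rooted_par[OF T(1), of w] rooted_par[OF T(1), of u] by auto
      show "f w = 0" if "{u, w} \<in> edges G - T" for w using off[OF uD that] .
    qed
    then show False using z u by simp
  qed
  show "v \<in> D \<Longrightarrow> f v = 0" by (rule zero)
  assume v: "v \<in> D" "v \<noteq> r"
  show "f (par v) = 0"
    by (rule force_parent[OF G f T _ v(2)]) (use v D zero closed off in auto)
qed

lemma childless_exists:
  assumes R: "rooted V T r par d" and Y: "finite Y" "Y \<noteq> {}"
    and closed: "\<And>v. v \<in> V \<Longrightarrow> v \<noteq> r \<Longrightarrow> par v \<in> Y \<Longrightarrow> v \<in> Y"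
  obtains t where "t \<in> Y" "\<And>u. u \<in> V \<Longrightarrow> u \<noteq> r \<Longrightarrow> par u \<noteq> t"
proof -
  have "Max (d ` Y) \<in> d ` Y" using Y by (intro Max_in) auto
  then obtain t where t: "t \<in> Y" "d t = Max (d ` Y)" by auto
  have "par u \<noteq> t" if u: "u \<in> V" "u \<noteq> r" for u
  proof
    assume "par u = t"
    then have "d u \<le> Max (d ` Y)" using closed[OF u] t(1) Y(1) by simp
    then show False using rooted_par[OF R u] \<open>par u = t\<close> t(2) by simp
  qed
  then show thesis using that t(1) by blast
qed

lemma root_has_child:
  assumes T: "rooted V T r par d" and "v \<in> V" "v \<noteq> r"
  shows "\<exists>u\<in>V. u \<noteq> r \<and> par u = r"
proof -
  have T': "conn V T" "T \<subseteq> pairs V" "r \<in> V"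
    using rooted_sptree[OF T] T by (auto simp: sptree_def rooted_def)
  obtain u where "{r, u} \<in> T" using conn_neighbour[OF T'(1,2,3) assms(2,3)] by blast
  then show ?thesis using rooted_edge[OF T, of r u] by auto
qed

text \<open>Two distinct vertices are demanded because a single isolated vertex has nullity 1 and an
  empty cut set. With them the root has a child, so every childless vertex lies in the cut
  set.\<close>

lemma cut_set_forcing:
  assumes G: "signed_graph G" and T: "sptree (verts G) T" "T \<subseteq> edges G"
    and uv: "u \<in> verts G" "v \<in> verts G" "u \<noteq> v"
  shows "forcing G (cut_set G T)"
  unfolding forcing_def
proof (intro allI impI ballI)
  fix f x assume f: "null_fun G f" "\<forall>s\<in>cut_set G T. f s = 0" and x: "x \<in> verts G"
  obtain par d where R: "rooted (verts G) T u par d" using sptree_rooted[OF T(1) uv(1)] .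
  show "f x = 0"
  proof (rule branch_zero(1)[OF G f(1) R T(2), of "verts G"])
    fix y assume "y \<in> verts G" "\<And>z. z \<in> verts G \<Longrightarrow> z \<noteq> u \<Longrightarrow> par z \<noteq> y"
    then show "f y = 0"
      using childless_in_cut_set[OF G R T(2)] root_has_child[OF R uv(2)] uv f(2) by metis
  next
    show "f w = 0" if "{v, w} \<in> edges G - T" for v w using f(2) cut_setI(2)[OF that] by blast
  qed (use x in auto)
qed

lemma leaf_edge_in_sptree:
  assumes G: "signed_graph G" and T: "sptree (verts G) T" "T \<subseteq> edges G" and r: "r \<in> leaves G"
  shows "\<exists>u. {u, r} \<in> T" and "\<And>e. e \<in> edges G - T \<Longrightarrow> r \<notin> e"
proof -
  have rV: "r \<in> verts G" and "card {e \<in> edges G. r \<in> e} = 1"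
    using r by (auto simp: leaves_def vertex_degree_def)
  then obtain e where e: "{e \<in> edges G. r \<in> e} = {e}" by (auto simp: card_1_singleton_iff)
  then have "e \<in> {e \<in> edges G. r \<in> e}" by simp
  then have "e \<in> edges G" "r \<in> e" by simp_all
  then obtain w where w: "e = {r, w}" "w \<in> verts G" "w \<noteq> r"
    using pairsE[OF signed_graph_pairs[OF G]] by (metis doubleton_eq_iff insertE singletonD)
  obtain u where u: "{r, u} \<in> T"
    using conn_neighbour[of "verts G" T r w] T w rV by (auto simp: sptree_def)
  then show "\<exists>u. {u, r} \<in> T" by (auto simp: insert_commute)
  have "{r, u} \<in> {e \<in> edges G. r \<in> e}" using u T(2) by blast
  then have re: "{r, u} = e" unfolding e by simp
  show "r \<notin> e'" if "e' \<in> edges G - T" for e'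
  proof
    assume "r \<in> e'"
    then have "e' \<in> {e \<in> edges G. r \<in> e}" using that by simp
    then have "e' = e" unfolding e by simp
    then show False using that u re by simp
  qed
qed

text \<open>Root the tree at the leaf itself. It meets no edge outside \<open>T\<close>, so
  propagation below it is undisturbed and finally reaches it from its child.\<close>

lemma cut_set_forcing_drop_leaf:
  assumes G: "signed_graph G" and T: "sptree (verts G) T" "T \<subseteq> edges G" and r: "r \<in> leaves G"
  shows "forcing G (cut_set G T - {r})"
  unfolding forcing_def
proof (intro allI impI ballI)
  fix f x assume f: "null_fun G f" "\<forall>s\<in>cut_set G T - {r}. f s = 0" and x: "x \<in> verts G"
  have rV: "r \<in> verts G" using r by (simp add: leaves_def)
  obtain par d where R: "rooted (verts G) T r par d" using sptree_rooted[OF T(1) rV] .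
  note off = leaf_edge_in_sptree(2)[OF G T r]
  have *: "f y = 0" "y \<noteq> r \<Longrightarrow> f (par y) = 0" if y: "y \<in> verts G - {r}" for y
  proof -
    have closed: "v \<in> verts G - {r}" if "v \<in> verts G" "v \<noteq> r" for v using that by simp
    have childless: "f v = 0" if "v \<in> verts G - {r}" "\<And>u. u \<in> verts G \<Longrightarrow> u \<noteq> r \<Longrightarrow> par u \<noteq> v" for v
      using childless_in_cut_set[OF G R T(2), of v] f(2) that by auto
    have off: "f w = 0" if "{v, w} \<in> edges G - T" for v w
      using cut_setI(2)[OF that] off[OF that] f(2) by auto
    show "f y = 0"
      by (rule branch_zero(1)[OF G f(1) R T(2) _ closed childless off y]) auto
    show "f (par y) = 0" if "y \<noteq> r"
      by (rule branch_zero(2)[OF G f(1) R T(2) _ closed childless off y that]) auto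
  qed
  obtain u where "{u, r} \<in> T" using leaf_edge_in_sptree(1)[OF G T r] by blast
  then have "u \<in> verts G" "u \<noteq> r" "par u = r" using rooted_edge[OF R, of u r] by auto
  then have "f r = 0" using *(2)[of u] by auto
  then show "f x = 0" using *(1) x by (cases "x = r") auto
qed

text \<open>The parent relation is single-valued, so the ancestors of \<open>w\<close> form a chain,
  and a chain ending in the root passes through one child of it.\<close>

lemma ancestors_child_unique:
  assumes R: "rooted V T r par d" and u: "u \<in> ancestors V r par w" "v \<in> ancestors V r par w"
    "u \<noteq> r" "par u = r" "v \<noteq> r" "par v = r"
  shows "u = v"
proof -
  define R where "R = {(v, par v) | v. v \<in> V - {r}}"
  have *: "y = x" if "(x, y) \<in> R\<^sup>*" "par x = r" "y \<noteq> r" for x y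
    using that(1)
  proof (cases rule: converse_rtranclE)
    case (step z)
    then have "z = r" using that(2) by (auto simp: R_def)
    then have "(r, y) \<in> R\<^sup>*" using step by simp
    then show ?thesis by (cases rule: converse_rtranclE) (use that in \<open>auto simp: R_def\<close>)
  qed simp
  have "single_valued R" by (auto simp: R_def single_valued_def)
  then have "(u, v) \<in> R\<^sup>* \<or> (v, u) \<in> R\<^sup>*"
    by (rule single_valued_confluent) (use u(1,2) in \<open>simp_all add: ancestors_def R_def\<close>)
  then show ?thesis using *[of u v] *[of v u] u by auto
qed

text \<open>Root the tree at \<open>y\<close>. Only one child of \<open>y\<close> is an ancestor of
  \<open>w\<close>, so another child \<open>v\<close> is not. The vertices that are not ancestors of
  \<open>w\<close> are closed under children, and none is joined to \<open>y\<close> outside the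
  tree, since \<open>w\<close> is the only such neighbour of \<open>y\<close>. Hence zeros propagate
  up to \<open>v\<close> and then to \<open>y\<close> without assuming
  \<open>f y = 0\<close>.\<close>

lemma cut_set_forcing_drop_major:
  assumes G: "signed_graph G" and T: "sptree (verts G) T" "T \<subseteq> edges G"
    and y: "{y, w} \<in> edges G - T" and unique: "\<And>x. {y, x} \<in> edges G - T \<Longrightarrow> x = w"
    and u: "{y, u1} \<in> T" "{y, u2} \<in> T" "u1 \<noteq> u2"
  shows "forcing G (cut_set G T - {y})"
  unfolding forcing_def
proof (intro allI impI)
  fix f assume f: "null_fun G f" "\<forall>s\<in>cut_set G T - {y}. f s = 0"
  have yw: "y \<in> verts G" "w \<in> verts G" "y \<noteq> w" using y pairsD[OF signed_graph_pairs[OF G], of y w] by auto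
  obtain par d where R: "rooted (verts G) T y par d" using sptree_rooted[OF T(1) yw(1)] .
  let ?A = "ancestors (verts G) y par w"
  note yA = root_in_ancestors[OF R yw(2)]
  have ch: "u1 \<in> verts G" "u1 \<noteq> y" "par u1 = y" "u2 \<in> verts G" "u2 \<noteq> y" "par u2 = y"
    using rooted_edge[OF R u(1)] rooted_edge[OF R u(2)] by auto
  then obtain v where v: "v \<in> verts G - ?A" "v \<noteq> y" "par v = y"
    using ancestors_child_unique[OF R, of u1 w u2] u(3) by blast
  have "f (par v) = 0"
  proof (rule branch_zero(2)[OF G f(1) R T(2) _ _ _ _ v(1,2)])
    show "z \<in> verts G - ?A" if "z \<in> verts G" "z \<noteq> y" "par z \<in> verts G - ?A" for z
      using that ancestors_par[of z "verts G" y par w] by auto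
    show "f z = 0" if "z \<in> verts G - ?A" "\<And>u. u \<in> verts G \<Longrightarrow> u \<noteq> y \<Longrightarrow> par u \<noteq> z" for z
      using childless_in_cut_set[OF G R T(2), of z] that yA f(2) by auto
    show "f x = 0" if "z \<in> verts G - ?A" "{z, x} \<in> edges G - T" for z x
    proof -
      have "x \<noteq> y" using unique[of z] that ancestors_refl[of w "verts G" y par]
        by (auto simp: insert_commute)
      then show ?thesis using f(2) cut_setI(2)[OF that(2)] by auto
    qed
  qed auto
  then have "\<forall>s\<in>cut_set G T. f s = 0" using f(2) v(3) by auto
  then show "\<forall>v\<in>verts G. f v = 0"
    using cut_set_forcing[OF G T yw] f(1) by (auto simp: forcing_def)
qed

section \<open>Branches: the side \<open>Y\<close> of a bridge with inner end \<open>c\<close> and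
  outer end \<open>x\<close>\<close>

definition branch :: "'a signed_graph \<Rightarrow> 'a set \<Rightarrow> 'a \<Rightarrow> 'a \<Rightarrow> bool" where
  "branch G Y x c \<longleftrightarrow> Y \<subseteq> verts G \<and> c \<in> Y \<and> x \<in> verts G \<and> x \<notin> Y \<and> {x, c} \<in> edges G
     \<and> (\<forall>u\<in>Y. \<forall>v\<in>verts G - Y. {u, v} \<in> edges G \<longrightarrow> {u, v} = {x, c})"

lemma branch_crossing:
  "branch G Y x c \<Longrightarrow> u \<in> Y \<Longrightarrow> {u, v} \<in> edges G \<Longrightarrow> v \<in> verts G \<Longrightarrow> v \<notin> Y \<Longrightarrow> {u, v} = {x, c}"
  by (simp add: branch_def)

lemma branch_edge_in_conn:
  assumes "branch G Y x c" "conn (verts G) T" "T \<subseteq> edges G" "T \<subseteq> pairs (verts G)"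
  shows "{x, c} \<in> T"
proof -
  obtain u v where "u \<in> Y" "v \<in> verts G" "v \<notin> Y" "{u, v} \<in> T"
    using conn_cut[OF assms(2,4), of c Y x] assms(1) by (auto simp: branch_def)
  then show ?thesis using assms(1,3) by (auto simp: branch_def)
qed

lemma branch_children_closed:
  assumes "branch G Y x c" "rooted (verts G) T x par d" "T \<subseteq> edges G"
    "v \<in> verts G" "v \<noteq> x" "par v \<in> Y"
  shows "v \<in> Y"
proof (rule rooted_children_closed[OF assms(2) _ _ _ assms(4-6), where e = "{x, c}"])
  show "{u, w} = {x, c}" if "u \<in> Y" "w \<in> verts G" "{u, w} \<in> T" "w \<notin> Y" for u w
    by (rule branch_crossing[OF assms(1)]) (use that assms(3) in blast)+
qed (use assms(1) in \<open>auto simp: branch_def\<close>)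

text \<open>With the root at \<open>x\<close> the branch is closed under children. The bridge lies
  in every spanning tree, so edges outside \<open>T\<close> that start in \<open>Y\<close> also end
  in \<open>Y\<close>. The zeros prescribed inside the branch thus suffice to propagate up to
  \<open>c\<close> and across the bridge to \<open>x\<close>.\<close>

lemma branch_forces:
  assumes G: "signed_graph G" and T: "sptree (verts G) T" "T \<subseteq> edges G" and Y: "branch G Y x c"
    and f: "null_fun G f" "\<And>s. s \<in> cut_set G T \<inter> Y \<Longrightarrow> f s = 0"
  shows "f x = 0"
proof -
  have Y': "Y \<subseteq> verts G" "c \<in> Y" "x \<in> verts G" "x \<notin> Y" using Y by (auto simp: branch_def)
  obtain par d where R: "rooted (verts G) T x par d" using sptree_rooted[OF T(1) Y'(3)] .
  have xc: "{x, c} \<in> T" using branch_edge_in_conn[OF Y] T by (auto simp: sptree_def)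
  have closed: "v \<in> Y" if "v \<in> verts G" "v \<noteq> x" "par v \<in> Y" for v
    using branch_children_closed[OF Y R T(2) that] .
  have childless: "f v = 0" if "v \<in> Y" "\<And>u. u \<in> verts G \<Longrightarrow> u \<noteq> x \<Longrightarrow> par u \<noteq> v" for v
    using childless_in_cut_set[OF G R T(2), of v] f(2)[of v] that Y' by auto
  have off: "f w = 0" if v: "v \<in> Y" and vw: "{v, w} \<in> edges G - T" for v w
  proof -
    have "w \<in> verts G" using vw pairsD[OF signed_graph_pairs[OF G], of v w] by auto
    then have "w \<in> Y" using v vw xc branch_crossing[OF Y, of v w] by (metis DiffD1 DiffD2)
    then show ?thesis using f(2)[of w] cut_setI(2)[OF vw] by auto
  qed
  have "f (par c) = 0"
    by (rule branch_zero(2)[OF G f(1) R T(2) Y'(1) closed childless off Y'(2)]) (use Y' in auto)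
  moreover have "par c = x" using rooted_edge[OF R xc] by auto
  ultimately show ?thesis by simp
qed

text \<open>A deepest vertex of the branch is childless, hence in the cut set: it is a leaf, or an
  edge outside the tree starts there. Such an edge stays in the branch, and the tree closes it to a
  cycle inside.\<close>

lemma branch_leaf_or_cycle:
  assumes G: "signed_graph G" and c: "conn (verts G) (edges G)" and Y: "branch G Y x c"
  obtains s where "s \<in> Y" "s \<in> leaves G" | vs where "is_cycle (edges G) vs" "set vs \<subseteq> Y"
proof -
  have Y': "Y \<subseteq> verts G" "c \<in> Y" "x \<in> verts G" "x \<notin> Y" using Y by (auto simp: branch_def)
  note fin = signed_graph_finite[OF G] and prs = signed_graph_pairs[OF G]
  obtain T par d where T: "T \<subseteq> edges G" "rooted (verts G) T x par d"
    using breadth_first_tree[OF fin prs c Y'(3)] .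
  have xc: "{x, c} \<in> T"
    using branch_edge_in_conn[OF Y] rooted_sptree[OF T(2)] T(1) by (auto simp: sptree_def)
  have "finite Y" "Y \<noteq> {}" using Y' fin finite_subset by auto
  then obtain t where t: "t \<in> Y" and childless: "\<And>u. u \<in> verts G \<Longrightarrow> u \<noteq> x \<Longrightarrow> par u \<noteq> t"
    using childless_exists[OF T(2)] branch_children_closed[OF Y T(2,1)] by metis
  have tV: "t \<in> verts G" "t \<noteq> x" using t Y' by auto
  have "t \<in> cut_set G T" by (rule childless_in_cut_set[OF G T(2,1) tV]) (use childless in auto)
  then consider "t \<in> leaves G" | e where "e \<in> edges G - T" "t \<in> e" by (auto simp: cut_set_def)
  then show thesis
  proof cases
    case 1 then show ?thesis using that t by blast
  next
    case 2
    then obtain w where w: "{t, w} \<in> edges G - T" "t \<noteq> w" "w \<in> verts G"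
      using pairsE[OF prs, of e] by (metis DiffD1 doubleton_eq_iff insertE singletonD)
    have wY: "w \<in> Y" using w(1,3) xc t branch_crossing[OF Y, of t w] by (metis DiffD1 DiffD2)
    \<comment> \<open>Climbing towards the root \<open>x\<close> from a vertex of \<open>Y\<close>
      can leave \<open>Y\<close> only at \<open>c\<close>, so any two vertices of \<open>Y\<close>
      are joined through \<open>c\<close> by tree edges inside \<open>Y\<close>.\<close>
    define E' where "E' = T \<inter> Pow Y"
    have toc: "(y, c) \<in> reach E'" if "y \<in> Y" for y
      using that
    proof (induction "d y" arbitrary: y rule: less_induct)
      case less
      show ?case
      proof (cases "y = c")
        case False
        have py: "par y \<in> verts G" "d (par y) < d y" "{y, par y} \<in> T"
          using rooted_par[OF T(2), of y] less(2) Y' by auto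
        have "par y \<in> Y"
        proof (rule ccontr)
          assume "par y \<notin> Y"
          then have "{y, par y} = {x, c}"
            by (intro branch_crossing[OF Y less(2)]) (use py T(1) in auto)
          then show False using less(2) False Y' by (auto simp: doubleton_eq_iff)
        qed
        then have "{y, par y} \<in> E'" using py less(2) by (auto simp: E'_def)
        then show ?thesis using less(1)[OF py(2) \<open>par y \<in> Y\<close>] by (auto intro: reach_edge reach_trans)
      qed simp
    qed
    have "(t, w) \<in> reach E'" using toc[OF t] toc[OF wY] by (meson reach_sym reach_trans)
    moreover have "E' \<subseteq> edges G - {{t, w}}" "{t, w} \<in> edges G" using w T(1) by (auto simp: E'_def)
    ultimately obtain vs where vs: "is_cycle (edges G) vs" "path_edges vs \<subseteq> E'"
      using cycle_through_edge[of t w "edges G" E'] w(2) by metis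
    have "set vs \<subseteq> Y"
      using path_edges_cover[of vs] vs by (fastforce simp: is_cycle_def E'_def)
    then show ?thesis using that vs by blast
  qed
qed

section \<open>Kernel functions supported on a cycle\<close>

definition cycle_of :: "'a signed_graph \<Rightarrow> 'a list \<Rightarrow> 'a signed_graph" where
  "cycle_of G vs = \<lparr>verts = set vs, edges = cycle_edges vs, edge_sign = edge_sign G\<rparr>"

lemma cycle_of_simps [simp]: "verts (cycle_of G vs) = set vs" "edges (cycle_of G vs) = cycle_edges vs"
  "edge_sign (cycle_of G vs) = edge_sign G"
  by (auto simp: cycle_of_def)

lemma null_fun_cycle_of:
  assumes G: "signed_graph G" and vs: "is_cycle (edges G) vs" and f: "null_fun G f"
    and out: "\<And>v. v \<in> verts G - set vs \<Longrightarrow> f v = 0"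
    and chord: "\<And>u v. u \<in> set vs \<Longrightarrow> v \<in> set vs \<Longrightarrow> {u, v} \<in> edges G - cycle_edges vs \<Longrightarrow> f v = 0"
  shows "null_fun (cycle_of G vs) f"
  unfolding null_fun_def
proof
  fix v assume v: "v \<in> verts (cycle_of G vs)"
  have sub: "set vs \<subseteq> verts G" using is_cycle_set[OF vs signed_graph_pairs[OF G]] .
  have sub': "cycle_edges vs \<subseteq> edges G" using vs by (simp add: is_cycle_def)
  have "(\<Sum>u\<in>set vs. weight (cycle_of G vs) v u * f u) = (\<Sum>u\<in>set vs. weight G v u * f u)"
    using v chord[of v] sub' by (intro sum.cong) (auto simp: weight_def)
  also have "\<dots> = (\<Sum>u\<in>verts G. weight G v u * f u)"
    using sub out signed_graph_finite[OF G] by (intro sum.mono_neutral_left) auto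
  also have "\<dots> = 0" using f v sub by (auto simp: null_fun_def)
  finally show "(\<Sum>u\<in>verts (cycle_of G vs). weight (cycle_of G vs) v u * f u) = 0" by simp
qed

text \<open>Root the tree at the last vertex of the cycle. The path along the cycle is a connected
  part of \<open>T\<close> containing the root, so the vertices off the cycle are closed under
  children. By \<open>unique\<close> the possibly nonzero root is joined outside \<open>T\<close> to
  the head only, so zeros propagate through everything off the cycle. A chord is never in
  \<open>T\<close> and never ends in the root, so its ends are zero by assumption and the kernel
  equations restrict to the cycle.\<close>

lemma null_fun_concentrates_on_cycle:
  assumes G: "signed_graph G" and T: "sptree (verts G) T" "T \<subseteq> edges G"
    and vs: "is_cycle (edges G) vs" "path_edges vs \<subseteq> T"
    and unique: "\<And>w. {last vs, w} \<in> edges G - T \<Longrightarrow> w = hd vs"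
    and f: "null_fun G f" "\<And>s. s \<in> cut_set G T \<Longrightarrow> s \<noteq> last vs \<Longrightarrow> f s = 0"
  shows "null_fun (cycle_of G vs) f" and "v \<in> verts G - set vs \<Longrightarrow> f v = 0"
proof -
  let ?a = "last vs"
  have vs': "distinct vs" "length vs \<ge> 3" "vs \<noteq> []" using vs(1) by (auto simp: is_cycle_def)
  have sub: "set vs \<subseteq> verts G" using is_cycle_set[OF vs(1) signed_graph_pairs[OF G]] .
  have a: "?a \<in> verts G" "?a \<in> set vs" using sub vs' by auto
  obtain par d where R: "rooted (verts G) T ?a par d" using sptree_rooted[OF T(1) a(1)] .
  have up: "{z, par z} \<in> path_edges vs" "par z \<in> set vs" if "z \<in> set vs" "z \<noteq> ?a" for z
    using parent_in_connected_part[OF R conn_path_edges vs(2) path_edges_pairs[OF vs'(1)] sub a(2) that]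
    by auto
  have zero: "f v = 0" if "v \<in> verts G - set vs" for v
  proof (rule branch_zero(1)[OF G f(1) R T(2) _ _ _ _ that])
    show "z \<in> verts G - set vs" if "z \<in> verts G" "z \<noteq> ?a" "par z \<in> verts G - set vs" for z
      using that up(2)[of z] by auto
    show "f z = 0" if "z \<in> verts G - set vs" "\<And>u. u \<in> verts G \<Longrightarrow> u \<noteq> ?a \<Longrightarrow> par u \<noteq> z" for z
      using childless_in_cut_set[OF G R T(2), of z] that a f(2) by auto
    show "f w = 0" if "z \<in> verts G - set vs" "{z, w} \<in> edges G - T" for z w
    proof -
      have "w \<noteq> ?a" using unique[of z] that vs' by (auto simp: insert_commute)
      then show ?thesis using f(2) cut_setI(2)[OF that(2)] by auto
    qed
  qed auto
  then show "v \<in> verts G - set vs \<Longrightarrow> f v = 0" .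
  show "null_fun (cycle_of G vs) f"
  proof (rule null_fun_cycle_of[OF G vs(1) f(1) zero])
    fix u v assume uv: "u \<in> set vs" "v \<in> set vs" "{u, v} \<in> edges G - cycle_edges vs"
    have "{u, v} \<notin> T"
    proof
      assume "{u, v} \<in> T"
      then have "{u, v} \<in> path_edges vs"
        using rooted_edge[OF R, of u v] up[of u] up[of v] uv by (auto simp: insert_commute)
      then show False using uv by (simp add: cycle_edges_def)
    qed
    then have F: "{u, v} \<in> edges G - T" using uv by blast
    moreover have "v \<noteq> ?a"
      using unique[of u] F uv by (auto simp: cycle_edges_def insert_commute)
    ultimately show "f v = 0" using f(2) cut_setI(2)[OF F] by auto
  qed auto
qed

section \<open>Nullity of signed cycles\<close>

lemma nullity_cong:
  assumes "verts H = verts G" "edges H = edges G"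
    "\<And>e. e \<in> edges G \<Longrightarrow> edge_sign H e = edge_sign G e"
  shows "nullity H = nullity G"
proof -
  have "adj_matrix H vs = adj_matrix G vs" for vs
    by (rule eq_matI) (use assms in \<open>auto simp: adj_matrix_def\<close>)
  then show ?thesis by (simp add: nullity_def assms(1))
qed

lemma signed_cycle_subgraph:
  assumes "signed_cycle n C" "signed_subgraph C G"
  obtains vs where "is_cycle (edges G) vs" "verts C = set vs" "edges C = cycle_edges vs"
    "length vs = n" "nullity C = nullity (cycle_of G vs)"
proof -
  obtain vs where vs: "distinct vs" "length vs = n" "n \<ge> 3" "verts C = set vs" "edges C = cycle_edges vs"
    using assms(1) by (auto simp: signed_cycle_def)
  moreover have "nullity C = nullity (cycle_of G vs)"
    by (rule nullity_cong) (use vs assms(2) in \<open>auto simp: signed_subgraph_def\<close>)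
  ultimately show thesis
    using that[of vs] assms(2) by (auto simp: is_cycle_def signed_subgraph_def)
qed

lemma cycle_of_signed_cycle:
  assumes G: "signed_graph G" and vs: "is_cycle (edges G) vs"
  shows "signed_cycle (length vs) (cycle_of G vs)" "signed_subgraph (cycle_of G vs) G"
proof -
  have vs': "distinct vs" "length vs \<ge> 3" "cycle_edges vs \<subseteq> edges G" using vs by (auto simp: is_cycle_def)
  have *: "signed_graph (cycle_of G vs)"
    using cycle_edges_pairs[OF vs'(1,2)] vs'(3) G
    by (auto simp: signed_graph_def pairs_def)
  then show "signed_cycle (length vs) (cycle_of G vs)"
    using vs' by (auto simp: signed_cycle_def)
  show "signed_subgraph (cycle_of G vs) G"
    using * vs'(3) is_cycle_set[OF vs signed_graph_pairs[OF G]] by (auto simp: signed_subgraph_def)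
qed

text \<open>The action of the adjacency matrix with vertex set and edge set as separate parameters,
  so that it can be split along a decomposition of the edges.\<close>

definition adj :: "'a signed_graph \<Rightarrow> 'a set \<Rightarrow> 'a set set \<Rightarrow> ('a \<Rightarrow> real) \<Rightarrow> 'a \<Rightarrow> real" where
  "adj G W F f v = (\<Sum>u\<in>W. if {v, u} \<in> F then edge_sign G {v, u} * f u else 0)"

lemma null_fun_adj: "null_fun G f \<longleftrightarrow> (\<forall>v\<in>verts G. adj G (verts G) (edges G) f v = 0)"
  by (auto simp: null_fun_def adj_def weight_def if_distrib[of "\<lambda>x. x * _"] cong: if_cong)

lemma null_fun_cycle_of_adj:
  "null_fun (cycle_of G vs) f \<longleftrightarrow> (\<forall>v\<in>set vs. adj G (set vs) (cycle_edges vs) f v = 0)"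
  by (simp add: null_fun_adj adj_def cong: if_cong)

lemma adj_enlarge:
  assumes "F \<subseteq> pairs W" "W \<subseteq> W'" "finite W'"
  shows "adj G W' F f v = adj G W F f v"
  unfolding adj_def
  by (rule sum.mono_neutral_right) (use assms pairsD[OF assms(1)] in auto)

lemma adj_outside: "F \<subseteq> pairs W \<Longrightarrow> v \<notin> W \<Longrightarrow> adj G W' F f v = 0"
  unfolding adj_def by (rule sum.neutral) (auto dest: pairsD)

lemma adj_cong: "(\<And>u. u \<in> W \<Longrightarrow> f u = g u) \<Longrightarrow> adj G W F f v = adj G W F g v"
  unfolding adj_def by (rule sum.cong) auto

lemma adj_Un: "F1 \<inter> F2 = {} \<Longrightarrow> adj G W (F1 \<union> F2) f v = adj G W F1 f v + adj G W F2 f v"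
  unfolding adj_def sum.distrib[symmetric] by (rule sum.cong) auto

lemma edge_in_path_edges:
  assumes "distinct vs" "i < length vs" "j < length vs"
  shows "{vs ! i, vs ! j} \<in> path_edges vs \<longleftrightarrow> j = Suc i \<or> i = Suc j"
proof
  assume "{vs ! i, vs ! j} \<in> path_edges vs"
  then obtain k where "Suc k < length vs" "{vs ! i, vs ! j} = {vs ! k, vs ! Suc k}"
    by (auto simp: path_edges_def)
  then show "j = Suc i \<or> i = Suc j"
    using assms by (auto simp: doubleton_eq_iff nth_eq_iff_index_eq)
next
  assume "j = Suc i \<or> i = Suc j"
  then show "{vs ! i, vs ! j} \<in> path_edges vs"
    using assms by (auto simp: path_edges_def insert_commute)
qed

definition step_sign :: "'a signed_graph \<Rightarrow> 'a list \<Rightarrow> nat \<Rightarrow> real" where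
  "step_sign G vs i = edge_sign G {vs ! i, vs ! Suc i}"

lemma sum_list_index:
  assumes "distinct vs"
  shows "(\<Sum>u\<in>set vs. g u) = (\<Sum>j<length vs. g (vs ! j))"
  using sum.reindex_bij_betw[OF bij_betw_nth[OF assms refl refl], of g] by simp

lemma adj_path:
  assumes vs: "distinct vs" and i: "i < length vs"
  shows "adj G (set vs) (path_edges vs) f (vs ! i) =
    (if i > 0 then step_sign G vs (i - 1) * f (vs ! (i - 1)) else 0)
    + (if Suc i < length vs then step_sign G vs i * f (vs ! Suc i) else 0)"
proof -
  have "adj G (set vs) (path_edges vs) f (vs ! i) = (\<Sum>j<length vs.
      (if Suc j = i then step_sign G vs j * f (vs ! j) else 0)
      + (if j = Suc i then step_sign G vs i * f (vs ! Suc i) else 0))"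
    unfolding adj_def sum_list_index[OF vs]
    by (rule sum.cong) (use vs i in \<open>auto simp: edge_in_path_edges step_sign_def insert_commute\<close>)
  also have "\<dots> = (\<Sum>j<length vs. if Suc j = i then step_sign G vs j * f (vs ! j) else 0)
      + (\<Sum>j<length vs. if j = Suc i then step_sign G vs i * f (vs ! Suc i) else 0)"
    by (rule sum.distrib)
  also have "(\<Sum>j<length vs. if j = Suc i then step_sign G vs i * f (vs ! Suc i) else 0)
      = (if Suc i < length vs then step_sign G vs i * f (vs ! Suc i) else 0)"
    by simp
  also have "(\<Sum>j<length vs. if Suc j = i then step_sign G vs j * f (vs ! j) else 0)
      = (if i > 0 then step_sign G vs (i - 1) * f (vs ! (i - 1)) else 0)"
  proof (cases i)
    case (Suc k)
    then have "k < length vs" using i by simp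
    then show ?thesis using Suc by simp
  qed simp
  finally show ?thesis .
qed

lemma adj_closing_edge:
  assumes "finite W" "x \<in> W" "y \<in> W" "x \<noteq> y"
  shows "adj G W {{x, y}} f v = (if v = x then edge_sign G {x, y} * f y else 0)
    + (if v = y then edge_sign G {x, y} * f x else 0)"
proof -
  have "adj G W {{x, y}} f v = (\<Sum>u\<in>W. (if u = y then if v = x then edge_sign G {x, y} * f y else 0 else 0)
    + (if u = x then if v = y then edge_sign G {x, y} * f x else 0 else 0))"
    unfolding adj_def by (rule sum.cong) (use assms in \<open>auto simp: doubleton_eq_iff insert_commute\<close>)
  also have "\<dots> = (if v = x then edge_sign G {x, y} * f y else 0)
    + (if v = y then edge_sign G {x, y} * f x else 0)"
    unfolding sum.distrib using assms by simp
  finally show ?thesis .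
qed

lemma adj_cycle:
  assumes vs: "distinct vs" "length vs \<ge> 3" and i: "i < length vs"
  shows "adj G (set vs) (cycle_edges vs) f (vs ! i) = adj G (set vs) (path_edges vs) f (vs ! i)
    + (if i = 0 then edge_sign G {last vs, hd vs} * f (last vs) else 0)
    + (if Suc i = length vs then edge_sign G {last vs, hd vs} * f (hd vs) else 0)"
proof -
  have ne: "vs \<noteq> []" using vs by auto
  have hl: "hd vs = vs ! 0" "last vs = vs ! (length vs - 1)"
    using ne by (simp_all add: hd_conv_nth last_conv_nth)
  have "hd vs \<noteq> last vs" using vs ne by (simp add: hl nth_eq_iff_index_eq)
  have dis: "{{last vs, hd vs}} \<inter> path_edges vs = {}" using closing_edge_notin_path[OF vs] by simp
  have "adj G (set vs) (cycle_edges vs) f (vs ! i)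
      = adj G (set vs) {{last vs, hd vs}} f (vs ! i) + adj G (set vs) (path_edges vs) f (vs ! i)"
    using adj_Un[OF dis, of G "set vs" f "vs ! i"] by (simp add: cycle_edges_def)
  also have "adj G (set vs) {{last vs, hd vs}} f (vs ! i)
      = (if vs ! i = last vs then edge_sign G {last vs, hd vs} * f (hd vs) else 0)
      + (if vs ! i = hd vs then edge_sign G {last vs, hd vs} * f (last vs) else 0)"
    by (rule adj_closing_edge) (use ne \<open>hd vs \<noteq> last vs\<close> in auto)
  finally show ?thesis
    using vs i ne by (auto simp: hl nth_eq_iff_index_eq)
qed

text \<open>Switching along a path turns the kernel equations at its inner vertices into
  \<open>\<phi> (i + 2) = - \<phi> i\<close>.\<close>

definition path_sign :: "'a signed_graph \<Rightarrow> 'a list \<Rightarrow> nat \<Rightarrow> real" where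
  "path_sign G vs i = (\<Prod>j<i. step_sign G vs j)"

text \<open>The sequence a, b, -a, -b of period four, which is the solution of this recursion with
  initial values \<open>a\<close> and \<open>b\<close>.\<close>

definition alt :: "real \<Rightarrow> real \<Rightarrow> nat \<Rightarrow> real" where
  "alt a b i = (-1) ^ (i div 2) * (if even i then a else b)"

lemma alt_simps [simp]: "alt a b 0 = a" "alt a b (Suc 0) = b" "alt a b (Suc (Suc i)) = - alt a b i"
  by (auto simp: alt_def)

lemma path_sign_Suc [simp]: "path_sign G vs (Suc i) = path_sign G vs i * step_sign G vs i"
  and path_sign_0 [simp]: "path_sign G vs 0 = 1"
  by (simp_all add: path_sign_def)

lemma step_sign_square:
  assumes "signed_graph G" "path_edges vs \<subseteq> edges G" "Suc i < length vs"
  shows "step_sign G vs i * step_sign G vs i = 1"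
proof -
  have "{vs ! i, vs ! Suc i} \<in> edges G" using assms by (auto simp: path_edges_def)
  then show ?thesis using assms(1) by (auto simp: signed_graph_def step_sign_def)
qed

lemma path_sign_square:
  assumes "signed_graph G" "path_edges vs \<subseteq> edges G" "i < length vs"
  shows "path_sign G vs i * path_sign G vs i = 1"
  using assms(3)
proof (induction i)
  case (Suc i)
  have "path_sign G vs (Suc i) * path_sign G vs (Suc i)
      = (path_sign G vs i * path_sign G vs i) * (step_sign G vs i * step_sign G vs i)"
    by simp
  then show ?case using Suc step_sign_square[OF assms(1,2) Suc.prems] by simp
qed simp

lemma path_solution:
  assumes G: "signed_graph G" and vs: "distinct vs" "path_edges vs \<subseteq> edges G"
    and inner: "\<And>i. Suc (Suc i) < length vs \<Longrightarrow>
      adj G (set vs) (path_edges vs) f (vs ! Suc i) = 0"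
    and i: "i < length vs"
  shows "f (vs ! i) = path_sign G vs i * alt (f (vs ! 0)) (step_sign G vs 0 * f (vs ! 1)) i"
  using i
proof (induction i rule: induct_nat_012)
  case 1
  then show ?case using step_sign_square[OF G vs(2) 1] by (simp add: mult.assoc[symmetric])
next
  case (ge2 i)
  let ?s = "step_sign G vs" and ?p = "path_sign G vs"
  have "?s i * f (vs ! i) + ?s (Suc i) * f (vs ! Suc (Suc i)) = 0"
    using inner[OF ge2.prems] adj_path[OF vs(1), of "Suc i" G f] ge2.prems by simp
  then have "?s (Suc i) * (?s (Suc i) * f (vs ! Suc (Suc i))) = - (?s (Suc i) * (?s i * f (vs ! i)))"
    by (simp add: eq_neg_iff_add_eq_0 flip: distrib_left)
  then have "f (vs ! Suc (Suc i)) = - (?s (Suc i) * (?s i * f (vs ! i)))"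
    using step_sign_square[OF G vs(2) ge2.prems] by (simp flip: mult.assoc)
  then show ?case using ge2 by simp
qed simp

lemma path_function_inner:
  assumes G: "signed_graph G" and vs: "distinct vs" "path_edges vs \<subseteq> edges G"
    and f: "\<And>i. i < length vs \<Longrightarrow> f (vs ! i) = path_sign G vs i * alt a b i"
    and i: "Suc (Suc i) < length vs"
  shows "adj G (set vs) (path_edges vs) f (vs ! Suc i) = 0"
proof -
  let ?s = "step_sign G vs" and ?p = "path_sign G vs"
  have "adj G (set vs) (path_edges vs) f (vs ! Suc i) = ?s i * f (vs ! i) + ?s (Suc i) * f (vs ! Suc (Suc i))"
    using adj_path[OF vs(1), of "Suc i" G f] i by simp
  also have "\<dots> = ?s i * ?p i * alt a b i * (1 - ?s (Suc i) * ?s (Suc i))"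
    using f[of i] f[OF i] i by (simp add: algebra_simps)
  finally show ?thesis using step_sign_square[OF G vs(2) i] by simp
qed

text \<open>At the head the sign of the first step is squared away; at the last vertex the sign of
  the last step completes \<open>path_sign\<close>. These are the contributions of a path to the
  equations where a cycle closes or where the paths of a theta graph meet.\<close>

lemma path_function_ends:
  assumes G: "signed_graph G" and vs: "distinct vs" "path_edges vs \<subseteq> edges G" "length vs = Suc (Suc n)"
    and f: "\<And>i. i < length vs \<Longrightarrow> f (vs ! i) = path_sign G vs i * alt a b i"
  shows "adj G (set vs) (path_edges vs) f (hd vs) = b"
    and "adj G (set vs) (path_edges vs) f (last vs) = path_sign G vs (Suc n) * alt a b n"
proof -
  have ne: "vs \<noteq> []" using vs by auto
  have "adj G (set vs) (path_edges vs) f (vs ! 0) = step_sign G vs 0 * step_sign G vs 0 * b"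
    using adj_path[OF vs(1), of 0 G f] f[of 1] vs(3) by simp
  then show "adj G (set vs) (path_edges vs) f (hd vs) = b"
    using step_sign_square[OF G vs(2), of 0] vs(3) ne by (simp add: hd_conv_nth)
  have "adj G (set vs) (path_edges vs) f (vs ! Suc n) = step_sign G vs n * f (vs ! n)"
    using adj_path[OF vs(1), of "Suc n" G f] vs(3) by simp
  then show "adj G (set vs) (path_edges vs) f (last vs) = path_sign G vs (Suc n) * alt a b n"
    using f[of n] vs(3) ne by (simp add: last_conv_nth)
qed

lemma prod_path_edges:
  assumes "distinct vs"
  shows "prod (edge_sign G) (path_edges vs) = path_sign G vs (length vs - 1)"
proof -
  have eq: "path_edges vs = (\<lambda>i. {vs ! i, vs ! Suc i}) ` {..<length vs - 1}"
    by (auto simp: path_edges_def)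
  have "inj_on (\<lambda>i. {vs ! i, vs ! Suc i}) {..<length vs - 1}"
    by (rule eq_card_imp_inj_on) (use card_path_edges[OF assms] in \<open>auto simp: eq\<close>)
  then show ?thesis by (simp add: eq prod.reindex path_sign_def step_sign_def)
qed

text \<open>Not the usual balance of signed graphs. For a cycle of length n it says that n is
  divisible by 4 and the sign is positive, or that n is 2 modulo 4 and the sign is negative: exactly
  the signed cycles with eigenvalue 0.\<close>

definition balanced :: "'a signed_graph \<Rightarrow> 'a set set \<Rightarrow> bool" where
  "balanced G F \<longleftrightarrow> even (card F) \<and> prod (edge_sign G) F = (-1) ^ (card F div 2)"

lemma closing_sign_square:
  assumes "signed_graph G" "is_cycle (edges G) vs"
  shows "edge_sign G {last vs, hd vs} * edge_sign G {last vs, hd vs} = 1"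
proof -
  have "{last vs, hd vs} \<in> edges G" using assms(2) by (auto simp: is_cycle_def cycle_edges_def)
  then show ?thesis using assms(1) by (auto simp: signed_graph_def)
qed

lemma prod_cycle_edges:
  assumes "is_cycle E vs"
  shows "prod (edge_sign G) (cycle_edges vs) = edge_sign G {last vs, hd vs} * path_sign G vs (length vs - 1)"
  using assms closing_edge_notin_path[of vs] prod_path_edges[of vs G]
  by (simp add: is_cycle_def cycle_edges_def)

text \<open>The equations at inner vertices hold by the form of \<open>f\<close>. For length 2k + 2,
  balance says that the sign of the cycle is \<open>(-1) ^ Suc k\<close>, which makes the equations
  at the two ends of the list hold for all \<open>a\<close> and \<open>b\<close>.\<close>

lemma cycle_function_null:
  assumes G: "signed_graph G" and vs: "is_cycle (edges G) vs" and bal: "balanced G (cycle_edges vs)"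
    and f: "\<And>i. i < length vs \<Longrightarrow> f (vs ! i) = path_sign G vs i * alt a b i"
  shows "null_fun (cycle_of G vs) f"
  unfolding null_fun_cycle_of_adj
proof
  have vs': "distinct vs" "length vs \<ge> 3" "path_edges vs \<subseteq> edges G" "vs \<noteq> []"
    using vs by (auto simp: is_cycle_def cycle_edges_def)
  let ?t = "edge_sign G {last vs, hd vs}"
  have cc: "card (cycle_edges vs) = length vs" by (rule card_cycle_edges[OF vs'(1,2)])
  obtain m where m: "length vs = 2 * m" using bal cc by (auto simp: balanced_def)
  then obtain k where k: "length vs = 2 * Suc k" using vs'(2) by (cases m) auto
  then have n: "length vs = Suc (Suc (2 * k))" by simp
  have tau: "?t * path_sign G vs (Suc (2 * k)) = (-1) ^ Suc k"
    using bal prod_cycle_edges[OF vs, of G] by (simp add: balanced_def cc k)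
  have p1: "path_sign G vs (Suc (2 * k)) * path_sign G vs (Suc (2 * k)) = 1"
    by (rule path_sign_square[OF G vs'(3)]) (simp add: n)
  have t1: "?t = (-1) ^ Suc k * path_sign G vs (Suc (2 * k))"
  proof -
    have "?t = ?t * path_sign G vs (Suc (2 * k)) * path_sign G vs (Suc (2 * k))"
      using p1 by (simp add: mult.assoc del: path_sign_Suc)
    then show ?thesis unfolding tau .
  qed
  have hd: "hd vs = vs ! 0" and last: "last vs = vs ! Suc (2 * k)"
    using vs'(4) by (simp_all add: hd_conv_nth last_conv_nth n)
  fix v assume "v \<in> set vs"
  then obtain i where i: "i < length vs" "v = vs ! i" by (auto simp: in_set_conv_nth)
  note cyc = adj_cycle[OF vs'(1,2) i(1), of G f]
  consider "i = 0" | j where "i = Suc j" "Suc (Suc j) < length vs" | "i = Suc (2 * k)"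
    using i(1) unfolding n by (cases i) (force simp: less_Suc_eq)+
  then show "adj G (set vs) (cycle_edges vs) f v = 0"
  proof cases
    case 1
    have "adj G (set vs) (path_edges vs) f (vs ! 0) = b"
      using path_function_ends(1)[OF G vs'(1,3) n f] hd by simp
    then have "adj G (set vs) (cycle_edges vs) f v = b + ?t * f (last vs)"
      using cyc 1 i n by simp
    also have "?t * f (last vs) = ?t * path_sign G vs (Suc (2 * k)) * alt a b (Suc (2 * k))"
      using f[of "Suc (2 * k)"] n last by simp
    also have "\<dots> = - b" unfolding tau by (cases "even k") (auto simp: alt_def)
    finally show ?thesis by simp
  next
    case (2 j)
    then show ?thesis
      using cyc path_function_inner[OF G vs'(1,3) f, where i = j] i by simp
  next
    case 3
    have "adj G (set vs) (path_edges vs) f (vs ! Suc (2 * k)) = path_sign G vs (Suc (2 * k)) * alt a b (2 * k)"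
      using path_function_ends(2)[OF G vs'(1,3) n f] last by simp
    then have "adj G (set vs) (cycle_edges vs) f v = path_sign G vs (Suc (2 * k)) * alt a b (2 * k) + ?t * f (hd vs)"
      using cyc 3 i n by simp
    also have "?t * f (hd vs) = (-1) ^ Suc k * path_sign G vs (Suc (2 * k)) * a"
      using f[of 0] vs'(4) hd t1 by simp
    finally show ?thesis by (simp add: alt_def)
  qed
qed

text \<open>Only the equations away from the head and the last vertex are used, so this also applies
  to a cycle whose head carries further edges.\<close>

lemma cycle_null_fun_solution:
  assumes G: "signed_graph G" and vs: "is_cycle (edges G) vs"
    and f: "\<And>i. Suc (Suc i) < length vs \<Longrightarrow> adj G (set vs) (cycle_edges vs) f (vs ! Suc i) = 0"
    and i: "i < length vs"
  shows "f (vs ! i) = path_sign G vs i * alt (f (vs ! 0)) (step_sign G vs 0 * f (vs ! 1)) i"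
proof (rule path_solution[OF G _ _ _ i])
  have vs': "distinct vs" "length vs \<ge> 3" using vs by (auto simp: is_cycle_def)
  then show "distinct vs" "path_edges vs \<subseteq> edges G"
    using vs by (auto simp: is_cycle_def cycle_edges_def)
  show "adj G (set vs) (path_edges vs) f (vs ! Suc j) = 0" if "Suc (Suc j) < length vs" for j
    using f[OF that] adj_cycle[OF vs', of "Suc j" G f] that by simp
qed

text \<open>By the recursion \<open>f\<close> is given by two numbers \<open>a\<close> and
  \<open>b\<close>, not both zero, subject to two closing equations that involve the sign \<tau> of
  the cycle. For odd length they give \<tau> a = - \<tau> a, hence a = b = 0; for even length they
  determine \<tau>.\<close>

lemma balanced_if_null_fun:
  assumes G: "signed_graph G" and vs: "is_cycle (edges G) vs"
    and f: "null_fun (cycle_of G vs) f" and v: "v \<in> set vs" "f v \<noteq> 0"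
  shows "balanced G (cycle_edges vs)"
proof -
  have vs': "distinct vs" "length vs \<ge> 3" "path_edges vs \<subseteq> edges G" "vs \<noteq> []"
    using vs by (auto simp: is_cycle_def cycle_edges_def)
  let ?t = "edge_sign G {last vs, hd vs}"
  have cc: "card (cycle_edges vs) = length vs" by (rule card_cycle_edges[OF vs'(1,2)])
  have "length vs = Suc (Suc (length vs - 2))" using vs'(2) by simp
  then obtain n where n: "length vs = Suc (Suc n)" by blast
  define a b where "a = f (vs ! 0)" and "b = step_sign G vs 0 * f (vs ! 1)"
  have null: "adj G (set vs) (cycle_edges vs) f (vs ! i) = 0" if "i < length vs" for i
    using f that by (simp add: null_fun_cycle_of_adj)
  have sol: "f (vs ! i) = path_sign G vs i * alt a b i" if "i < length vs" for i
    unfolding a_def b_def by (rule cycle_null_fun_solution[OF G vs null that]) simp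
  define \<tau> where "\<tau> = ?t * path_sign G vs (Suc n)"
  have hd: "hd vs = vs ! 0" and last: "last vs = vs ! Suc n"
    using vs'(4) by (simp_all add: hd_conv_nth last_conv_nth n)
  have p1: "path_sign G vs (Suc n) * path_sign G vs (Suc n) = 1"
    by (rule path_sign_square[OF G vs'(3)]) (simp add: n)
  have "adj G (set vs) (path_edges vs) f (vs ! 0) = b"
    using path_function_ends(1)[OF G vs'(1,3) n sol] hd by simp
  then have "b + ?t * f (last vs) = 0"
    using null[of 0] adj_cycle[OF vs'(1,2), of 0 G f] n by simp
  \<comment> \<open>\<open>e1\<close> is the equation at the head and \<open>e2\<close> below the
    one at the last vertex, both freed of the signs along the path.\<close>
  then have e1: "b + \<tau> * alt a b (Suc n) = 0"
    using sol[of "Suc n"] n last by (simp add: \<tau>_def mult.assoc)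
  have "adj G (set vs) (path_edges vs) f (vs ! Suc n) = path_sign G vs (Suc n) * alt a b n"
    using path_function_ends(2)[OF G vs'(1,3) n sol] last by simp
  then have "path_sign G vs (Suc n) * alt a b n + ?t * a = 0"
    using null[of "Suc n"] adj_cycle[OF vs'(1,2), of "Suc n" G f] n hd by (simp add: a_def)
  then have "path_sign G vs (Suc n) * (path_sign G vs (Suc n) * alt a b n + ?t * a) = 0" by simp
  moreover have "path_sign G vs (Suc n) * (path_sign G vs (Suc n) * alt a b n + ?t * a)
      = path_sign G vs (Suc n) * path_sign G vs (Suc n) * alt a b n + \<tau> * a"
    unfolding \<tau>_def by (simp only: distrib_left mult_ac)
  ultimately have e2: "alt a b n + \<tau> * a = 0" using p1 by (simp del: path_sign_Suc)
  have ab: "a \<noteq> 0 \<or> b \<noteq> 0"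
  proof (rule ccontr)
    assume "\<not> (a \<noteq> 0 \<or> b \<noteq> 0)"
    then have "f (vs ! i) = 0" if "i < length vs" for i using sol[OF that] by (simp add: alt_def)
    then show False using v by (auto simp: in_set_conv_nth)
  qed
  have "\<tau> * \<tau> = (?t * ?t) * (path_sign G vs (Suc n) * path_sign G vs (Suc n))"
    unfolding \<tau>_def by (simp only: mult_ac)
  then have tt: "\<tau> * \<tau> = 1" unfolding closing_sign_square[OF G vs] p1 by simp
  have pm: "\<tau> = 1 \<or> \<tau> = -1" using tt by (simp add: square_eq_1_iff)
  have "even n"
  proof (rule ccontr)
    assume "odd n"
    then obtain k where k: "n = Suc (2 * k)" by (auto elim: oddE)
    have b: "b = \<tau> * (-1) ^ k * a" and "(-1) ^ k * b = - (\<tau> * a)"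
      using e1 e2 by (simp_all add: k alt_def algebra_simps)
    then have "(-1) ^ k * ((-1) ^ k * (\<tau> * a)) = - (\<tau> * a)" by (simp add: algebra_simps)
    then have "\<tau> * a = - (\<tau> * a)" by (simp flip: mult.assoc power_add)
    then have "\<tau> * a = 0" by simp
    then show False using b ab tt by auto
  qed
  then obtain k where k: "n = 2 * k" by (auto elim: evenE)
  have "b * (1 + \<tau> * (-1) ^ k) = 0" "a * ((-1) ^ k + \<tau>) = 0"
    using e1 e2 by (simp_all add: k alt_def algebra_simps)
  then have "\<tau> = - ((-1) ^ k)"
    using ab pm by (cases "even k") auto
  then show ?thesis
    using prod_cycle_edges[OF vs, of G] by (simp add: balanced_def cc n k \<tau>_def)
qed

lemma path_function_exists:
  assumes "distinct vs"
  shows "\<exists>f. \<forall>i<length vs. f (vs ! i) = g i"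
proof -
  let ?f = "\<lambda>v. g (THE i. i < length vs \<and> vs ! i = v)"
  show ?thesis
  proof (intro exI[of _ ?f] allI impI)
    fix i assume i: "i < length vs"
    have "(THE j. j < length vs \<and> vs ! j = vs ! i) = i"
      by (rule the_equality) (use assms i in \<open>auto simp: nth_eq_iff_index_eq\<close>)
    then show "?f (vs ! i) = g i" by simp
  qed
qed

text \<open>The recursion makes the first two vertices forcing, and balance lets their values be
  prescribed freely.\<close>

lemma nullity_balanced_cycle:
  assumes G: "signed_graph G" and vs: "is_cycle (edges G) vs" and bal: "balanced G (cycle_edges vs)"
  shows "nullity (cycle_of G vs) = 2"
proof -
  have vs': "distinct vs" "length vs \<ge> 3" "path_edges vs \<subseteq> edges G" "vs \<noteq> []"
    using vs by (auto simp: is_cycle_def cycle_edges_def)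
  have ne: "vs ! 0 \<noteq> vs ! 1" using vs' by (simp add: nth_eq_iff_index_eq)
  have "1 < length vs" using vs'(2) by simp
  then have p1: "path_sign G vs 1 \<noteq> 0" using path_sign_square[OF G vs'(3), of 1] by auto
  have "nullity (cycle_of G vs) = card {vs ! 0, vs ! 1}"
  proof (rule nullity_eq_card)
    show "{vs ! 0, vs ! 1} \<subseteq> verts (cycle_of G vs)" using nth_mem[of 0 vs] nth_mem[of 1 vs] \<open>1 < length vs\<close> vs'(4) by auto
    show "forcing (cycle_of G vs) {vs ! 0, vs ! 1}"
      unfolding forcing_def
    proof (intro allI impI ballI)
      fix f v assume f: "null_fun (cycle_of G vs) f" "\<forall>s\<in>{vs ! 0, vs ! 1}. f s = 0"
        and "v \<in> verts (cycle_of G vs)"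
      then obtain i where i: "i < length vs" "v = vs ! i" by (auto simp: in_set_conv_nth)
      have "f (vs ! i) = path_sign G vs i * alt (f (vs ! 0)) (step_sign G vs 0 * f (vs ! 1)) i"
        by (rule cycle_null_fun_solution[OF G vs _ i(1)]) (use f(1) in \<open>simp add: null_fun_cycle_of_adj\<close>)
      moreover have "f (vs ! 0) = 0" "f (vs ! 1) = 0" using f by auto
      ultimately show "f v = 0" unfolding i(2) by (simp add: alt_def)
    qed
    fix s assume s: "s \<in> {vs ! 0, vs ! 1}"
    define a b :: real where "a = (if s = vs ! 0 then 1 else 0)" and "b = (if s = vs ! 0 then 0 else 1)"
    obtain f where "\<forall>i<length vs. f (vs ! i) = path_sign G vs i * alt a b i"
      using path_function_exists[OF vs'(1), of "\<lambda>i. path_sign G vs i * alt a b i"] by blast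
    then have f: "f (vs ! i) = path_sign G vs i * alt a b i" if "i < length vs" for i
      using that by simp
    have "null_fun (cycle_of G vs) f" by (rule cycle_function_null[OF G vs bal f])
    moreover have "f (vs ! 0) = a" "f (vs ! 1) = path_sign G vs 1 * b"
      using f[of 0] f[of 1] vs' by auto
    ultimately show "\<exists>f. null_fun (cycle_of G vs) f \<and> f s \<noteq> 0 \<and> (\<forall>t\<in>{vs ! 0, vs ! 1} - {s}. f t = 0)"
      using s ne p1 by (intro exI[of _ f]) (auto simp: a_def b_def)
  qed simp
  then show ?thesis using ne by simp
qed

lemma cycle_nullity_2_iff_balanced:
  assumes G: "signed_graph G" and vs: "is_cycle (edges G) vs"
  shows "nullity (cycle_of G vs) = 2 \<longleftrightarrow> balanced G (cycle_edges vs)"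
proof
  assume "nullity (cycle_of G vs) = 2"
  then have "\<not> forcing (cycle_of G vs) {}" using nullity_le_card[of "cycle_of G vs" "{}"] by auto
  then show "balanced G (cycle_edges vs)"
    using balanced_if_null_fun[OF G vs] by (auto simp: forcing_def)
qed (rule nullity_balanced_cycle[OF G vs])

text \<open>A single nonzero kernel vector already implies balance and hence nullity 2. The missing
  value 1 is what excludes a lone cycle from the extremal graphs.\<close>

lemma cycle_nullity_cases:
  assumes G: "signed_graph G" and vs: "is_cycle (edges G) vs"
  shows "nullity (cycle_of G vs) = 0 \<or> nullity (cycle_of G vs) = 2"
proof (cases "forcing (cycle_of G vs) {}")
  case True
  then show ?thesis using nullity_le_card[of "cycle_of G vs" "{}"] by auto
next
  case False
  then show ?thesis
    using balanced_if_null_fun[OF G vs] nullity_balanced_cycle[OF G vs] by (auto simp: forcing_def)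
qed

section \<open>Gluing cycles of nullity two\<close>

lemma connected_graph_conn: "connected_graph G \<longleftrightarrow> verts G \<noteq> {} \<and> conn (verts G) (edges G)"
  by (auto simp: connected_graph_def conn_def reachable_def reach_def)

lemma cyclomatic_connected:
  assumes "connected_graph G"
  shows "cyclomatic G = int (card (edges G)) - int (card (verts G)) + 1"
proof -
  have "reachable G `` {v} = verts G" if "v \<in> verts G" for v
    using assms that by (auto simp: connected_graph_def reachable_def)
  then have "components G = {verts G}"
    using assms by (auto simp: components_def quotient_def connected_graph_def)
  then show ?thesis by (simp add: cyclomatic_def)
qed

lemma pairs_disjoint:
  assumes "F \<subseteq> pairs A" "F' \<subseteq> pairs B" "A \<inter> B = {x}"
  shows "F \<inter> F' = {}"
proof -
  have False if e: "e \<in> F" "e \<in> F'" for e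
  proof -
    have "e \<subseteq> A \<inter> B" "card e = 2" using e assms(1,2) by (auto simp: pairs_def)
    then show False using card_mono[of "{x}" e] assms(3) by simp
  qed
  then show ?thesis by blast
qed

lemma signed_graph_subgraph: "signed_graph G \<Longrightarrow> W \<subseteq> verts G \<Longrightarrow> F \<subseteq> edges G \<Longrightarrow> F \<subseteq> pairs W \<Longrightarrow>
    signed_subgraph \<lparr>verts = W, edges = F, edge_sign = edge_sign G\<rparr> G"
  by (auto simp: signed_subgraph_def signed_graph_def pairs_def finite_subset)

lemma two_edges_not_leaf:
  assumes "signed_graph G" "{v, x} \<in> edges G" "{v, y} \<in> edges G" "x \<noteq> y"
  shows "v \<notin> leaves G"
proof
  assume "v \<in> leaves G"
  then have "card {e \<in> edges G. v \<in> e} = 1" by (simp add: leaves_def vertex_degree_def)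
  then obtain e where "{e \<in> edges G. v \<in> e} = {e}" by (auto simp: card_1_singleton_iff)
  moreover have "{v, x} \<in> {e \<in> edges G. v \<in> e}" "{v, y} \<in> {e \<in> edges G. v \<in> e}" using assms by auto
  ultimately have "{v, x} = {v, y}" by simp
  then show False using assms(4) by (auto simp: doubleton_eq_iff)
qed

lemma cycle_vertex_not_leaf:
  assumes G: "signed_graph G" and vs: "is_cycle (edges G) vs" and v: "v \<in> set vs"
  shows "v \<notin> leaves G"
proof -
  obtain ws where ws: "is_cycle (edges G) ws" "hd ws = v" using is_cycle_rotate[OF vs v] by metis
  obtain y where y: "{hd ws, y} \<in> path_edges ws" "y \<noteq> last ws" using cycle_second[OF ws(1)] by metis
  have "cycle_edges ws \<subseteq> edges G" using ws(1) by (simp add: is_cycle_def)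
  then have "{hd ws, y} \<in> edges G" "{hd ws, last ws} \<in> edges G"
    using y(1) by (auto simp: cycle_edges_def insert_commute)
  then show ?thesis using two_edges_not_leaf[OF G _ _ y(2)] ws(2) by metis
qed

text \<open>A cycle of nullity 2 has a kernel vector with any prescribed value at the gluing vertex, and
  one vanishing there which is unique up to scaling; the latter accounts for the increment.\<close>

lemma nullity_glue_cycle:
  assumes G: "signed_graph G" and vs: "is_cycle (edges G) vs" and two: "nullity (cycle_of G vs) = 2"
    and H: "signed_subgraph H G" and glue: "verts H \<inter> set vs = {hd vs}"
    and V: "verts G = verts H \<union> set vs" and E: "edges G = edges H \<union> cycle_edges vs"
  shows "nullity G = Suc (nullity H)"
proof -
  have vs': "distinct vs" "length vs \<ge> 3" "path_edges vs \<subseteq> edges G" "vs \<noteq> []"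
    using vs by (auto simp: is_cycle_def cycle_edges_def)
  have bal: "balanced G (cycle_edges vs)" using two cycle_nullity_2_iff_balanced[OF G vs] by simp
  have HG: "signed_graph H" using H by (simp add: signed_subgraph_def)
  have HE: "edges H \<subseteq> pairs (verts H)" by (rule signed_graph_pairs[OF HG])
  have CE: "cycle_edges vs \<subseteq> pairs (set vs)" by (rule cycle_edges_pairs[OF vs'(1,2)])
  note fin = signed_graph_finite[OF G]
  have finH: "finite (verts H)" by (rule signed_graph_finite[OF HG])
  have dis: "edges H \<inter> cycle_edges vs = {}"
    by (rule pairs_disjoint[OF HE CE glue])
  have split: "adj G (verts G) (edges G) f v = adj H (verts H) (edges H) f v + adj G (set vs) (cycle_edges vs) f v"
    for f v
  proof -
    have "adj G (verts G) (edges G) f v = adj G (verts G) (edges H) f v + adj G (verts G) (cycle_edges vs) f v"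
      unfolding E by (rule adj_Un[OF dis])
    also have "adj G (verts G) (cycle_edges vs) f v = adj G (set vs) (cycle_edges vs) f v"
      by (rule adj_enlarge[OF CE]) (use V fin in auto)
    also have "adj G (verts G) (edges H) f v = adj G (verts H) (edges H) f v"
      by (rule adj_enlarge[OF HE]) (use V fin in auto)
    also have "\<dots> = adj H (verts H) (edges H) f v"
      unfolding adj_def by (rule sum.cong) (use H in \<open>auto simp: signed_subgraph_def\<close>)
    finally show ?thesis .
  qed
  have hd0: "hd vs = vs ! 0" using vs'(4) by (simp add: hd_conv_nth)
  have inH: "vs ! i \<in> verts H \<longleftrightarrow> i = 0" if "i < length vs" for i
  proof -
    have "vs ! i \<in> verts H \<longleftrightarrow> vs ! i \<in> {hd vs}"
      unfolding glue[symmetric] using nth_mem[OF that] by simp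
    also have "\<dots> \<longleftrightarrow> i = 0"
      using nth_eq_iff_index_eq[OF vs'(1) that, of 0] vs'(4) hd0 by simp
    finally show ?thesis .
  qed
  have sol: "f (vs ! i) = path_sign G vs i * alt (f (vs ! 0)) (step_sign G vs 0 * f (vs ! 1)) i"
    if f: "null_fun G f" and i: "i < length vs" for f i
  proof (rule cycle_null_fun_solution[OF G vs _ i])
    fix j assume j: "Suc (Suc j) < length vs"
    then have "vs ! Suc j \<notin> verts H" "vs ! Suc j \<in> verts G" using inH[of "Suc j"] V by auto
    then show "adj G (set vs) (cycle_edges vs) f (vs ! Suc j) = 0"
      using f split[of f "vs ! Suc j"] adj_outside[OF HE] by (simp add: null_fun_adj)
  qed
  \<comment> \<open>The key point of gluing: the equations at the cycle vertices other than the head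
    fix the form of \<open>f\<close> on the cycle, and balance then makes the cycle part of the
    equation at the head vanish by itself. So the equation at the head also holds in
    \<open>H\<close> alone.\<close>
  have null_cyc: "null_fun (cycle_of G vs) f" if f: "null_fun G f" for f
    by (rule cycle_function_null[OF G vs bal sol[OF f]])
  have null_H: "null_fun H f" if f: "null_fun G f" for f
    unfolding null_fun_adj
  proof
    fix v assume v: "v \<in> verts H"
    have "adj G (set vs) (cycle_edges vs) f v = 0"
      using null_cyc[OF f] adj_outside[OF CE] by (cases "v \<in> set vs") (auto simp: null_fun_cycle_of_adj)
    then show "adj H (verts H) (edges H) f v = 0"
      using f v V split[of f v] by (simp add: null_fun_adj)
  qed
  \<comment> \<open>The value at the gluing vertex is dictated by \<open>f\<close>; the second
    parameter \<open>b\<close> of the cycle is free.\<close>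
  have extend: "\<exists>F. null_fun G F \<and> (\<forall>v\<in>verts H. F v = f v) \<and> F (vs ! 1) = path_sign G vs 1 * b"
    if f: "null_fun H f" for f b
  proof -
    let ?g = "\<lambda>i. path_sign G vs i * alt (f (vs ! 0)) b i"
    obtain h where h: "\<forall>i<length vs. h (vs ! i) = ?g i"
      using path_function_exists[OF vs'(1), of ?g] by blast
    define F where "F v = (if v \<in> verts H then f v else h v)" for v
    have F: "F (vs ! i) = ?g i" if "i < length vs" for i
      using h that inH[OF that] by (auto simp: F_def)
    have nc: "null_fun (cycle_of G vs) F" by (rule cycle_function_null[OF G vs bal F])
    have "adj H (verts H) (edges H) F v = 0" for v
    proof (cases "v \<in> verts H")
      case True
      have "adj H (verts H) (edges H) F v = adj H (verts H) (edges H) f v"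
        by (rule adj_cong) (simp add: F_def)
      then show ?thesis using f True by (simp add: null_fun_adj)
    qed (rule adj_outside[OF HE])
    moreover have "adj G (set vs) (cycle_edges vs) F v = 0" for v
      using nc adj_outside[OF CE] by (cases "v \<in> set vs") (auto simp: null_fun_cycle_of_adj)
    ultimately have "null_fun G F" by (simp add: null_fun_adj split)
    then show ?thesis using F[of 1] vs'(2) by (intro exI[of _ F]) (auto simp: F_def)
  qed
  obtain S where S: "S \<subseteq> verts H" "forcing H S" "card S = nullity H"
    using forcing_contains_nullity[OF finH _ forcing_verts[of H]] by blast
  have one: "vs ! 1 \<in> set vs" "vs ! 1 \<notin> verts H" using vs'(2) inH[of 1] by auto
  have p1: "path_sign G vs 1 \<noteq> 0" using path_sign_square[OF G vs'(3), of 1] vs'(2) by auto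
  have "nullity G = card (insert (vs ! 1) S)"
  proof (rule nullity_eq_card[OF fin])
    show "insert (vs ! 1) S \<subseteq> verts G" using one S V by auto
    show "forcing G (insert (vs ! 1) S)"
      unfolding forcing_def
    proof (intro allI impI ballI)
      fix f v assume f: "null_fun G f" "\<forall>s\<in>insert (vs ! 1) S. f s = 0" and v: "v \<in> verts G"
      have zH: "f u = 0" if "u \<in> verts H" for u
        using null_H[OF f(1)] f(2) S(2) that unfolding forcing_def by blast
      show "f v = 0"
      proof (cases "v \<in> verts H")
        case False
        then obtain i where i: "i < length vs" "v = vs ! i" using v V by (auto simp: in_set_conv_nth)
        have "f (vs ! 0) = 0" using zH[of "vs ! 0"] inH[of 0] vs'(4) by simp
        then show ?thesis using sol[OF f(1) i(1)] f(2) i(2) by (simp add: alt_def)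
      qed (rule zH)
    qed
    fix s assume s: "s \<in> insert (vs ! 1) S"
    show "\<exists>f. null_fun G f \<and> f s \<noteq> 0 \<and> (\<forall>t\<in>insert (vs ! 1) S - {s}. f t = 0)"
    proof (cases "s = vs ! 1")
      case True
      have "null_fun H (\<lambda>v. 0)" by (simp add: null_fun_def)
      then obtain F where "null_fun G F" "\<forall>v\<in>verts H. F v = 0" "F (vs ! 1) = path_sign G vs 1 * 1"
        using extend[of "\<lambda>v. 0" 1] by blast
      then show ?thesis using True S(1) p1 by (intro exI[of _ F]) auto
    next
      case False
      then have sS: "s \<in> S" using s by simp
      obtain f where f: "null_fun H f" "f s \<noteq> 0" "\<forall>t\<in>S - {s}. f t = 0"
        using forcing_nullity_interp[OF finH S(1,2) S(3)[symmetric] sS] by blast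
      obtain F where "null_fun G F" "\<forall>v\<in>verts H. F v = f v" "F (vs ! 1) = path_sign G vs 1 * 0"
        using extend[OF f(1), of 0] by blast
      moreover have "F t = f t" if "t \<in> S" for t using that S(1) calculation(2) by blast
      ultimately show ?thesis using f sS by (intro exI[of _ F]) auto
    qed
  qed
  moreover have "vs ! 1 \<notin> S" "finite S" using one S(1) finH finite_subset by auto
  ultimately show ?thesis using S(3) by simp
qed

text \<open>The cycles are glued to the tree one at a time, over growing subsets \<open>M\<close> of
  \<open>L\<close>. Each new cycle meets the part built so far only in its leaf, because the cycles
  are disjoint, and adds one.\<close>

lemma tree_with_cycles_nullity:
  assumes G: "signed_graph G" and tw: "tree_with_cycles G T L C" and two: "\<And>v. v \<in> L \<Longrightarrow> nullity (C v) = 2"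
  shows "nullity G = nullity T + card L"
proof -
  have T: "L \<subseteq> leaves T"
    and cyc: "\<And>v. v \<in> L \<Longrightarrow> \<exists>n. signed_cycle n (C v)" "\<And>v. v \<in> L \<Longrightarrow> verts T \<inter> verts (C v) = {v}"
    and disj: "\<And>v w. v \<in> L \<Longrightarrow> w \<in> L \<Longrightarrow> v \<noteq> w \<Longrightarrow> verts (C v) \<inter> verts (C w) = {}"
    and un: "\<And>H. H \<in> insert T (C ` L) \<Longrightarrow> signed_subgraph H G"
      "verts G = verts T \<union> (\<Union>v\<in>L. verts (C v))" "edges G = edges T \<union> (\<Union>v\<in>L. edges (C v))"
    using tw by (auto simp: tree_with_cycles_def is_union_def)
  have finL: "finite L"
    using T un(1)[of T] by (auto simp: signed_subgraph_def signed_graph_def leaves_def intro: finite_subset)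
  define part where "part M = \<lparr>verts = verts T \<union> (\<Union>v\<in>M. verts (C v)),
    edges = edges T \<union> (\<Union>v\<in>M. edges (C v)), edge_sign = edge_sign G\<rparr>" for M
  have sub: "signed_subgraph (part M) (part N)" "signed_graph (part N)" if "M \<subseteq> N" "N \<subseteq> L" for M N
  proof -
    have *: "signed_graph (part K)" if "K \<subseteq> L" for K
    proof -
      have "e \<subseteq> verts (part K) \<and> card e = 2 \<and> e \<in> edges G" if e: "e \<in> edges (part K)" for e
      proof -
        have *: "e \<subseteq> verts H \<and> card e = 2 \<and> e \<in> edges G"
          if "H \<in> insert T (C ` L)" "e \<in> edges H" for H
          using un(1)[OF that(1)] that(2) by (auto simp: signed_subgraph_def signed_graph_def)
        have "e \<in> edges T \<or> (\<exists>v\<in>K. e \<in> edges (C v))" using e by (simp add: part_def)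
        then show ?thesis
        proof
          assume "e \<in> edges T"
          then show ?thesis using *[of T] by (auto simp: part_def)
        next
          assume "\<exists>v\<in>K. e \<in> edges (C v)"
          then obtain v where v: "v \<in> K" "e \<in> edges (C v)" by blast
          then have "e \<subseteq> verts (C v) \<and> card e = 2 \<and> e \<in> edges G" using *[of "C v"] \<open>K \<subseteq> L\<close> by blast
          then show ?thesis using v(1) by (auto simp: part_def)
        qed
      qed
      moreover have "finite (verts (part K))"
        using un(2) \<open>K \<subseteq> L\<close> signed_graph_finite[OF G] by (auto simp: part_def intro: finite_subset)
      ultimately show ?thesis using G by (auto simp: signed_graph_def part_def)
    qed
    show "signed_subgraph (part M) (part N)" "signed_graph (part N)"
      using *[of M] *[of N] that by (auto simp: signed_subgraph_def part_def)
  qed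
  have "nullity (part M) = nullity T + card M" if "finite M" "M \<subseteq> L" for M
    using that
  proof (induction M)
    case empty
    have "nullity (part {}) = nullity T"
      by (rule nullity_cong) (use un(1)[of T] in \<open>auto simp: part_def signed_subgraph_def\<close>)
    then show ?case by simp
  next
    case (insert v M)
    let ?G = "part (insert v M)"
    have vL: "v \<in> L" "M \<subseteq> L" using insert.prems by auto
    have G': "signed_graph ?G" using sub(2)[of "insert v M" "insert v M"] insert.prems by simp
    obtain n where n: "signed_cycle n (C v)" using cyc(1)[OF vL(1)] by blast
    have Csub: "signed_subgraph (C v) ?G"
      using un(1)[of "C v"] vL(1) by (auto simp: signed_subgraph_def part_def)
    obtain us where us: "is_cycle (edges ?G) us" "verts (C v) = set us" "edges (C v) = cycle_edges us"
      "nullity (C v) = nullity (cycle_of ?G us)"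
      using signed_cycle_subgraph[OF n Csub] by metis
    have "v \<in> set us" using cyc(2)[OF vL(1)] us(2) by auto
    then obtain ws where ws: "is_cycle (edges ?G) ws" "hd ws = v" "set ws = set us" "cycle_edges ws = cycle_edges us"
      using is_cycle_rotate[OF us(1)] by metis
    have "cycle_of ?G ws = cycle_of ?G us" using ws by (simp add: cycle_of_def)
    then have two': "nullity (cycle_of ?G ws) = 2" using two[OF vL(1)] us(4) by simp
    have "nullity ?G = Suc (nullity (part M))"
    proof (rule nullity_glue_cycle[OF G' ws(1) two'])
      show "signed_subgraph (part M) ?G" using sub(1)[of M "insert v M"] insert.prems by auto
      have "verts (C w) \<inter> verts (C v) = {}" if "w \<in> M" for w
        using disj[of w v] vL that insert.hyps by auto
      then show "verts (part M) \<inter> set ws = {hd ws}"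
        using cyc(2)[OF vL(1)] us(2) ws(2,3) by (auto simp: part_def)
    qed (use us ws in \<open>auto simp: part_def\<close>)
    then show ?case using insert by simp
  qed
  then have "nullity (part L) = nullity T + card L" using finL by simp
  moreover have "nullity (part L) = nullity G"
    by (rule nullity_cong) (use un in \<open>auto simp: part_def\<close>)
  ultimately show ?thesis by simp
qed

lemma tree_with_cycles_leaves:
  assumes G: "signed_graph G" and tw: "tree_with_cycles G T L C"
  shows "leaves G = leaves T - L"
proof -
  have T: "L \<subseteq> leaves T"
    and cyc: "\<And>v. v \<in> L \<Longrightarrow> \<exists>n. signed_cycle n (C v)" "\<And>v. v \<in> L \<Longrightarrow> verts T \<inter> verts (C v) = {v}"
    and un: "\<And>H. H \<in> insert T (C ` L) \<Longrightarrow> signed_subgraph H G"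
      "verts G = verts T \<union> (\<Union>v\<in>L. verts (C v))" "edges G = edges T \<union> (\<Union>v\<in>L. edges (C v))"
    using tw by (auto simp: tree_with_cycles_def is_union_def)
  have no_leaf: "v \<notin> leaves G" if w: "w \<in> L" "v \<in> verts (C w)" for v w
  proof -
    obtain n where n: "signed_cycle n (C w)" using cyc(1)[OF w(1)] by blast
    have "signed_subgraph (C w) G" using un(1) w(1) by blast
    then obtain us where "is_cycle (edges G) us" "verts (C w) = set us"
      using signed_cycle_subgraph[OF n] by metis
    then show ?thesis using cycle_vertex_not_leaf[OF G] w(2) by blast
  qed
  have same: "v \<in> leaves G \<longleftrightarrow> v \<in> leaves T" if v: "v \<in> verts T" "v \<notin> L" for v
  proof -
    have "v \<notin> e" if "w \<in> L" "e \<in> edges (C w)" for e w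
    proof
      assume "v \<in> e"
      moreover have "e \<subseteq> verts (C w)"
        using un(1)[of "C w"] that by (auto simp: signed_subgraph_def signed_graph_def)
      ultimately show False using cyc(2)[OF that(1)] v that(1) by auto
    qed
    then have "{e \<in> edges G. v \<in> e} = {e \<in> edges T. v \<in> e}" using un(3) by auto
    then show ?thesis using v un(2) by (simp add: leaves_def vertex_degree_def)
  qed
  have "v \<in> verts T" if "v \<in> leaves T" for v using that by (simp add: leaves_def)
  moreover have "v \<in> verts T" "v \<notin> L" if "v \<in> leaves G" for v
  proof -
    have "v \<in> verts G" using that by (simp add: leaves_def)
    then show "v \<in> verts T" using un(2) no_leaf that by blast
    show "v \<notin> L" using no_leaf[of v v] cyc(2)[of v] that by blast
  qed
  ultimately show ?thesis using same by blast
qed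

text \<open>The nullity is (p(T) - 1) + c. The c attached leaves stop being leaves, so p(T) = p(G) +
  c, and the sum is 2c + p(G) - 1.\<close>

lemma tree_with_cycles_equality:
  assumes G: "signed_graph G" and tw: "tree_with_cycles G T L C"
    and "\<And>v. v \<in> L \<Longrightarrow> nullity (C v) = 2"
    and T: "int (nullity T) = int (num_pendant T) - 1" and c: "int (card L) = cyclomatic G"
  shows "int (nullity G) = 2 * cyclomatic G + int (num_pendant G) - 1"
proof -
  have L: "L \<subseteq> leaves T" "finite (leaves T)"
    using tw by (auto simp: tree_with_cycles_def signed_tree_def signed_graph_def leaves_def)
  have "num_pendant G = num_pendant T - card L"
    unfolding num_pendant_def tree_with_cycles_leaves[OF G tw]
    by (rule card_Diff_subset) (use L finite_subset in auto)
  moreover have "card L \<le> num_pendant T" unfolding num_pendant_def using L by (rule card_mono[rotated])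
  ultimately show ?thesis
    using tree_with_cycles_nullity[OF G tw assms(3)] T c by simp
qed

text \<open>One cycle contributes 2 and gluing the other adds 1. With c = 2 and no leaves, 2c + p -
  1 is 3 as well.\<close>

lemma infinity_graph_equality:
  assumes conn: "connected_graph G" and inf: "infinity_graph p q G" and two: "cycles_have_nullity_2 G"
  shows "int (nullity G) = 2 * cyclomatic G + int (num_pendant G) - 1"
proof -
  obtain A B x where G: "signed_graph G" and AB: "signed_cycle p A" "signed_cycle q B"
      "verts A \<inter> verts B = {x}" "is_union G {A, B}"
    using inf by (auto simp: infinity_graph_def)
  have sub: "signed_subgraph A G" "signed_subgraph B G"
    and un: "verts G = verts A \<union> verts B" "edges G = edges A \<union> edges B"
    using AB(4) by (auto simp: is_union_def)
  obtain as where as: "is_cycle (edges G) as" "verts A = set as" "edges A = cycle_edges as" "length as = p"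
      "nullity A = nullity (cycle_of G as)"
    using signed_cycle_subgraph[OF AB(1) sub(1)] .
  obtain bs where bs: "is_cycle (edges G) bs" "verts B = set bs" "edges B = cycle_edges bs" "length bs = q"
    using signed_cycle_subgraph[OF AB(2) sub(2)] by metis
  have "x \<in> set as" using AB(3) as(2) by auto
  then obtain ws where ws: "is_cycle (edges G) ws" "hd ws = x" "set ws = set as" "cycle_edges ws = cycle_edges as"
    using is_cycle_rotate[OF as(1)] by metis
  have "cycle_of G ws = cycle_of G as" using ws by (simp add: cycle_of_def)
  moreover have "nullity A = 2" "nullity B = 2" using two AB sub by (auto simp: cycles_have_nullity_2_def)
  ultimately have "nullity (cycle_of G ws) = 2" "nullity B = 2" using as(5) by auto
  then have "nullity G = 3"
    using nullity_glue_cycle[OF G ws(1) _ sub(2)] AB(3) un as ws by auto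
  moreover have "leaves G = {}"
  proof -
    have "v \<notin> leaves G" if "v \<in> verts G" for v
      using that un as(2) bs(2) cycle_vertex_not_leaf[OF G as(1)] cycle_vertex_not_leaf[OF G bs(1)] by auto
    then show ?thesis by (auto simp: leaves_def)
  qed
  moreover have "cyclomatic G = 2"
  proof -
    have d: "distinct as" "length as \<ge> 3" "distinct bs" "length bs \<ge> 3"
      using as(1) bs(1) by (auto simp: is_cycle_def)
    have "cycle_edges as \<inter> cycle_edges bs = {}"
      using pairs_disjoint[OF cycle_edges_pairs[OF d(1,2)] cycle_edges_pairs[OF d(3,4)]] AB(3) as(2) bs(2)
      by simp
    then have "card (edges G) = p + q"
      using un as bs d card_cycle_edges[OF d(1,2)] card_cycle_edges[OF d(3,4)]
      by (simp add: card_Un_disjoint)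
    moreover have "card (verts G) + 1 = p + q"
      using card_Un_Int[of "set as" "set bs"] AB(3) un as bs d by (simp add: distinct_card)
    ultimately show ?thesis by (simp add: cyclomatic_connected[OF conn])
  qed
  ultimately show ?thesis by (simp add: num_pendant_def)
qed

section \<open>Theta graphs\<close>

lemma path_between_decompose:
  assumes "path_between u v k vs" "k \<ge> 1"
  obtains ws where "vs = u # ws @ [v]" "length ws = k - 1"
proof -
  have vs: "length vs = Suc k" "hd vs = u" "last vs = v" using assms(1) by (auto simp: path_between_def)
  then have "vs \<noteq> []" "tl vs \<noteq> []" using assms(2) by (cases vs; force)+
  then have "vs = u # butlast (tl vs) @ [v]"
    using vs by (metis append_butlast_last_id last_tl list.collapse)
  then show thesis using that vs(1) by (metis diff_Suc_1 length_Cons length_append_singleton)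
qed

text \<open>Run along \<open>P\<close> and return through the interior of \<open>Q\<close> in
  reverse. If both paths had length 1 there would be no cycle.\<close>

lemma theta_cycle:
  assumes P: "path_between u v p P" "p \<ge> 1" and Q: "path_between u v q Q" "q \<ge> 1"
    and int: "set P \<inter> set Q = {u, v}" and E: "path_edges P \<subseteq> E" "path_edges Q \<subseteq> E" and pq: "\<not> (p = 1 \<and> q = 1)"
  obtains ws where "is_cycle E ws" "set ws = set P \<union> set Q" "cycle_edges ws = path_edges P \<union> path_edges Q"
    "length ws = p + q"
proof -
  obtain P' where P': "P = u # P' @ [v]" "length P' = p - 1" using path_between_decompose[OF P] .
  obtain Q' where Q': "Q = u # Q' @ [v]" "length Q' = q - 1" using path_between_decompose[OF Q] .
  have d: "distinct P" "distinct Q" using P Q by (auto simp: path_between_def)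
  let ?ws = "P @ rev Q'"
  have len: "length ?ws = p + q" using P' Q' P(2) Q(2) by simp
  have set: "set ?ws = set P \<union> set Q" using P' Q' by auto
  have "set P \<inter> set Q' = {}"
  proof -
    have "set P \<inter> set Q' \<subseteq> {u, v}" using int Q' by auto
    moreover have "u \<notin> set Q'" "v \<notin> set Q'" using d(2) Q' by auto
    ultimately show ?thesis by blast
  qed
  then have dist: "distinct ?ws" using d Q' by simp
  have ce: "cycle_edges ?ws = path_edges P \<union> path_edges Q"
  proof (cases "Q' = []")
    case True
    then show ?thesis using P' Q' by (simp add: cycle_edges_def insert_commute)
  next
    case False
    have "path_edges (P @ rev Q') = insert {last P, hd (rev Q')} (path_edges P \<union> path_edges (rev Q'))"
      by (rule path_edges_append) (use False P' in auto)
    moreover have "path_edges (u # (Q' @ [v])) = insert {u, hd Q'} (path_edges (Q' @ [v]))"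
      using False by (cases Q') auto
    moreover have "path_edges (Q' @ [v]) = insert {last Q', v} (path_edges Q')"
      using path_edges_append[of Q' "[v]"] False by simp
    ultimately show ?thesis
      using False P' Q' by (simp add: cycle_edges_def last_rev hd_rev insert_commute)
  qed
  have "is_cycle E ?ws" using dist len ce E pq P(2) Q(2) by (auto simp: is_cycle_def)
  then show thesis using that set ce len by blast
qed

text \<open>Here \<open>e1\<close>, \<open>e2\<close>, \<open>e3\<close> are the signs of the three
  paths of a theta graph and the last three equations say that its cycles are balanced. Multiplying
  them squares every sign, so p + q + l is even and hence so is each length. Then the numbers e
  (-1)^(length/2) of the three paths agree.\<close>

lemma pm_one_power_half:
  fixes e1 e2 e3 :: real
  assumes "e1 * e1 = 1" "e2 * e2 = 1" "e3 * e3 = 1"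
    and "even (p + q)" "even (p + l)" "even (q + l)"
    and "e1 * e2 = (-1) ^ ((p + q) div 2)" "e1 * e3 = (-1) ^ ((p + l) div 2)" "e2 * e3 = (-1) ^ ((q + l) div 2)"
  shows "even p" "even q" "even l"
    "e1 * (-1) ^ (p div 2) = e2 * (-1) ^ (q div 2)" "e1 * (-1) ^ (p div 2) = e3 * (-1) ^ (l div 2)"
proof -
  obtain i j k where "p + q = 2 * i" "p + l = 2 * j" "q + l = 2 * k" using assms(4-6) by (elim evenE)
  then have "(p + q) div 2 + (p + l) div 2 + (q + l) div 2 = p + q + l" by simp
  then have "(-1 :: real) ^ (p + q + l) = (e1 * e2) * (e1 * e3) * (e2 * e3)"
    unfolding assms(7-9) by (simp flip: power_add)
  also have "\<dots> = (e1 * e1) * (e2 * e2) * (e3 * e3)" by simp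
  finally have "even (p + q + l)" using assms(1-3) by (cases "even (p + q + l)") auto
  then show ev: "even p" "even q" "even l" using assms(4-6) by presburger+
  have *: "e * (-1) ^ (i div 2) = e' * (-1) ^ (j div 2)"
    if "e * e' = (-1) ^ ((i + j) div 2)" "e' * e' = 1" "even i" "even j" for e e' :: real and i j :: nat
  proof -
    have s: "(-1 :: real) ^ ((i + j) div 2) = (-1) ^ (i div 2) * (-1) ^ (j div 2)"
      using that(3,4) by (simp add: power_add[symmetric] div_add)
    have "e = e * (e' * e')" using that(2) by simp
    also have "\<dots> = (e * e') * e'" by (simp only: mult_ac)
    finally have "e = (-1) ^ (i div 2) * (-1) ^ (j div 2) * e'" unfolding that(1) s .
    then show ?thesis by (cases "even (i div 2)") auto
  qed
  show "e1 * (-1) ^ (p div 2) = e2 * (-1) ^ (q div 2)" by (rule *) (use assms ev in auto)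
  show "e1 * (-1) ^ (p div 2) = e3 * (-1) ^ (l div 2)" by (rule *) (use assms ev in auto)
qed

text \<open>Along each path a kernel vector satisfies the alternating recursion. As \<kappa> is
  common to the paths, a value \<open>a\<close> at \<open>u\<close> leads consistently to \<kappa> a
  at \<open>v\<close>. The second parameters of the paths must have sum zero, by the equation at
  \<open>u\<close> and equally by the one at \<open>v\<close>. Three parameters remain, read off at
  \<open>u\<close> and at the second vertices of \<open>P\<close> and \<open>Q\<close>.\<close>

lemma theta_graph_equality:
  assumes conn: "connected_graph G" and th: "theta_graph p q l G" and two: "cycles_have_nullity_2 G"
  shows "int (nullity G) = 2 * cyclomatic G + int (num_pendant G) - 1"
proof -
  obtain u v P Q R where G: "signed_graph G"
    and ge: "p \<ge> 1" "q \<ge> 1" "l \<ge> 1" "\<not> (p = 1 \<and> q = 1)" "\<not> (p = 1 \<and> l = 1)" "\<not> (q = 1 \<and> l = 1)"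
    and pb: "path_between u v p P" "path_between u v q Q" "path_between u v l R"
    and int: "set P \<inter> set Q = {u, v}" "set P \<inter> set R = {u, v}" "set Q \<inter> set R = {u, v}"
    and V: "verts G = set P \<union> set Q \<union> set R" and E: "edges G = path_edges P \<union> path_edges Q \<union> path_edges R"
    using th unfolding theta_graph_def by (elim conjE exE) (rule that, assumption+)
  have sub: "path_edges P \<subseteq> edges G" "path_edges Q \<subseteq> edges G" "path_edges R \<subseteq> edges G" using E by auto
  have d: "distinct P" "distinct Q" "distinct R" and len: "length P = Suc p" "length Q = Suc q" "length R = Suc l"
    and hd: "hd P = u" "hd Q = u" "hd R = u" and last: "last P = v" "last Q = v" "last R = v"
    using pb by (auto simp: path_between_def)
  have uv: "u \<noteq> v" using path_between_decompose[OF pb(1) ge(1)] d(1) by (metis distinct.simps(2) in_set_conv_decomp)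
  define eps where "eps X = prod (edge_sign G) (path_edges X)" for X
  \<comment> \<open>Besides balance this yields edge-disjointness, by counting: the cycle formed by
    two of the paths has as many edges as both together.\<close>
  have pair: "balanced G (path_edges X \<union> path_edges Y) \<and> path_edges X \<inter> path_edges Y = {}
      \<and> set X \<inter> leaves G = {} \<and> set Y \<inter> leaves G = {}"
    if h: "path_between u v i X" "i \<ge> 1" "path_between u v j Y" "j \<ge> 1" "set X \<inter> set Y = {u, v}"
      "path_edges X \<subseteq> edges G" "path_edges Y \<subseteq> edges G" "\<not> (i = 1 \<and> j = 1)" for X Y i j
  proof -
    obtain ws where ws: "is_cycle (edges G) ws" "set ws = set X \<union> set Y"
      "cycle_edges ws = path_edges X \<union> path_edges Y" "length ws = i + j"
      using theta_cycle[OF h] .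
    have "nullity (cycle_of G ws) = 2"
      using two cycle_of_signed_cycle[OF G ws(1)] unfolding cycles_have_nullity_2_def by blast
    then have b: "balanced G (path_edges X \<union> path_edges Y)"
      using cycle_nullity_2_iff_balanced[OF G ws(1)] ws(3) by simp
    have "card (path_edges X \<union> path_edges Y) = i + j"
      using card_cycle_edges[of ws] ws by (simp add: is_cycle_def)
    moreover have "card (path_edges X) = i" "card (path_edges Y) = j"
      using h by (simp_all add: path_between_def card_path_edges)
    ultimately have "card (path_edges X \<inter> path_edges Y) = 0"
      using card_Un_Int[of "path_edges X" "path_edges Y"] by simp
    then show ?thesis using b cycle_vertex_not_leaf[OF G ws(1)] ws(2) by auto
  qed
  note PQ = pair[OF pb(1) ge(1) pb(2) ge(2) int(1) sub(1,2) ge(4)]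
  note PR = pair[OF pb(1) ge(1) pb(3) ge(3) int(2) sub(1,3) ge(5)]
  note QR = pair[OF pb(2) ge(2) pb(3) ge(3) int(3) sub(2,3) ge(6)]
  have cardE: "card (path_edges P) = p" "card (path_edges Q) = q" "card (path_edges R) = l"
    using d len by (simp_all add: card_path_edges)
  have epsP: "eps P = path_sign G P p" "eps Q = path_sign G Q q" "eps R = path_sign G R l"
    using d len by (simp_all add: eps_def prod_path_edges)
  have *: "even (i + j)" "eps X * eps Y = (-1) ^ ((i + j) div 2)"
    if "balanced G (path_edges X \<union> path_edges Y)" "path_edges X \<inter> path_edges Y = {}"
      "card (path_edges X) = i" "card (path_edges Y) = j" for X Y i j
    using that by (simp_all add: balanced_def eps_def card_Un_disjoint prod.union_disjoint)
  have "eps P * eps P = 1" "eps Q * eps Q = 1" "eps R * eps R = 1"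
    unfolding epsP using len sub by (simp_all add: path_sign_square[OF G])
  moreover have "even (p + q)" "even (p + l)" "even (q + l)"
    "eps P * eps Q = (-1) ^ ((p + q) div 2)" "eps P * eps R = (-1) ^ ((p + l) div 2)" "eps Q * eps R = (-1) ^ ((q + l) div 2)"
    using PQ PR QR *[OF _ _ cardE(1,2)] *[OF _ _ cardE(1,3)] *[OF _ _ cardE(2,3)] by blast+
  ultimately have ev: "even p" "even q" "even l"
    and kap: "eps Q * (-1) ^ (q div 2) = eps P * (-1) ^ (p div 2)" "eps R * (-1) ^ (l div 2) = eps P * (-1) ^ (p div 2)"
    using pm_one_power_half[of "eps P" "eps Q" "eps R" p q l] by metis+
  \<comment> \<open>The factor by which the value at \<open>u\<close> is multiplied when carried
    along a path of even length to \<open>v\<close>; by balance it is the same for all three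
    paths.\<close>
  define \<kappa> where "\<kappa> = eps P * (-1) ^ (p div 2)"
  have kappa: "path_sign G P p * (-1) ^ (p div 2) = \<kappa>" "path_sign G Q q * (-1) ^ (q div 2) = \<kappa>"
    "path_sign G R l * (-1) ^ (l div 2) = \<kappa>"
    using kap by (simp_all add: \<kappa>_def epsP)
  have ge2: "p \<ge> 2" "q \<ge> 2" "l \<ge> 2" using ev ge by presburger+
  note fin = signed_graph_finite[OF G]
  have split: "adj G (verts G) (edges G) f w = adj G (set P) (path_edges P) f w
      + adj G (set Q) (path_edges Q) f w + adj G (set R) (path_edges R) f w" for f w
  proof -
    have "(path_edges P \<union> path_edges Q) \<inter> path_edges R = {}" using PR QR by blast
    then have "adj G (verts G) (edges G) f w = adj G (verts G) (path_edges P) f w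
      + adj G (verts G) (path_edges Q) f w + adj G (verts G) (path_edges R) f w"
      unfolding E using PQ by (simp add: adj_Un)
    moreover have *: "adj G (verts G) (path_edges X) f w = adj G (set X) (path_edges X) f w"
      if "distinct X" "set X \<subseteq> verts G" for X
      by (rule adj_enlarge[OF path_edges_pairs[OF that(1)] that(2) fin])
    have "set P \<subseteq> verts G" "set Q \<subseteq> verts G" "set R \<subseteq> verts G" using V by auto
    ultimately show ?thesis using *[OF d(1)] *[OF d(2)] *[OF d(3)] by simp
  qed
  have adj_path_fun: "adj G (set X) (path_edges X) F w = (if w = u then b else if w = v then - \<kappa> * b else 0)"
    if X: "distinct X" "length X = Suc n" "hd X = u" "last X = v" "path_edges X \<subseteq> edges G" "even n" "n \<ge> 2"
      "path_sign G X n * (-1) ^ (n div 2) = \<kappa>"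
      and F: "\<And>i. i \<le> n \<Longrightarrow> F (X ! i) = path_sign G X i * alt a b i" for X n F a b w
  proof -
    obtain k where k: "n = 2 * Suc k" using X(6,7) by (metis Suc_le_D dvd_def mult_is_0 not0_implies_Suc not_numeral_le_zero)
    have n: "length X = Suc (Suc (Suc (2 * k)))" using X(2) k by simp
    have F': "F (X ! i) = path_sign G X i * alt a b i" if "i < length X" for i using F that X(2) by simp
    have ne: "X \<noteq> []" using n by auto
    have h: "X ! 0 = u" "X ! n = v" using X(2-4) ne by (simp_all add: hd_conv_nth last_conv_nth)
    show ?thesis
    proof (cases "w \<in> set X")
      case False
      then have "w \<noteq> u" "w \<noteq> v" using X(3,4) ne by auto
      then show ?thesis using adj_outside[OF path_edges_pairs[OF X(1)] False] by simp
    next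
      case True
      then obtain i where i: "i < length X" "w = X ! i" by (auto simp: in_set_conv_nth)
      consider "i = 0" | "i = n" | j where "i = Suc j" "Suc (Suc j) < length X"
        using i(1) X(2) by (cases i) (auto, metis Suc_lessI less_antisym)
      then show ?thesis
      proof cases
        case 1
        then have "w = u" using h i by simp
        then show ?thesis using path_function_ends(1)[OF G X(1,5) n F'] X(3) by simp
      next
        case 2
        then have "w = v" using h i by simp
        moreover have "adj G (set X) (path_edges X) F v = path_sign G X n * alt a b (Suc (2 * k))"
          using path_function_ends(2)[OF G X(1,5) n F'] X(4) k by simp
        moreover have "\<kappa> = - (path_sign G X n * (-1) ^ k)" using X(8) k by simp
        ultimately show ?thesis using uv by (simp add: alt_def)
      next
        case 3
        have "w \<noteq> u" "w \<noteq> v"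
          using 3 i h X(1,2) by (auto simp: nth_eq_iff_index_eq simp flip: h)
        then show ?thesis using path_function_inner[OF G X(1,5) F' 3(2)] 3(1) i by simp
      qed
    qed
  qed
  have shared: "X ! i \<notin> set Y \<or> i = 0 \<or> i = n"
    if X: "distinct X" "length X = Suc n" "hd X = u" "last X = v" "set Y \<inter> set X = {u, v}" "i \<le> n" for X Y n i
  proof -
    have ne: "X \<noteq> []" using X(2) by auto
    have h: "X ! 0 = u" "X ! n = v" using X(2-4) ne by (simp_all add: hd_conv_nth last_conv_nth)
    have "X ! i \<in> set X" using X(2,6) by simp
    then have "X ! i \<in> set Y \<Longrightarrow> X ! i = u \<or> X ! i = v" using X(5) by blast
    then show ?thesis using X(1,2,6) h by (metis le_imp_less_Suc lessI nth_eq_iff_index_eq zero_less_Suc)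
  qed
  have null: "\<exists>F. null_fun G F \<and> F u = a \<and> F (P ! 1) = path_sign G P 1 * b1 \<and> F (Q ! 1) = path_sign G Q 1 * b2"
    for a b1 b2
  proof -
    have ex: "\<exists>f. \<forall>i<length X. f (X ! i) = path_sign G X i * alt a b i" if "distinct X" for X b
      by (rule path_function_exists[OF that])
    obtain fP where fP: "\<forall>i<length P. fP (P ! i) = path_sign G P i * alt a b1 i" using ex[OF d(1)] by blast
    obtain fQ where fQ: "\<forall>i<length Q. fQ (Q ! i) = path_sign G Q i * alt a b2 i" using ex[OF d(2)] by blast
    \<comment> \<open>The third parameter \<open>- b1 - b2\<close> makes the sum over the three
      paths vanish at \<open>u\<close>. At \<open>v\<close> the path contributions are these
      parameters times - \<kappa>, so they cancel too.\<close>
    obtain fR where fR: "\<forall>i<length R. fR (R ! i) = path_sign G R i * alt a (- b1 - b2) i"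
      using ex[OF d(3)] by blast
    define F where "F w = (if w \<in> set P then fP w else if w \<in> set Q then fQ w else fR w)" for w
    have ends: "X ! 0 = u" "X ! n = v" if "hd X = u" "last X = v" "length X = Suc n" for X n
    proof -
      have "X \<noteq> []" using that(3) by auto
      then show "X ! 0 = u" "X ! n = v" using that by (simp_all add: hd_conv_nth last_conv_nth)
    qed
    have endv: "path_sign G P p * alt a b p = \<kappa> * a" "path_sign G Q q * alt a b q = \<kappa> * a"
      "path_sign G R l * alt a b l = \<kappa> * a" for b
      using ev kappa by (simp_all add: alt_def flip: mult.assoc)
    have FP: "F (P ! i) = path_sign G P i * alt a b1 i" if "i \<le> p" for i
      using that fP len by (simp add: F_def)
    have Fu: "F u = a" and Fv: "F v = \<kappa> * a"
      using FP[of 0] FP[of p] ends[OF hd(1) last(1) len(1)] endv(1) by simp_all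
    have FQ: "F (Q ! i) = path_sign G Q i * alt a b2 i" if i: "i \<le> q" for i
    proof (cases "i = 0 \<or> i = q")
      case True
      then show ?thesis using Fu Fv endv(2) ends[OF hd(2) last(2) len(2)] by auto
    next
      case False
      then have "Q ! i \<notin> set P" using shared[OF d(2) len(2) hd(2) last(2) int(1) i] by blast
      then show ?thesis using i fQ len by (simp add: F_def)
    qed
    have FR: "F (R ! i) = path_sign G R i * alt a (- b1 - b2) i" if i: "i \<le> l" for i
    proof (cases "i = 0 \<or> i = l")
      case True
      then show ?thesis using Fu Fv endv(3) ends[OF hd(3) last(3) len(3)] by auto
    next
      case False
      then have "R ! i \<notin> set P" "R ! i \<notin> set Q"
        using shared[OF d(3) len(3) hd(3) last(3) int(2) i] shared[OF d(3) len(3) hd(3) last(3) int(3) i] by blast+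
      then show ?thesis using i fR len by (simp add: F_def)
    qed
    have "null_fun G F"
      unfolding null_fun_adj split
      using adj_path_fun[OF d(1) len(1) hd(1) last(1) sub(1) ev(1) ge2(1) kappa(1) FP]
        adj_path_fun[OF d(2) len(2) hd(2) last(2) sub(2) ev(2) ge2(2) kappa(2) FQ]
        adj_path_fun[OF d(3) len(3) hd(3) last(3) sub(3) ev(3) ge2(3) kappa(3) FR]
      by (simp add: algebra_simps)
    then show ?thesis using Fu FP[of 1] FQ[of 1] ge by (intro exI[of _ F]) simp
  qed
  have on_path: "f (X ! i) = path_sign G X i * alt (f (X ! 0)) (step_sign G X 0 * f (X ! 1)) i"
    if f: "null_fun G f" and X: "distinct X" "path_edges X \<subseteq> edges G" "length X = Suc n" "hd X = u" "last X = v"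
      and inner: "\<And>w. w \<in> set X \<Longrightarrow> w \<noteq> u \<Longrightarrow> w \<noteq> v \<Longrightarrow> adj G (set X) (path_edges X) f w = 0"
      and i: "i \<le> n" for f X n i
  proof (rule path_solution[OF G X(1,2)])
    have ne: "X \<noteq> []" using X(3) by auto
    have h: "X ! 0 = u" "X ! n = v" using X(3-5) ne by (simp_all add: hd_conv_nth last_conv_nth)
    fix j assume j: "Suc (Suc j) < length X"
    then have "X ! Suc j \<noteq> X ! 0" "X ! Suc j \<noteq> X ! n" using X(1,3) by (simp_all add: nth_eq_iff_index_eq)
    then show "adj G (set X) (path_edges X) f (X ! Suc j) = 0" using inner[of "X ! Suc j"] h j by simp
  qed (use i X(3) in simp)
  have inner: "adj G (set P) (path_edges P) f w = 0 \<or> w \<notin> set P"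
      "adj G (set Q) (path_edges Q) f w = 0 \<or> w \<notin> set Q"
      "adj G (set R) (path_edges R) f w = 0 \<or> w \<notin> set R"
    if "null_fun G f" "w \<noteq> u" "w \<noteq> v" for f w
  proof -
    have zero: "adj G (set X) (path_edges X) f w = 0" if "distinct X" "w \<notin> set X" for X
      by (rule adj_outside[OF path_edges_pairs[OF that(1)] that(2)])
    have "w \<in> verts G \<longrightarrow> adj G (verts G) (edges G) f w = 0" using that(1) by (simp add: null_fun_adj)
    moreover have "w \<notin> set P \<or> w \<notin> set Q" "w \<notin> set P \<or> w \<notin> set R" "w \<notin> set Q \<or> w \<notin> set R"
      using that(2,3) int by auto
    ultimately show "adj G (set P) (path_edges P) f w = 0 \<or> w \<notin> set P"
      "adj G (set Q) (path_edges Q) f w = 0 \<or> w \<notin> set Q"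
      "adj G (set R) (path_edges R) f w = 0 \<or> w \<notin> set R"
      using V split[of f w] zero[OF d(1)] zero[OF d(2)] zero[OF d(3)]
      by (cases "w \<in> set P"; cases "w \<in> set Q"; cases "w \<in> set R"; simp)+
  qed
  have nth0: "P ! 0 = u" "Q ! 0 = u" "R ! 0 = u" using hd len by (auto simp: hd_conv_nth simp flip: length_greater_0_conv)
  have "nullity G = card {u, P ! 1, Q ! 1}"
  proof (rule nullity_eq_card[OF fin])
    have mem: "u \<in> set P" "P ! 1 \<in> set P" "Q ! 1 \<in> set Q" using int len ge by auto
    then show "{u, P ! 1, Q ! 1} \<subseteq> verts G" using V by auto
    show "forcing G {u, P ! 1, Q ! 1}"
      unfolding forcing_def
    proof (intro allI impI ballI)
      fix f w assume f: "null_fun G f" "\<forall>s\<in>{u, P ! 1, Q ! 1}. f s = 0" and w: "w \<in> verts G"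
      have z: "f x = 0" if X: "distinct X" "path_edges X \<subseteq> edges G" "length X = Suc n" "hd X = u" "last X = v"
        and inner: "\<And>w. w \<in> set X \<Longrightarrow> w \<noteq> u \<Longrightarrow> w \<noteq> v \<Longrightarrow> adj G (set X) (path_edges X) f w = 0"
        and "f (X ! 0) = 0" "f (X ! 1) = 0" "x \<in> set X" for x X n
      proof -
        obtain i where "i \<le> n" "x = X ! i" using \<open>x \<in> set X\<close> X(3) by (auto simp: in_set_conv_nth less_Suc_eq_le)
        then show ?thesis using on_path[OF f(1) X inner] that(7,8) by (simp add: alt_def)
      qed
      have zP: "f x = 0" if "x \<in> set P" for x
        by (rule z[OF d(1) sub(1) len(1) hd(1) last(1) _ _ _ that]) (use f nth0 inner(1)[OF f(1)] in auto)
      have zQ: "f x = 0" if "x \<in> set Q" for x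
        by (rule z[OF d(2) sub(2) len(2) hd(2) last(2) _ _ _ that]) (use f nth0 inner(2)[OF f(1)] in auto)
      \<comment> \<open>\<open>P\<close> and \<open>Q\<close> contribute nothing at
        \<open>u\<close>, so the equation there isolates the second vertex of \<open>R\<close> and
        makes the third path vanish as well.\<close>
      have "adj G (set P) (path_edges P) f u = 0" "adj G (set Q) (path_edges Q) f u = 0"
        using zP zQ by (auto simp: adj_def intro!: sum.neutral)
      moreover have "adj G (verts G) (edges G) f u = 0" using f(1) mem V by (auto simp: null_fun_adj)
      ultimately have "adj G (set R) (path_edges R) f (R ! 0) = 0" using split[of f u] nth0 by simp
      then have "step_sign G R 0 * f (R ! 1) = 0" using adj_path[OF d(3), of 0 G f] len ge by simp
      moreover have "step_sign G R 0 \<noteq> 0" using step_sign_square[OF G sub(3), of 0] len ge by auto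
      ultimately have R1: "f (R ! 1) = 0" by simp
      have "f x = 0" if "x \<in> set R" for x
        by (rule z[OF d(3) sub(3) len(3) hd(3) last(3) _ _ R1 that]) (use f nth0 inner(3)[OF f(1)] in auto)
      then show "f w = 0" using w V zP zQ by auto
    qed
    fix s assume s: "s \<in> {u, P ! 1, Q ! 1}"
    have pnz: "path_sign G P 1 \<noteq> 0" "path_sign G Q 1 \<noteq> 0"
      using path_sign_square[OF G sub(1), of 1] path_sign_square[OF G sub(2), of 1] len ge by auto
    have "s = u \<or> s = P ! 1 \<or> s = Q ! 1" using s by blast
    then show "\<exists>f. null_fun G f \<and> f s \<noteq> 0 \<and> (\<forall>t\<in>{u, P ! 1, Q ! 1} - {s}. f t = 0)"
    proof (elim disjE)
      assume "s = u" then show ?thesis using null[of 1 0 0] by auto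
    next
      assume "s = P ! 1" then show ?thesis using null[of 0 1 0] pnz by auto
    next
      assume "s = Q ! 1" then show ?thesis using null[of 0 0 1] pnz by auto
    qed
  qed
  moreover have "card {u, P ! 1, Q ! 1} = 3"
  proof -
    have "P ! 1 \<notin> set Q" using shared[OF d(1) len(1) hd(1) last(1), of Q 1] int(1) ge2 by (auto simp: Int_commute)
    moreover have "Q ! 1 \<in> set Q" "u \<in> set Q" using len ge int by auto
    moreover have "Q ! 1 \<noteq> u" using nth0 d(2) len ge nth_eq_iff_index_eq[of Q 1 0] by auto
    ultimately have "P ! 1 \<noteq> Q ! 1" "P ! 1 \<noteq> u" "Q ! 1 \<noteq> u" by auto
    then show ?thesis by auto
  qed
  moreover have "leaves G = {}"
    using PQ PR V by (auto simp: leaves_def)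
  moreover have "cyclomatic G = 2"
  proof -
    have "(path_edges P \<union> path_edges Q) \<inter> path_edges R = {}" using PR QR by blast
    then have "card (edges G) = p + q + l" unfolding E using PQ cardE by (simp add: card_Un_disjoint)
    moreover have "card (set P) = Suc p" "card (set Q) = Suc q" "card (set R) = Suc l"
      using d len by (simp_all add: distinct_card)
    moreover have "card {u, v} = 2" using uv by simp
    moreover have "(set P \<union> set Q) \<inter> set R = {u, v}" using int by auto
    ultimately show ?thesis
      using card_Un_Int[of "set P" "set Q"] card_Un_Int[of "set P \<union> set Q" "set R"] int V
      by (simp add: cyclomatic_connected[OF conn])
  qed
  ultimately show ?thesis by (simp add: num_pendant_def)
qed

section \<open>Extremal graphs\<close>

text \<open>Each edge outside \<open>F0\<close> brings at most two new ends, so any saving among the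
  ends of \<open>F0\<close> is a saving for all of \<open>F\<close>.\<close>

lemma card_Union_pairs_le:
  assumes "finite F" "\<And>e. e \<in> F \<Longrightarrow> card e = 2" "F0 \<subseteq> F"
  shows "card (\<Union>F) + 2 * card F0 \<le> card (\<Union>F0) + 2 * card F"
proof -
  have fin: "finite e" if "e \<in> F" for e using assms(2)[OF that] by (metis card.infinite zero_neq_numeral)
  have finF0: "finite F0" using assms finite_subset by blast
  have "\<Union>F = \<Union>F0 \<union> \<Union>(F - F0)" using assms(3) by auto
  then have "card (\<Union>F) \<le> card (\<Union>F0) + card (\<Union>(F - F0))" using card_Un_le by metis
  moreover have "card (\<Union>(F - F0)) \<le> (\<Sum>e\<in>F - F0. card e)"
    by (rule card_Union_le_sum_card)
  moreover have "(\<Sum>e\<in>F - F0. card e) = 2 * card (F - F0)" using assms(2) by simp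
  moreover have "card F = card F0 + card (F - F0)"
    using assms finF0 by (metis card_Diff_subset card_mono le_add_diff_inverse)
  ultimately show ?thesis by simp
qed

lemma card_Union_two_pairs: "card (\<Union>{{x, a}, {x, b}}) \<le> 3"
proof -
  have "\<Union>{{x, a}, {x, b}} = set [x, a, b]" by auto
  then show ?thesis using card_length[of "[x, a, b]"] by simp
qed

lemma closing_edge_in_cycle: "{hd vs, last vs} \<in> cycle_edges vs"
  by (simp add: cycle_edges_def insert_commute)

lemma path_edges_in_cycle: "path_edges vs \<subseteq> cycle_edges vs"
  by (auto simp: cycle_edges_def)

lemma cycle_off_edge:
  assumes "conn V E" "E \<subseteq> pairs V" "is_cycle E vs" "E \<noteq> cycle_edges vs"
  obtains y z where "y \<in> set vs" "{y, z} \<in> E - cycle_edges vs"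
proof (cases "set vs = V")
  case True
  obtain e where "e \<in> E" "e \<notin> cycle_edges vs" using assms(3,4) by (auto simp: is_cycle_def)
  then show thesis using that pairsE[OF assms(2)] True by (metis DiffI)
next
  case False
  have sub: "set vs \<subseteq> V" by (rule is_cycle_set[OF assms(3,2)])
  have ne: "vs \<noteq> []" using assms(3) by (auto simp: is_cycle_def)
  obtain v where "v \<in> V" "v \<notin> set vs" using False sub by blast
  then obtain y z where yz: "y \<in> set vs" "z \<notin> set vs" "{y, z} \<in> E"
    using conn_cut[OF assms(1,2) hd_in_set[OF ne] sub] by metis
  then have "{y, z} \<notin> cycle_edges vs" using cycle_edges_subset[OF ne] by blast
  then show thesis using that yz by blast
qed

text \<open>\<open>c\<close> is the cyclomatic number, for a connected graph. Both equations avoid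
  subtraction of naturals, and \<open>c\<close> may be 0, so that trees are the base of the
  induction.\<close>

locale extremal =
  fixes G :: "'a signed_graph" and c :: nat
  assumes signed: "signed_graph G" and connected: "connected_graph G"
    and cyclomatic: "Suc (card (edges G)) = card (verts G) + c"
    and equality: "Suc (nullity G) = 2 * c + num_pendant G"
begin

abbreviation "V \<equiv> verts G"
abbreviation "E \<equiv> edges G"

lemma pairs: "E \<subseteq> pairs V" and finV: "finite V" and neV: "V \<noteq> {}" and connE: "conn V E" and finE: "finite E"
  using signed_graph_pairs[OF signed] signed_graph_finite[OF signed] connected connected_graph_conn
    finite_pairs by (auto simp: connected_graph_conn)

lemma forcing_large:
  assumes "S \<subseteq> V" "forcing G S" shows "2 * c + num_pendant G \<le> Suc (card S)"
  using nullity_le_card[OF finV assms] equality by simp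

lemma finite_cut: "finite (cut_set G T)"
  using cut_set_subset[OF signed] finV finite_subset by blast

text \<open>With \<open>F0 = {}\<close> this is the bound 2c + p. Two edges of \<open>F0\<close>
  with a common end improve it by one. An improvement by two contradicts
  \<open>forcing_large\<close>.\<close>

lemma cut_card:
  assumes "sptree V T" "T \<subseteq> E" "F0 \<subseteq> E - T"
  shows "card (cut_set G T) + 2 * card F0 \<le> card (\<Union>F0) + 2 * c + num_pendant G"
proof -
  have "finite T" using assms(2) finE finite_subset by blast
  then have "card (E - T) = c"
    using assms cyclomatic card_Diff_subset[of T E] by (auto simp: sptree_def)
  moreover have "card (\<Union>(E - T)) + 2 * card F0 \<le> card (\<Union>F0) + 2 * card (E - T)"
    by (rule card_Union_pairs_le) (use finE pairs assms(3) in \<open>auto simp: pairs_def\<close>)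
  moreover have "card (cut_set G T) \<le> card (\<Union>(E - T)) + num_pendant G"
    unfolding cut_set_def num_pendant_def by (rule card_Un_le)
  ultimately show ?thesis by simp
qed

lemma cut_forcing: "sptree V T \<Longrightarrow> T \<subseteq> E \<Longrightarrow> {x, y} \<in> E \<Longrightarrow> forcing G (cut_set G T)"
  using cut_set_forcing[OF signed, of T x y] pairsD[OF pairs, of x y] by blast

section \<open>Two edges at one vertex whose deletion leaves the graph connected\<close>

lemma nonbridge_no_leaf:
  assumes xa: "{x, a} \<in> E" and xb: "{x, b} \<in> E" and ab: "a \<noteq> b" and con: "conn V (E - {{x, a}, {x, b}})"
  shows "leaves G = {}"
proof (rule ccontr)
  assume "leaves G \<noteq> {}"
  then obtain r where r: "r \<in> leaves G" by blast
  \<comment> \<open>A tree avoiding both edges already saves one vertex, their common end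
    \<open>x\<close>. Dropping the leaf \<open>r\<close> would save a second one.\<close>
  obtain T where T: "T \<subseteq> E - {{x, a}, {x, b}}" "sptree V T"
    using sptree_exists[OF finV neV _ con] pairs by blast
  have TE: "T \<subseteq> E" using T by blast
  let ?F0 = "{{x, a}, {x, b}}"
  have "card ?F0 = 2" using ab by (auto simp: doubleton_eq_iff card_insert_if)
  moreover have "?F0 \<subseteq> E - T" using T(1) xa xb by blast
  ultimately have "card (cut_set G T) + 1 \<le> 2 * c + num_pendant G"
    using cut_card[OF T(2) TE, of ?F0] card_Union_two_pairs[of x a b] by linarith
  moreover have "r \<in> cut_set G T" using r by (simp add: cut_set_def)
  then have "Suc (card (cut_set G T - {r})) = card (cut_set G T)"
    using finite_cut by (metis card_Suc_Diff1)
  moreover have "2 * c + num_pendant G \<le> Suc (card (cut_set G T - {r}))"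
    by (rule forcing_large[OF _ cut_set_forcing_drop_leaf[OF signed T(2) TE r]])
      (use cut_set_subset[OF signed] in blast)
  ultimately show False by simp
qed

lemma nonbridge_cyclomatic:
  assumes xa: "{x, a} \<in> E" and xb: "{x, b} \<in> E" and ab: "a \<noteq> b" and con: "conn V (E - {{x, a}, {x, b}})"
  shows "c = 2"
proof (rule ccontr)
  assume "c \<noteq> 2"
  have p0: "num_pendant G = 0" using nonbridge_no_leaf[OF assms] by (simp add: num_pendant_def)
  let ?F0 = "{{x, a}, {x, b}}"
  let ?E2 = "E - ?F0"
  have card2: "card ?F0 = 2" using ab by (auto simp: doubleton_eq_iff card_insert_if)
  have E2: "?E2 \<subseteq> pairs V" using pairs by blast
  have cE2: "card E = card ?E2 + 2"
    using card_Diff_subset[of ?F0 E] card2 xa xb finE card_mono[of E ?F0] by simp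
  have "c \<ge> 2" using conn_card[OF finV neV E2 con] cE2 cyclomatic by simp
  then have c3: "c \<ge> 3" using \<open>c \<noteq> 2\<close> by simp
  then obtain vs where vs: "is_cycle ?E2 vs"
    using cycle_exists[OF finV neV E2 con] cE2 cyclomatic by auto
  have vsE: "is_cycle E vs" using vs by (rule is_cycle_mono) blast
  have "E \<noteq> cycle_edges vs" using vs xa by (auto simp: is_cycle_def)
  then obtain y z' where yz': "y \<in> set vs" "{y, z'} \<in> E - cycle_edges vs"
    using cycle_off_edge[OF connE pairs vsE] by metis
  obtain ws where ws: "is_cycle ?E2 ws" "hd ws = y" "cycle_edges ws = cycle_edges vs"
    using is_cycle_rotate[OF vs yz'(1)] by metis
  define z where "z = last ws"
  obtain u where u: "{y, u} \<in> path_edges ws" "u \<noteq> z"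
    using cycle_second[OF ws(1)] ws(2) by (metis z_def)
  have yz: "{y, z} \<in> cycle_edges ws"
    using closing_edge_in_cycle[of ws] ws(2) by (simp add: z_def)
  then have yz2: "{y, z} \<in> ?E2" using ws(1) unfolding is_cycle_def by blast
  have con3: "conn V (?E2 - {{y, z}})"
    using conn_remove_cycle_edge[OF con ws(1)] ws(2) by (simp add: z_def)
  obtain T where T: "T \<subseteq> ?E2 - {{y, z}}" "sptree V T"
    using sptree_exists[OF finV neV _ con3] pairs by blast
  have TE: "T \<subseteq> E" using T by blast
  have F: "{x, a} \<in> E - T" "{x, b} \<in> E - T" "{y, z} \<in> E - T" using T(1) xa xb yz2 by blast+
  have large: "2 * c \<le> Suc (card (cut_set G T))"
    using forcing_large[OF cut_set_subset[OF signed] cut_forcing[OF T(2) TE xa]] p0 by simp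
  \<comment> \<open>Otherwise three edges outside the tree have at most four ends instead of
    six.\<close>
  have y_not: "y \<notin> {x, a, b}"
  proof
    assume y: "y \<in> {x, a, b}"
    let ?M = "{{y, z}, {x, a}, {x, b}}"
    have "{y, z} \<notin> ?F0" using yz2 by blast
    then have "card ?M = 3" using card_insert_disjoint[of ?F0 "{y, z}"] card2 by simp
    moreover have "card (\<Union>?M) \<le> card (set [x, a, b, z])" by (rule card_mono) (use y in auto)
    moreover have "card (set [x, a, b, z]) \<le> 4"
      using card_length[of "[x, a, b, z]"] by simp
    moreover have "?M \<subseteq> E - T" using F by blast
    ultimately show False using cut_card[OF T(2) TE, of ?M] large p0 by linarith
  qed
  \<comment> \<open>Otherwise four edges outside the tree have at most six ends instead of
    eight.\<close>
  have unique: "w = z" if w: "{y, w} \<in> E - T" for w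
  proof (rule ccontr)
    assume "w \<noteq> z"
    let ?M = "{{y, w}, {y, z}, {x, a}, {x, b}}"
    have h: "{y, w} \<noteq> {y, z}" using \<open>w \<noteq> z\<close> by (auto simp: doubleton_eq_iff)
    have "e \<notin> ?F0" if "y \<in> e" for e using y_not that by auto
    then have h0: "{y, w} \<notin> ?F0" "{y, z} \<notin> ?F0" by blast+
    have "card (insert {y, z} ?F0) = 3" using card_insert_disjoint[OF _ h0(2)] card2 by simp
    moreover have "{y, w} \<notin> insert {y, z} ?F0" using h h0 by blast
    ultimately have "card ?M = 4" using card_insert_disjoint[of "insert {y, z} ?F0" "{y, w}"] by simp
    moreover have "card (\<Union>?M) \<le> card (set [x, a, b, y, z, w])" by (rule card_mono) auto
    moreover have "card (set [x, a, b, y, z, w]) \<le> 6"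
      using card_length[of "[x, a, b, y, z, w]"] by simp
    moreover have "?M \<subseteq> E - T" using F w by blast
    ultimately show False using cut_card[OF T(2) TE, of ?M] large p0 by linarith
  qed
  have "{y, u} \<in> E" using u(1) ws(1) path_edges_in_cycle[of ws] unfolding is_cycle_def by blast
  then have yu: "{y, u} \<in> T" using unique[of u] u(2) by blast
  have "z' \<noteq> z" using yz' yz ws(3) by auto
  then have yz'T: "{y, z'} \<in> T" using unique[of z'] yz'(2) by blast
  have "u \<noteq> z'" using u(1) yz'(2) ws(3) path_edges_in_cycle[of ws] by auto
  then have "forcing G (cut_set G T - {y})"
    using cut_set_forcing_drop_major[OF signed T(2) TE F(3) unique yu yz'T] by simp
  then have "2 * c \<le> Suc (card (cut_set G T - {y}))"
    using forcing_large[of "cut_set G T - {y}"] cut_set_subset[OF signed] p0 by force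
  moreover have "y \<in> cut_set G T" using cut_setI(1)[OF F(3)] .
  then have "Suc (card (cut_set G T - {y})) = card (cut_set G T)"
    using finite_cut by (metis card_Suc_Diff1)
  moreover have "card (cut_set G T) + 1 \<le> 2 * c"
  proof -
    have "?F0 \<subseteq> E - T" using F by blast
    then show ?thesis
      using cut_card[OF T(2) TE, of ?F0] card_Union_two_pairs[of x a b] card2 p0 by linarith
  qed
  ultimately show False by simp
qed

text \<open>As c = 2, deleting the two edges leaves a spanning tree. With no leaves in
  \<open>G\<close> the cut set of this tree is known exactly, and the nullity is 2 * 2 + 0 -
  1.\<close>

lemma nonbridge_sptree:
  assumes xa: "{x, a} \<in> E" and xb: "{x, b} \<in> E" and ab: "a \<noteq> b" and con: "conn V (E - {{x, a}, {x, b}})"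
  shows "sptree V (E - {{x, a}, {x, b}})" "cut_set G (E - {{x, a}, {x, b}}) = {x, a, b}" "nullity G = 3"
proof -
  let ?F0 = "{{x, a}, {x, b}}"
  note c2 = nonbridge_cyclomatic[OF assms] and nl = nonbridge_no_leaf[OF assms]
  have card2: "card ?F0 = 2" using ab by (auto simp: doubleton_eq_iff card_insert_if)
  have "card E = card (E - ?F0) + 2"
    using card_Diff_subset[of ?F0 E] card2 xa xb finE card_mono[of E ?F0] by simp
  then show "sptree V (E - ?F0)" using finV neV pairs con cyclomatic c2 by (auto simp: sptree_def)
  have "E - (E - ?F0) = ?F0" using xa xb by blast
  then show "cut_set G (E - ?F0) = {x, a, b}" using nl by (auto simp: cut_set_def)
  show "nullity G = 3" using equality c2 nl by (simp add: num_pendant_def)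
qed

text \<open>Root the tree at \<open>x\<close> and take a deepest vertex on the side of
  \<open>e\<close> away from \<open>x\<close>. It lies in the cut set, so it is \<open>a\<close> or
  \<open>b\<close>, and its deleted edge to \<open>x\<close> crosses and must be \<open>e\<close>.
  Then the tree has no edge into that side.\<close>

lemma nonbridge_no_bridge:
  assumes xa: "{x, a} \<in> E" and xb: "{x, b} \<in> E" and ab: "a \<noteq> b" and con: "conn V (E - {{x, a}, {x, b}})"
  shows "conn V (E - {e})"
proof (rule ccontr)
  assume nb: "\<not> conn V (E - {e})"
  let ?T = "E - {{x, a}, {x, b}}"
  note T = nonbridge_sptree[OF assms]
  have xV: "x \<in> V" using pairsD[OF pairs xa] by blast
  obtain Y where Y: "Y \<subseteq> V" "x \<notin> Y" "Y \<noteq> {}"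
    and cut: "\<And>u v. u \<in> Y \<Longrightarrow> v \<in> V \<Longrightarrow> {u, v} \<in> E \<Longrightarrow> v \<notin> Y \<Longrightarrow> {u, v} = e"
    using bridge_side[OF connE nb xV] by metis
  obtain par d where R: "rooted V ?T x par d" using sptree_rooted[OF T(1) xV] .
  have "finite Y" using Y(1) finV finite_subset by blast
  then obtain t where t: "t \<in> Y" "\<And>u. u \<in> V \<Longrightarrow> u \<noteq> x \<Longrightarrow> par u \<noteq> t"
    using childless_exists[OF R _ Y(3)] rooted_children_closed[OF R Y(1,2), of e] cut
    by (metis DiffD1)
  have "t \<in> cut_set G ?T" by (rule childless_in_cut_set[OF signed R]) (use t Y in auto)
  then have "t = a \<or> t = b" using T(2) t(1) Y(2) by auto
  then have "{t, x} \<in> {{x, a}, {x, b}}" "{t, x} \<in> E" using xa xb by (auto simp: insert_commute)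
  moreover from this have "{t, x} = e" using cut[OF t(1) xV] Y(2) by blast
  ultimately have eF: "e \<notin> ?T" by blast
  obtain u v where "u \<in> Y" "v \<in> V" "v \<notin> Y" "{u, v} \<in> ?T"
    using conn_cut[of V ?T t Y x] T(1) t(1) Y xV by (auto simp: sptree_def)
  then show False using cut eF by (metis DiffD1)
qed

text \<open>As there are no bridges, every cycle can take the role of the given one: it has a vertex
  \<open>y\<close> with an edge \<open>{y, b'}\<close> off it, and deleting this edge and a cycle
  edge \<open>{y, a'}\<close> keeps the graph connected. The cut set is then
  \<open>{y, a', b'}\<close>. The nullity 3 exceeds the size of \<open>{y, b'}\<close>, so a nonzero
  kernel vector vanishes at both, and it is supported on the cycle.\<close>

lemma nonbridge_cycle_nullity:
  assumes xa: "{x, a} \<in> E" and xb: "{x, b} \<in> E" and ab: "a \<noteq> b" and con: "conn V (E - {{x, a}, {x, b}})"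
    and vs: "is_cycle E vs"
  shows "balanced G (cycle_edges vs)"
proof -
  \<comment> \<open>A cycle has as many edges as vertices, hence at most |V|, whereas c = 2 means
    |V| + 1 edges; so some edge is off the cycle.\<close>
  have "card (cycle_edges vs) = card (set vs)"
    using vs card_cycle_edges[of vs] by (auto simp: is_cycle_def distinct_card)
  also have "\<dots> \<le> card V" using is_cycle_set[OF vs pairs] finV by (simp add: card_mono)
  finally have "E \<noteq> cycle_edges vs" using cyclomatic nonbridge_cyclomatic[OF xa xb ab con] by auto
  then obtain y b' where yb: "y \<in> set vs" "{y, b'} \<in> E - cycle_edges vs"
    using cycle_off_edge[OF connE pairs vs] by metis
  obtain ws where ws: "is_cycle E ws" "hd ws = y" "set ws = set vs" "cycle_edges ws = cycle_edges vs"
    using is_cycle_rotate[OF vs yb(1)] by metis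
  define a' where "a' = last ws"
  have ya1: "{y, a'} \<in> cycle_edges ws"
    using closing_edge_in_cycle[of ws] ws(2) by (simp add: a'_def)
  then have ya2: "{y, a'} \<in> E" using ws(1) unfolding is_cycle_def by blast
  note ya = ya1 ya2 pairsD[OF pairs ya2, THEN conjunct2, THEN conjunct2]
  have ab': "a' \<noteq> b'" using ya(1) yb(2) ws(4) by auto
  have con1: "conn V (E - {{y, b'}})" by (rule nonbridge_no_bridge[OF xa xb ab con])
  have "is_cycle (E - {{y, b'}}) ws" using ws yb(2) by (auto simp: is_cycle_def)
  then have "conn V (E - {{y, b'}} - {{y, a'}})"
    using conn_remove_cycle_edge[OF con1] ws(2) by (metis a'_def)
  moreover have "E - {{y, b'}} - {{y, a'}} = E - {{y, a'}, {y, b'}}" by blast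
  ultimately have con2: "conn V (E - {{y, a'}, {y, b'}})" by simp
  have yb'E: "{y, b'} \<in> E" using yb by simp
  let ?T = "E - {{y, a'}, {y, b'}}"
  note T = nonbridge_sptree[OF ya(2) yb'E ab' con2]
  have TE: "?T \<subseteq> E" by blast
  have "card {y, b'} \<le> 2" using card_length[of "[y, b']"] by simp
  then have "\<not> forcing G {y, b'}"
    using nullity_le_card[OF finV, of "{y, b'}"] T(3) pairsD[OF pairs yb'E] by auto
  then obtain f v where f: "null_fun G f" "f y = 0" "f b' = 0" "v \<in> V" "f v \<noteq> 0"
    unfolding forcing_def by auto
  have pe: "path_edges ws \<subseteq> ?T"
  proof -
    have "{y, a'} \<notin> path_edges ws"
      using ws(1,2) closing_edge_notin_path[of ws] by (simp add: is_cycle_def a'_def insert_commute)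
    moreover have "cycle_edges ws \<subseteq> E" using ws(1) by (simp add: is_cycle_def)
    ultimately show ?thesis using path_edges_in_cycle[of ws] ws(4) yb(2) by blast
  qed
  have un: "w = hd ws" if "{last ws, w} \<in> E - ?T" for w
    using that ya(3) ab' ws(2) by (auto simp: a'_def doubleton_eq_iff)
  have zero: "f s = 0" if "s \<in> cut_set G ?T" "s \<noteq> last ws" for s
    using that T(2) f(2,3) by (auto simp: a'_def)
  have "null_fun (cycle_of G ws) f"
    by (rule null_fun_concentrates_on_cycle(1)[OF signed T(1) TE ws(1) pe un f(1) zero])
  moreover have "v \<in> set ws"
    using null_fun_concentrates_on_cycle(2)[OF signed T(1) TE ws(1) pe un f(1) zero, of v] f(4,5) by auto
  ultimately show ?thesis using balanced_if_null_fun[of G ws f v] signed ws(1,4) f(5) by simp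
qed

end

lemma path_edge_split:
  assumes "e \<in> path_edges vs"
  obtains as bs where "vs = as @ bs" "as \<noteq> []" "bs \<noteq> []" "e = {last as, hd bs}"
proof -
  obtain i where i: "Suc i < length vs" "e = {vs ! i, vs ! Suc i}" using assms by (auto simp: path_edges_def)
  have "last (take (Suc i) vs) = vs ! i" using i(1) by (simp add: take_Suc_conv_app_nth)
  moreover have "hd (drop (Suc i) vs) = vs ! Suc i" using i(1) by (simp add: hd_drop_conv_nth)
  moreover have "take (Suc i) vs \<noteq> []" "drop (Suc i) vs \<noteq> []" using i(1) by auto
  ultimately show thesis using that[of "take (Suc i) vs" "drop (Suc i) vs"] i(2) by simp
qed

context extremal
begin

text \<open>Follow the tree from \<open>b\<close> until it hits the cycle at \<open>y\<close>. The
  cycle and this path contain the whole cut set, so no further vertices are left. The path together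
  with \<open>{x, b}\<close> is a second cycle if y = x, and otherwise the third path of a theta
  graph with ends \<open>x\<close> and \<open>y\<close>.\<close>

lemma nonbridge_structure:
  assumes vs: "is_cycle E vs" and xa: "x = hd vs" "a = last vs"
    and xb: "{x, b} \<in> E - cycle_edges vs" and con: "conn V (E - {{x, a}, {x, b}})"
  shows "(\<exists>p q. infinity_graph p q G) \<or> (\<exists>p q l. theta_graph p q l G)"
proof -
  let ?T = "E - {{x, a}, {x, b}}"
  have vs': "distinct vs" "length vs \<ge> 3" "cycle_edges vs \<subseteq> E" "vs \<noteq> []"
    using vs by (auto simp: is_cycle_def)
  have xaC: "{x, a} \<in> cycle_edges vs" using closing_edge_in_cycle[of vs] xa by simp
  have xaE: "{x, a} \<in> E" and xbE: "{x, b} \<in> E" using xaC vs'(3) xb by auto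
  have ab: "a \<noteq> b" using xaC xb by auto
  note T = nonbridge_sptree[OF xaE xbE ab con]
  have TE: "?T \<subseteq> E" by blast
  have inV: "x \<in> V" "b \<in> V" "x \<noteq> b" "a \<in> V" "x \<noteq> a"
    using pairsD[OF pairs xaE] pairsD[OF pairs xbE] by auto
  have xset: "x \<in> set vs" "a \<in> set vs" using xa vs'(4) by auto
  have "(b, x) \<in> reach ?T" using con inV by (auto simp: conn_def)
  then obtain qs where qs: "qs \<noteq> []" "distinct qs" "hd qs = b" "last qs \<in> set vs" "path_edges qs \<subseteq> ?T"
    "set (butlast qs) \<inter> set vs = {}"
    using obtain_path_to_set[of b x ?T "set vs"] xset(1) by metis
  define y where "y = last qs"
  have y: "y \<in> set vs" "y \<in> set qs" using qs by (auto simp: y_def)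
  have qs_vs: "set qs \<inter> set vs = {y}"
  proof -
    have "set qs = insert y (set (butlast qs))"
      using qs(1) unfolding y_def by (metis append_butlast_last_id list.simps(15) rotate1.simps(2) set_rotate1)
    then show ?thesis using qs(6) y(1) by auto
  qed
  have peT: "path_edges vs \<subseteq> ?T"
  proof -
    have "{x, a} \<notin> path_edges vs"
      using closing_edge_notin_path[OF vs'(1,2)] xa by (simp add: insert_commute)
    then show ?thesis using path_edges_in_cycle[of vs] vs'(3) xb by blast
  qed
  let ?W = "set vs \<union> set qs"
  let ?EW = "path_edges vs \<union> path_edges qs"
  have WV: "?W \<subseteq> V"
  proof -
    have "v \<in> V" if v: "v \<in> set qs" for v
    proof (cases "length qs \<ge> 2")
      case True
      then obtain e where "e \<in> path_edges qs" "v \<in> e" using path_edges_cover[OF True v] by blast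
      then show ?thesis using qs(5) pairs by (auto simp: pairs_def)
    next
      case False
      moreover have "length qs > 0" using qs(1) by simp
      ultimately have "length qs = 1" by linarith
      then have "v = b" using v qs(3) by (auto simp: length_Suc_conv)
      then show ?thesis using inV by simp
    qed
    then show ?thesis using is_cycle_set[OF vs pairs] by auto
  qed
  have connW: "conn ?W ?EW"
  proof (rule connI_from[of _ y])
    fix v assume "v \<in> ?W"
    then consider "v \<in> set vs" | "v \<in> set qs" by blast
    then show "(y, v) \<in> reach ?EW"
    proof cases
      case 1
      then have "(y, v) \<in> reach (path_edges vs)" using conn_path_edges[of vs] y by (auto simp: conn_def)
      then show ?thesis by (rule reach_mono[rotated]) simp
    next
      case 2
      then have "(y, v) \<in> reach (path_edges qs)" using conn_path_edges[of qs] y by (auto simp: conn_def)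
      then show ?thesis by (rule reach_mono[rotated]) simp
    qed
  qed
  have EWp: "?EW \<subseteq> E \<and> ?EW \<subseteq> pairs ?W"
    using path_edges_pairs[OF vs'(1)] path_edges_pairs[OF qs(2)] peT qs(5) by (auto simp: pairs_def)
  obtain par d where R: "rooted V ?T x par d" using sptree_rooted[OF T(1) inV(1)] .
  have up: "{z, par z} \<in> ?EW" "par z \<in> ?W" if "z \<in> ?W" "z \<noteq> x" for z
    using parent_in_connected_part[OF R connW _ _ WV _ that] peT qs(5) EWp xset(1) by auto
  \<comment> \<open>A vertex outside \<open>?W\<close> would give a childless one outside
    \<open>?W\<close>, since \<open>?W\<close> is closed under parents; but childless vertices lie
    in the cut set.\<close>
  have VW: "V = ?W"
  proof (rule ccontr)
    assume "V \<noteq> ?W"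
    then have ne: "V - ?W \<noteq> {}" using WV by blast
    obtain t where t: "t \<in> V - ?W" "\<And>u. u \<in> V \<Longrightarrow> u \<noteq> x \<Longrightarrow> par u \<noteq> t"
      using childless_exists[OF R _ ne] up(2) finV by (metis DiffD2 DiffI finite_Diff)
    have "t \<in> cut_set G ?T"
      by (rule childless_in_cut_set[OF signed R TE]) (use t xset in auto)
    moreover have "b \<in> ?W" using qs(1,3) hd_in_set by blast
    ultimately show False using T(2) t(1) xset by auto
  qed
  have "?T \<subseteq> ?EW"
  proof
    fix e assume e: "e \<in> ?T"
    then obtain u v where uv: "e = {u, v}" using pairsE[OF pairs, of e] by blast
    then show "e \<in> ?EW" using rooted_edge[OF R, of u v] e up(1)[of u] up(1)[of v] VW by (auto simp: insert_commute)
  qed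
  then have "E \<subseteq> ?EW \<union> {{x, a}, {x, b}}" by blast
  moreover have "?EW \<union> {{x, a}, {x, b}} \<subseteq> E" using EWp xaE xbE by blast
  ultimately have E1: "E = ?EW \<union> {{x, a}, {x, b}}" by blast
  have E2: "E = cycle_edges vs \<union> insert {x, b} (path_edges qs)"
    unfolding E1 cycle_edges_def xa by (auto simp: insert_commute)
  show ?thesis
  proof (cases "y = x")
    case True
    \<comment> \<open>The path runs in the tree from \<open>b\<close> to \<open>x\<close>, and the
      edge \<open>{x, b}\<close> is not in the tree.\<close>
    have "length qs \<ge> 3"
    proof (rule ccontr)
      assume "\<not> length qs \<ge> 3"
      moreover have "length qs > 0" using qs(1) by simp
      ultimately have "length qs = 1 \<or> length qs = 2" by linarith
      then show False
        using qs(3,5) True inV(3) y_def by (auto simp: length_Suc_conv numeral_2_eq_2 insert_commute)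
    qed
    have ceq: "cycle_edges qs = insert {x, b} (path_edges qs)"
      using True qs(3) by (simp add: cycle_edges_def y_def)
    have cq: "is_cycle E qs" using \<open>length qs \<ge> 3\<close> qs(2) ceq E2 by (auto simp: is_cycle_def)
    have "is_union G {cycle_of G vs, cycle_of G qs}"
      using cycle_of_signed_cycle(2)[OF signed vs] cycle_of_signed_cycle(2)[OF signed cq] VW E2 ceq
      by (simp add: is_union_def)
    moreover have "verts (cycle_of G vs) \<inter> verts (cycle_of G qs) = {x}" using qs_vs True by auto
    ultimately have "infinity_graph (length vs) (length qs) G"
      using cycle_of_signed_cycle(1)[OF signed vs] cycle_of_signed_cycle(1)[OF signed cq] signed
      unfolding infinity_graph_def by blast
    then show ?thesis by blast
  next
    case False
    obtain as bs where ab': "vs = as @ y # bs" using y(1) by (meson split_list)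
    have asn: "as \<noteq> []" "hd as = x" using ab' False xa(1) by (cases as; simp)+
    \<comment> \<open>\<open>?P\<close> and \<open>?R\<close> are the two arcs of the cycle from
      \<open>x\<close> to \<open>y\<close>, and \<open>?Q\<close> leaves the cycle through
      \<open>b\<close>. If \<open>?Q\<close> and an arc both had length 1, the edge
      \<open>{x, b}\<close> would belong to the cycle.\<close>
    let ?P = "as @ [y]" and ?R = "x # rev (y # bs)" and ?Q = "x # qs"
    have lasta: "last (y # bs) = a" using ab' xa(2) by simp
    have hdr: "hd (rev (y # bs)) = a" using lasta hd_rev by metis
    have pvs: "path_edges vs = insert {last as, y} (path_edges as \<union> path_edges (y # bs))"
      unfolding ab' using path_edges_append[OF asn(1), of "y # bs"] by simp
    have pP: "path_edges ?P = insert {last as, y} (path_edges as)"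
      using path_edges_append[OF asn(1), of "[y]"] by simp
    have pR: "path_edges ?R = insert {x, a} (path_edges (y # bs))"
    proof -
      have "path_edges ([x] @ rev (y # bs)) = insert {last [x], hd (rev (y # bs))} (path_edges [x] \<union> path_edges (rev (y # bs)))"
        by (rule path_edges_append) auto
      then show ?thesis unfolding hdr path_edges_rev by simp
    qed
    have pQ: "path_edges ?Q = insert {x, b} (path_edges qs)"
    proof -
      have "path_edges ([x] @ qs) = insert {last [x], hd qs} (path_edges [x] \<union> path_edges qs)"
        by (rule path_edges_append) (use qs(1) in auto)
      then show ?thesis using qs(3) by simp
    qed
    have ce: "cycle_edges vs = path_edges ?P \<union> path_edges ?R"
      using pvs pP pR xa by (auto simp: cycle_edges_def insert_commute)
    have Eeq: "E = path_edges ?P \<union> path_edges ?Q \<union> path_edges ?R"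
      using E2 ce pQ by blast
    have xq: "x \<notin> set qs" using qs_vs False xset(1) by (metis IntI singletonD)
    have xas: "x \<in> set as" using asn hd_in_set by blast
    have dis: "distinct as" "y \<notin> set as" "y \<notin> set bs" "set as \<inter> set bs = {}" "distinct bs"
      using vs'(1) ab' by auto
    have setq: "set qs \<inter> set as = {}" "set qs \<inter> set bs = {}" using qs_vs ab' dis by auto
    have pb: "path_between x y (length as) ?P" "path_between x y (length qs) ?Q"
      "path_between x y (Suc (length bs)) ?R"
      unfolding path_between_def using asn dis xas xq qs(1,2) False
      by (auto simp: y_def hd_append last_rev)
    have "set ?P \<inter> set ?Q = {x, y}" using setq xas y(2) by auto
    moreover have "set ?P \<inter> set ?R = {x, y}" using dis xas by auto
    moreover have "set ?Q \<inter> set ?R = {x, y}" using setq y(2) by auto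
    moreover have "V = set ?P \<union> set ?Q \<union> set ?R" using VW ab' xas by auto
    moreover have "\<not> (length as = 1 \<and> Suc (length bs) = 1)" using vs'(2) ab' by auto
    moreover have "\<not> (length as = 1 \<and> length qs = 1)"
    proof
      assume h: "length as = 1 \<and> length qs = 1"
      then have "as = [x]" "qs = [b]" using asn qs(3) by (auto simp: length_Suc_conv)
      then have "{x, b} \<in> path_edges ?P" using y_def by simp
      then show False using xb ce by blast
    qed
    moreover have "\<not> (length qs = 1 \<and> Suc (length bs) = 1)"
    proof
      assume h: "length qs = 1 \<and> Suc (length bs) = 1"
      then have "bs = []" "qs = [b]" using qs(3) by (auto simp: length_Suc_conv)
      then have "{x, b} \<in> path_edges ?R" using y_def by simp
      then show False using xb ce by blast
    qed
    moreover have "length as \<ge> 1" "length qs \<ge> 1" using asn(1) qs(1) by (simp_all add: Suc_le_eq)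
    ultimately have "theta_graph (length as) (length qs) (Suc (length bs)) G"
      unfolding theta_graph_def using signed pb Eeq
      by - (intro conjI exI[of _ x] exI[of _ y] exI[of _ ?P] exI[of _ ?Q] exI[of _ ?R],
        (assumption | simp only: le_add1 plus_1_eq_Suc[symmetric])+)
    then show ?thesis by blast
  qed
qed

text \<open>The cycle survives the deletion of \<open>{x, b}\<close>, so its closing edge at
  \<open>x\<close> can be deleted as well; this gives the required pair of edges at
  \<open>x\<close>.\<close>

lemma nonbridge_case:
  assumes vs: "is_cycle E vs" and x: "x \<in> set vs" and xb: "{x, b} \<in> E - cycle_edges vs"
    and con: "conn V (E - {{x, b}})"
  shows "leaves G = {} \<and> cycles_have_nullity_2 G
    \<and> ((\<exists>p q. infinity_graph p q G) \<or> (\<exists>p q l. theta_graph p q l G))"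
proof -
  obtain ws where ws: "is_cycle E ws" "hd ws = x" "set ws = set vs" "cycle_edges ws = cycle_edges vs"
    using is_cycle_rotate[OF vs x] by metis
  define a where "a = last ws"
  have xaC: "{x, a} \<in> cycle_edges ws" using closing_edge_in_cycle[of ws] ws(2) by (simp add: a_def)
  have xaE: "{x, a} \<in> E" and xbE: "{x, b} \<in> E" using xaC ws(1) xb by (auto simp: is_cycle_def)
  have ab: "a \<noteq> b" using xaC xb ws(4) by auto
  have "is_cycle (E - {{x, b}}) ws" using ws xb by (auto simp: is_cycle_def)
  then have "conn V (E - {{x, b}} - {{x, a}})"
    using conn_remove_cycle_edge[OF con] ws(2) by (metis a_def)
  moreover have "E - {{x, b}} - {{x, a}} = E - {{x, a}, {x, b}}" by blast
  ultimately have con2: "conn V (E - {{x, a}, {x, b}})" by simp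
  have "cycles_have_nullity_2 G"
    unfolding cycles_have_nullity_2_def
  proof (intro allI impI, elim conjE)
    fix n C assume "signed_cycle n C" "signed_subgraph C G"
    then obtain us where us: "is_cycle E us" "nullity C = nullity (cycle_of G us)"
      using signed_cycle_subgraph by metis
    then show "nullity C = 2"
      using nonbridge_cycle_nullity[OF xaE xbE ab con2 us(1)] nullity_balanced_cycle[OF signed us(1)] by simp
  qed
  then show ?thesis
    using nonbridge_no_leaf[OF xaE xbE ab con2] nonbridge_structure[OF ws(1) ws(2)[symmetric] a_def _ con2] xb ws(4)
    by simp
qed

section \<open>Cycles that can be left only through bridges\<close>

lemma bridge_branch:
  assumes vs: "is_cycle E vs" and x: "x \<in> set vs" and xb: "{x, b} \<in> E - cycle_edges vs"
    and nb: "\<not> conn V (E - {{x, b}})"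
  obtains D where "branch G D x b" "D \<inter> set vs = {}"
proof -
  have xbE: "{x, b} \<in> E" using xb by simp
  have xV: "x \<in> V" "b \<in> V" using pairsD[OF pairs xbE] by auto
  obtain D where D: "D \<subseteq> V" "x \<notin> D" "D \<noteq> {}"
    and cut: "\<And>u v. u \<in> D \<Longrightarrow> v \<in> V \<Longrightarrow> {u, v} \<in> E \<Longrightarrow> v \<notin> D \<Longrightarrow> {u, v} = {x, b}"
    and out: "\<And>v. v \<in> V \<Longrightarrow> (x, v) \<in> reach (E - {{x, b}}) \<Longrightarrow> v \<notin> D"
    using bridge_side[OF connE nb xV(1)] by metis
  obtain w where "w \<in> D" using D(3) by blast
  then obtain u v where uv: "u \<in> D" "v \<in> V" "v \<notin> D" "{u, v} \<in> E"
    using conn_cut[OF connE pairs _ D(1) xV(1) D(2)] by metis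
  then have "{u, v} = {x, b}" using cut by blast
  then have "b \<in> D" using uv(1) D(2) by (auto simp: doubleton_eq_iff)
  moreover have "D \<inter> set vs = {}"
  proof -
    have "v \<notin> D" if "v \<in> set vs" for v
    proof (rule out)
      show "v \<in> V" using is_cycle_set[OF vs pairs] that by blast
      have "(x, v) \<in> reach (cycle_edges vs)" using conn_cycle_edges[of vs] x that by (auto simp: conn_def)
      then show "(x, v) \<in> reach (E - {{x, b}})"
        by (rule reach_mono[rotated]) (use vs xb in \<open>auto simp: is_cycle_def\<close>)
    qed
    then show ?thesis by blast
  qed
  moreover have "\<forall>u\<in>D. \<forall>v\<in>V - D. {u, v} \<in> E \<longrightarrow> {u, v} = {x, b}" using cut by blast
  ultimately show thesis using that[of D] D(1,2) xV(1) xbE unfolding branch_def by blast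
qed

text \<open>Some edge leaves the intersection. If it leaves \<open>D\<close>, it ends in
  \<open>x\<close>, which lies outside \<open>D'\<close>, so it would equal both bridges. If it
  leaves only \<open>D'\<close>, it ends in \<open>y\<close>, which is not in
  \<open>D\<close>.\<close>

lemma branches_disjoint:
  assumes D: "branch G D x b" and D': "branch G D' y b'" and ne: "{x, b} \<noteq> {y, b'}"
    and out: "x \<notin> D'" "y \<notin> D"
  shows "D \<inter> D' = {}"
proof (rule ccontr)
  assume "D \<inter> D' \<noteq> {}"
  then obtain w where w: "w \<in> D \<inter> D'" by blast
  have "D \<inter> D' \<subseteq> V" "x \<in> V" "x \<notin> D \<inter> D'" using D out by (auto simp: branch_def)
  then obtain u v where uv: "u \<in> D \<inter> D'" "v \<in> V" "v \<notin> D \<inter> D'" "{u, v} \<in> E"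
    using conn_cut[OF connE pairs w] by metis
  show False
  proof (cases "v \<in> D")
    case False
    then have e: "{u, v} = {x, b}" using branch_crossing[OF D, of u v] uv by auto
    then have "v = x" using uv(1) False D by (auto simp: doubleton_eq_iff branch_def)
    then have "{u, v} = {y, b'}" using branch_crossing[OF D', of u v] uv out by auto
    then show False using e ne by simp
  next
    case True
    then have "{u, v} = {y, b'}" using branch_crossing[OF D', of u v] uv by auto
    moreover from this have "v = y" using uv True D' by (auto simp: doubleton_eq_iff branch_def)
    ultimately show False using True out by simp
  qed
qed

lemma branch_root_forced:
  assumes T: "sptree V T" "T \<subseteq> E" and D: "branch G D x b" and S: "cut_set G T \<inter> D \<subseteq> S"
    and forc: "forcing G (insert x S)"
  shows "forcing G S"
  unfolding forcing_def
proof (intro allI impI)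
  fix f assume f: "null_fun G f" "\<forall>s\<in>S. f s = 0"
  have "f x = 0" by (rule branch_forces[OF signed T D f(1)]) (use f(2) S in auto)
  then have "\<forall>s\<in>insert x S. f s = 0" using f(2) by simp
  then show "\<forall>v\<in>V. f v = 0" using f(1) forc unfolding forcing_def by blast
qed

lemma single_branch:
  assumes vs: "is_cycle E vs"
    and nb: "\<And>x b. x \<in> set vs \<Longrightarrow> {x, b} \<in> E - cycle_edges vs \<Longrightarrow> \<not> conn V (E - {{x, b}})"
    and x: "x \<in> set vs" "{x, b} \<in> E - cycle_edges vs"
    and y: "y \<in> set vs" "{y, b'} \<in> E - cycle_edges vs"
  shows "{x, b} = {y, b'}"
proof (rule ccontr)
  assume ne: "{x, b} \<noteq> {y, b'}"
  obtain D where D: "branch G D x b" "D \<inter> set vs = {}" using bridge_branch[OF vs x nb[OF x]] .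
  obtain D' where D': "branch G D' y b'" "D' \<inter> set vs = {}" using bridge_branch[OF vs y nb[OF y]] .
  have disj: "D \<inter> D' = {}" by (rule branches_disjoint[OF D(1) D'(1) ne]) (use D D' x y in auto)
  obtain ws where ws: "is_cycle E ws" "hd ws = x" "set ws = set vs" "cycle_edges ws = cycle_edges vs"
    using is_cycle_rotate[OF vs x(1)] by metis
  define a where "a = last ws"
  have "{x, a} \<in> cycle_edges ws" using closing_edge_in_cycle[of ws] ws(2) by (simp add: a_def)
  then have xaE: "{x, a} \<in> E" using ws(1) unfolding is_cycle_def by blast
  have con1: "conn V (E - {{x, a}})" using conn_remove_cycle_edge[OF connE ws(1)] ws(2) by (simp add: a_def)
  have xD: "x \<notin> D" "x \<notin> D'" using D(2) D'(2) x(1) by auto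
  \<comment> \<open>The branch at \<open>x\<close> already forces the value at \<open>x\<close>, so by extremality nothing else is superfluous.\<close>
  have drop: False
    if T: "sptree V T" "T \<subseteq> E - {{x, a}}" and s: "s \<in> cut_set G T" "s \<in> D'" "forcing G (cut_set G T - {s})" for T s
  proof -
    have TE: "T \<subseteq> E" using T(2) by blast
    have xS: "x \<in> cut_set G T" using cut_setI(1)[of x a G T] xaE T(2) by blast
    have sx: "s \<noteq> x" "s \<notin> D" using s(2) xD disj by auto
    let ?S = "cut_set G T - {s} - {x}"
    have "insert x ?S = cut_set G T - {s}" using xS sx by blast
    then have "forcing G ?S"
      using branch_root_forced[OF T(1) TE D(1), of ?S] s(3) xD sx by auto
    then have "2 * c + num_pendant G \<le> Suc (card ?S)"
      using forcing_large[of ?S] cut_set_subset[OF signed] by blast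
    moreover have "Suc (Suc (card ?S)) = card (cut_set G T)"
      using finite_cut[of T] xS s(1) sx
      by (metis Diff_iff card_Suc_Diff1 finite_Diff singletonD)
    ultimately show False using cut_card[OF T(1) TE, of "{}"] by simp
  qed
  show False
  proof (rule branch_leaf_or_cycle[OF signed connE D'(1)])
    fix s assume s: "s \<in> D'" "s \<in> leaves G"
    obtain T where T: "T \<subseteq> E - {{x, a}}" "sptree V T"
      using sptree_exists[OF finV neV _ con1] pairs by blast
    have "forcing G (cut_set G T - {s})"
      by (rule cut_set_forcing_drop_leaf[OF signed T(2) _ s(2)]) (use T(1) in blast)
    moreover have "s \<in> cut_set G T" using s(2) by (simp add: cut_set_def)
    ultimately show False using drop[OF T(2,1) _ s(1)] by blast
  next
    fix us assume us: "is_cycle E us" "set us \<subseteq> D'"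
    have usne: "us \<noteq> []" using us(1) by (auto simp: is_cycle_def)
    have xa_us: "{x, a} \<notin> cycle_edges us" using cycle_edges_subset[OF usne] us(2) xD by blast
    then have "E \<noteq> cycle_edges us" using xaE by blast
    then obtain s s' where s: "s \<in> set us" "{s, s'} \<in> E - cycle_edges us"
      using cycle_off_edge[OF connE pairs us(1)] by metis
    obtain zs where zs: "is_cycle E zs" "hd zs = s" "cycle_edges zs = cycle_edges us"
      using is_cycle_rotate[OF us(1) s(1)] by metis
    define w where "w = last zs"
    have sw: "{s, w} \<in> cycle_edges zs" using closing_edge_in_cycle[of zs] zs(2) by (simp add: w_def)
    then have swE: "{s, w} \<in> E" using zs(1) unfolding is_cycle_def by blast
    obtain u where u: "{s, u} \<in> path_edges zs" "u \<noteq> w" using cycle_second[OF zs(1)] zs(2) by (metis w_def)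
    have suC: "{s, u} \<in> cycle_edges zs" using u(1) path_edges_in_cycle[of zs] by blast
    then have suE: "{s, u} \<in> E" using zs(1) unfolding is_cycle_def by blast
    have "is_cycle (E - {{x, a}}) zs" using zs xa_us by (auto simp: is_cycle_def)
    then have con2: "conn V (E - {{x, a}} - {{s, w}})"
      using conn_remove_cycle_edge[OF con1] zs(2) by (metis w_def)
    obtain T where T: "T \<subseteq> E - {{x, a}} - {{s, w}}" "sptree V T"
      using sptree_exists[OF finV neV _ con2] pairs by blast
    have TE: "T \<subseteq> E" "T \<subseteq> E - {{x, a}}" using T(1) by blast+
    have swF: "{s, w} \<in> E - T" using swE T(1) by blast
    have sD': "s \<in> D'" using s(1) us(2) by blast
    have xS: "x \<in> cut_set G T" using cut_setI(1)[of x a G T] xaE T(1) by blast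
    \<comment> \<open>A second edge outside the tree at \<open>s\<close> would share the end
      \<open>s\<close>; together with the loss of \<open>x\<close> that is one saving too
      many.\<close>
    have unique: "z = w" if z: "{s, z} \<in> E - T" for z
    proof (rule ccontr)
      assume "z \<noteq> w"
      then have "card {{s, z}, {s, w}} = 2" by (auto simp: doubleton_eq_iff card_insert_if)
      moreover have "{{s, z}, {s, w}} \<subseteq> E - T" using z swF by blast
      ultimately have "card (cut_set G T) + 1 \<le> 2 * c + num_pendant G"
        using cut_card[OF T(2) TE(1), of "{{s, z}, {s, w}}"] card_Union_two_pairs[of s z w] by linarith
      moreover have "forcing G (cut_set G T - {x})"
      proof (rule branch_root_forced[OF T(2) TE(1) D(1)])
        have "insert x (cut_set G T - {x}) = cut_set G T" using xS by blast
        then show "forcing G (insert x (cut_set G T - {x}))" using cut_forcing[OF T(2) TE(1) xaE] by simp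
      qed (use xD in blast)
      then have "2 * c + num_pendant G \<le> Suc (card (cut_set G T - {x}))"
        using forcing_large[of "cut_set G T - {x}"] cut_set_subset[OF signed] by blast
      moreover have "Suc (card (cut_set G T - {x})) = card (cut_set G T)"
        using finite_cut xS by (metis card_Suc_Diff1)
      ultimately show False by simp
    qed
    have "s' \<noteq> w" using s(2) sw zs(3) by auto
    then have ss'T: "{s, s'} \<in> T" using unique[of s'] s(2) by blast
    have suT: "{s, u} \<in> T" using unique[of u] u(2) suE by blast
    have "u \<noteq> s'" using suC s(2) zs(3) by auto
    then have "forcing G (cut_set G T - {s})"
      using cut_set_forcing_drop_major[OF signed T(2) TE(1) swF unique suT ss'T] by simp
    then show False using drop[OF T(2) TE(2) cut_setI(1)[OF swF] sD'] by blast
  qed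
qed

text \<open>Let the tree omit the closing edge \<open>{x, a}\<close>. Since the branch forces
  \<open>x\<close>, the cut set without \<open>x\<close> is forcing and, by extremality, of least
  size. So some kernel vector is nonzero at \<open>a\<close> and zero on the rest of the cut set,
  including \<open>x\<close>, and such a vector is supported on the cycle.\<close>

lemma pendant_cycle_balanced:
  assumes vs: "is_cycle E vs" and D: "branch G D x b" "D \<inter> set vs = {}" and x: "x = hd vs"
    and only: "\<And>y z. y \<in> set vs \<Longrightarrow> {y, z} \<in> E - cycle_edges vs \<Longrightarrow> {y, z} = {x, b}"
  shows "balanced G (cycle_edges vs)"
proof -
  have vs': "distinct vs" "length vs \<ge> 3" "cycle_edges vs \<subseteq> E" "vs \<noteq> []"
    using vs by (auto simp: is_cycle_def)
  define a where "a = last vs"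
  have xaC: "{x, a} \<in> cycle_edges vs" using closing_edge_in_cycle[of vs] x by (simp add: a_def)
  then have xaE: "{x, a} \<in> E" using vs'(3) by blast
  have xa_ne: "x \<noteq> a" using pairsD[OF pairs xaE] by blast
  have aset: "a \<in> set vs" "x \<in> set vs" using vs'(4) x by (auto simp: a_def)
  have bD: "b \<in> D" using D(1) by (auto simp: branch_def)
  then have bvs: "b \<notin> set vs" using D(2) by blast
  have con: "conn V (E - {{x, a}})" using conn_remove_cycle_edge[OF connE vs] x by (simp add: a_def)
  obtain T where T: "T \<subseteq> E - {{x, a}}" "sptree V T"
    using sptree_exists[OF finV neV _ con] pairs by blast
  have TE: "T \<subseteq> E" using T by blast
  have xD: "x \<notin> D" "a \<notin> D" using D aset by auto
  \<comment> \<open>Cut the list at the edge \<open>e\<close>: the part \<open>bs\<close> does not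
    contain \<open>x\<close>, and with the closing edge missing from the tree only \<open>e\<close>
    joins \<open>bs\<close> to the rest. As the tree is connected, it contains
    \<open>e\<close>.\<close>
  have peT: "path_edges vs \<subseteq> T"
  proof
    fix e assume "e \<in> path_edges vs"
    then obtain as bs where s: "vs = as @ bs" "as \<noteq> []" "bs \<noteq> []" "e = {last as, hd bs}"
      by (rule path_edge_split)
    have xas: "x \<in> set as" using x s by simp
    then have xbs: "x \<notin> set bs" using vs'(1) s(1) by auto
    have "set bs \<subseteq> V" using is_cycle_set[OF vs pairs] s(1) by auto
    moreover have "conn V T" "T \<subseteq> pairs V" "x \<in> V"
      using T(2) is_cycle_set[OF vs pairs] aset by (auto simp: sptree_def)
    ultimately obtain u v where uv: "u \<in> set bs" "v \<in> V" "v \<notin> set bs" "{u, v} \<in> T"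
      using conn_cut[of V T "hd bs" "set bs" x] hd_in_set[OF s(3)] xbs by metis
    have "{u, v} \<in> cycle_edges vs"
    proof (rule ccontr)
      assume "{u, v} \<notin> cycle_edges vs"
      then have "{u, v} = {x, b}" using only[of u v] uv TE s(1) by auto
      then show False using uv(1) xbs bvs s(1) by (auto simp: doubleton_eq_iff)
    qed
    moreover have "{u, v} \<noteq> {last vs, hd vs}" using uv(4) T(1) x by (auto simp: a_def insert_commute)
    ultimately have "{u, v} \<in> path_edges as \<union> path_edges bs \<or> {u, v} = e"
      using path_edges_append[OF s(2,3)] s(1,4) by (auto simp: cycle_edges_def)
    moreover have "{u, v} \<notin> path_edges bs" using path_edges_subset uv(3) by blast
    moreover have "{u, v} \<notin> path_edges as" using path_edges_subset[of "{u, v}" as] uv(1) vs'(1) s(1) by auto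
    ultimately show "e \<in> T" using uv(4) by auto
  qed
  have un: "w = hd vs" if w: "{last vs, w} \<in> E - T" for w
  proof (cases "{last vs, w} \<in> cycle_edges vs")
    case True
    then have "{last vs, w} = {last vs, hd vs}" using w peT by (auto simp: cycle_edges_def)
    then show ?thesis by (auto simp: doubleton_eq_iff)
  next
    case False
    then have "{last vs, w} = {x, b}" using only[of "last vs" w] w aset(1) by (auto simp: a_def)
    then show ?thesis using xa_ne bvs aset by (auto simp: doubleton_eq_iff a_def)
  qed
  have xS: "x \<in> cut_set G T" and aS: "a \<in> cut_set G T"
    using cut_setI[of x a G T] cut_setI(2)[of x a G T] xaE T(1) by blast+
  let ?S = "cut_set G T - {x}"
  have forcS: "forcing G ?S"
  proof (rule branch_root_forced[OF T(2) TE D(1)])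
    have "insert x ?S = cut_set G T" using xS by blast
    then show "forcing G (insert x ?S)" using cut_forcing[OF T(2) TE xaE] by simp
  qed (use xD in blast)
  have subS: "?S \<subseteq> V" using cut_set_subset[OF signed] by blast
  have "card ?S \<le> nullity G"
  proof -
    have "Suc (card ?S) = card (cut_set G T)" using finite_cut xS by (metis card_Suc_Diff1)
    then show ?thesis using cut_card[OF T(2) TE, of "{}"] equality by simp
  qed
  moreover have "nullity G \<le> card ?S" by (rule nullity_le_card[OF finV subS forcS])
  ultimately have "nullity G = card ?S" by simp
  moreover have "a \<in> ?S" using aS xa_ne by blast
  ultimately obtain f where f: "null_fun G f" "f a \<noteq> 0" "\<forall>t\<in>?S - {a}. f t = 0"
    using forcing_nullity_interp[OF finV subS forcS] by blast
  have fx: "f x = 0" by (rule branch_forces[OF signed T(2) TE D(1) f(1)]) (use f(3) xD in auto)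
  have zero: "f s = 0" if "s \<in> cut_set G T" "s \<noteq> last vs" for s
    using that f(3) fx by (cases "s = x") (auto simp: a_def)
  have "null_fun (cycle_of G vs) f"
    by (rule null_fun_concentrates_on_cycle(1)[OF signed T(2) TE vs peT un f(1) zero])
  then show ?thesis using balanced_if_null_fun[of G vs f a] signed vs aset f(2) by simp
qed

section \<open>Removing a pendant cycle\<close>

text \<open>A lone cycle has c = 1 and p = 0, so equality would require nullity 1, which
  \<open>cycle_nullity_cases\<close> excludes.\<close>

lemma not_cycle:
  assumes vs: "is_cycle E vs" shows "E \<noteq> cycle_edges vs"
proof
  assume E: "E = cycle_edges vs"
  have vs': "distinct vs" "length vs \<ge> 3" "vs \<noteq> []" using vs by (auto simp: is_cycle_def)
  have sub: "set vs \<subseteq> V" by (rule is_cycle_set[OF vs pairs])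
  have "V \<subseteq> set vs"
  proof (rule ccontr)
    assume "\<not> V \<subseteq> set vs"
    then obtain v where "v \<in> V" "v \<notin> set vs" by blast
    then obtain y z where "y \<in> set vs" "z \<notin> set vs" "{y, z} \<in> E"
      using conn_cut[OF connE pairs hd_in_set[OF vs'(3)] sub] by metis
    then show False using E cycle_edges_subset[OF vs'(3)] by blast
  qed
  then have V: "V = set vs" using sub by blast
  then have "c = 1" using cyclomatic E card_cycle_edges[OF vs'(1,2)] vs'(1) by (simp add: distinct_card)
  moreover have "leaves G = {}"
    using cycle_vertex_not_leaf[OF signed vs] V by (auto simp: leaves_def)
  moreover have "nullity (cycle_of G vs) = nullity G" by (rule nullity_cong) (use V E in auto)
  ultimately show False using equality cycle_nullity_cases[OF signed vs] by (auto simp: num_pendant_def)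
qed

text \<open>The attaching vertex \<open>hd vs\<close> is kept: it is to become a leaf of what
  remains.\<close>

definition without :: "'a list \<Rightarrow> 'a signed_graph" where
  "without vs = \<lparr>verts = V - (set vs - {hd vs}), edges = E - cycle_edges vs, edge_sign = edge_sign G\<rparr>"

lemma without_simps [simp]: "verts (without vs) = V - (set vs - {hd vs})"
  "edges (without vs) = E - cycle_edges vs" "edge_sign (without vs) = edge_sign G"
  by (auto simp: without_def)

text \<open>Deleting \<open>length vs\<close> edges but only \<open>length vs - 1\<close> vertices
  lowers c by one. The head becomes a leaf, so p grows by one, and the nullity falls by one by
  \<open>nullity_glue_cycle\<close>. Both sides of the equality decrease by one.\<close>

lemma pendant_cycle_removal:
  assumes vs: "is_cycle E vs" and b: "{hd vs, b} \<in> E" "b \<notin> set vs"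
    and only: "\<And>y z. y \<in> set vs \<Longrightarrow> {y, z} \<in> E - cycle_edges vs \<Longrightarrow> {y, z} = {hd vs, b}"
    and bal: "balanced G (cycle_edges vs)"
  shows "signed_subgraph (without vs) G" "verts (without vs) \<inter> set vs = {hd vs}"
    "hd vs \<in> leaves (without vs)" "extremal (without vs) (c - 1)"
    "V = verts (without vs) \<union> set vs" "E = edges (without vs) \<union> cycle_edges vs"
proof -
  let ?x = "hd vs" and ?H = "without vs"
  have vs': "distinct vs" "length vs \<ge> 3" "cycle_edges vs \<subseteq> E" "vs \<noteq> []"
    using vs by (auto simp: is_cycle_def)
  have sub: "set vs \<subseteq> V" by (rule is_cycle_set[OF vs pairs])
  have x: "?x \<in> set vs" using vs'(4) by simp
  have bE: "{?x, b} \<in> E - cycle_edges vs"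
    using b cycle_edges_subset[OF vs'(4), of "{?x, b}"] by auto
  have keep: "u \<in> verts ?H" if uv: "{u, v} \<in> E - cycle_edges vs" for u v
  proof -
    have "u \<in> V" using pairsD[OF pairs, of u v] uv by blast
    moreover have "u = ?x" if "u \<in> set vs"
      using only[OF that uv] that b(2) by (auto simp: doubleton_eq_iff)
    ultimately show ?thesis by auto
  qed
  have Hp: "edges ?H \<subseteq> pairs (verts ?H)"
  proof
    fix e assume e: "e \<in> edges ?H"
    then have "e \<in> E" by simp
    then obtain u v where uv: "e = {u, v}" "u \<noteq> v" by (rule pairsE[OF pairs])
    then have "u \<in> verts ?H" "v \<in> verts ?H"
      using keep[of u v] keep[of v u] e by (auto simp: insert_commute)
    then show "e \<in> pairs (verts ?H)" using uv by (auto simp: pairs_def)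
  qed
  have HG: "signed_subgraph \<lparr>verts = verts ?H, edges = edges ?H, edge_sign = edge_sign G\<rparr> G"
    by (rule signed_graph_subgraph[OF signed _ _ Hp]) auto
  then show HG: "signed_subgraph ?H G" by (simp add: without_def)
  show int: "verts ?H \<inter> set vs = {?x}" using sub x by auto
  show V: "V = verts ?H \<union> set vs" using sub by auto
  show E: "E = edges ?H \<union> cycle_edges vs" using vs'(3) by auto
  have H: "signed_graph ?H" using HG by (simp add: signed_subgraph_def)
  have xH: "?x \<in> verts ?H" using x sub by auto
  have "{e \<in> edges ?H. ?x \<in> e} = {{?x, b}}"
  proof (intro equalityI subsetI)
    fix e assume "e \<in> {e \<in> edges ?H. ?x \<in> e}"
    then have e: "e \<in> E - cycle_edges vs" "?x \<in> e" by auto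
    then obtain z where "e = {?x, z}"
      using pairsE[OF pairs, of e] by (metis DiffD1 doubleton_eq_iff insertE singletonD)
    then show "e \<in> {{?x, b}}" using only[OF x, of z] e by simp
  qed (use bE in auto)
  then show leaf: "?x \<in> leaves ?H" using xH by (simp add: leaves_def vertex_degree_def)
  have leavesH: "leaves ?H = insert ?x (leaves G)"
  proof -
    have *: "v \<in> leaves ?H \<longleftrightarrow> v \<in> leaves G" if v: "v \<in> V - set vs" for v
    proof -
      have "{e \<in> edges ?H. v \<in> e} = {e \<in> E. v \<in> e}"
        using cycle_edges_subset[OF vs'(4)] v by auto
      then show ?thesis using v by (simp add: leaves_def vertex_degree_def)
    qed
    have "v \<notin> set vs" if "v \<in> leaves G" for v using cycle_vertex_not_leaf[OF signed vs] that by blast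
    moreover have "v \<in> V" if "v \<in> leaves G" for v using that by (simp add: leaves_def)
    moreover have "v \<in> V - set vs \<or> v = ?x" if "v \<in> leaves ?H" for v using that by (auto simp: leaves_def)
    ultimately show ?thesis using * leaf by blast
  qed
  have xG: "?x \<notin> leaves G" by (rule cycle_vertex_not_leaf[OF signed vs x])
  have finL: "finite (leaves G)" using finV by (auto simp: leaves_def)
  have p: "num_pendant ?H = Suc (num_pendant G)"
    unfolding num_pendant_def leavesH using xG finL by simp
  have n: "nullity G = Suc (nullity ?H)"
    by (rule nullity_glue_cycle[OF signed vs nullity_balanced_cycle[OF signed vs bal] HG int V E])
  have cE: "card E = card (edges ?H) + length vs"
    using card_Diff_subset[OF _ vs'(3)] card_mono[OF finE vs'(3)] card_cycle_edges[OF vs'(1,2)] by simp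
  have cV: "card V + 1 = card (verts ?H) + length vs"
  proof -
    have "card (set vs - {?x}) + 1 = length vs"
      using vs' x by (simp add: distinct_card)
    moreover have "card (verts ?H) = card V - card (set vs - {?x})"
      unfolding without_simps by (rule card_Diff_subset) (use sub in auto)
    moreover have "card (set vs - {?x}) \<le> card V" by (rule card_mono[OF finV]) (use sub in auto)
    ultimately show ?thesis by simp
  qed
  have "conn (verts ?H) (edges ?H)"
  proof (rule connI_from[of _ ?x])
    \<comment> \<open>Collapsing the cycle to its head maps each edge of \<open>G\<close> to an edge
      of the remaining graph or to a single vertex, so walks of \<open>G\<close> become walks
      there.\<close>
    define \<rho> where "\<rho> v = (if v \<in> set vs then ?x else v)" for v
    have step: "(\<rho> u, \<rho> v) \<in> reach (edges ?H)" if "{u, v} \<in> E" for u v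
    proof (cases "{u, v} \<in> cycle_edges vs")
      case True
      then have "u \<in> set vs" "v \<in> set vs" using cycle_edges_subset[OF vs'(4)] by auto
      then show ?thesis by (simp add: \<rho>_def)
    next
      case False
      then have "{u, v} \<in> edges ?H" using that by simp
      moreover have "\<rho> u = u" "\<rho> v = v"
        using keep[of u v] keep[of v u] that False by (auto simp: \<rho>_def insert_commute)
      ultimately show ?thesis by (auto intro: reach_edge)
    qed
    fix v assume v: "v \<in> verts ?H"
    then have "(?x, v) \<in> {(x, y). {x, y} \<in> E}\<^sup>*" using connE x sub by (auto simp: conn_def reach_def)
    then have "(\<rho> ?x, \<rho> v) \<in> reach (edges ?H)"
    proof (induction rule: rtrancl_induct)
      case (step y z)
      then show ?case using \<open>\<And>u v. {u, v} \<in> E \<Longrightarrow> _\<close> reach_trans by fastforce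
    qed simp
    moreover have "\<rho> v = v" "\<rho> ?x = ?x" using v x by (auto simp: \<rho>_def)
    ultimately show "(?x, v) \<in> reach (edges ?H)" by simp
  qed
  then have conH: "connected_graph ?H" using xH by (auto simp: connected_graph_conn)
  have "card (verts ?H) \<le> Suc (card (edges ?H))"
    using conn_card[OF signed_graph_finite[OF H] _ Hp] xH conH by (auto simp: connected_graph_conn)
  then have c1: "c \<ge> 1" using cE cV cyclomatic by simp
  show "extremal ?H (c - 1)"
  proof (unfold_locales)
    show "signed_graph ?H" "connected_graph ?H" by (fact H, fact conH)
    show "Suc (card (edges ?H)) = card (verts ?H) + (c - 1)" using cE cV cyclomatic c1 by simp
    show "Suc (nullity ?H) = 2 * (c - 1) + num_pendant ?H" using equality n p c1 by simp
  qed
qed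

end

section \<open>Induction on the cyclomatic number\<close>

lemma signed_subgraph_trans:
  "signed_subgraph A B \<Longrightarrow> signed_subgraph B C \<Longrightarrow> signed_subgraph A C"
  by (auto simp: signed_subgraph_def)

text \<open>The leaves of \<open>H\<close> are the leaves of \<open>T\<close> not yet used, so the
  leaf \<open>x\<close> of \<open>H\<close> is a fresh attaching point. It lies on none of the
  earlier cycles, hence the new cycle is disjoint from them.\<close>

lemma tree_with_cycles_insert:
  assumes G: "signed_graph G" and vs: "is_cycle (edges G) vs" and H: "signed_subgraph H G"
    and int: "verts H \<inter> set vs = {x}" and leaf: "x \<in> leaves H"
    and V: "verts G = verts H \<union> set vs" and E: "edges G = edges H \<union> cycle_edges vs"
    and tw: "tree_with_cycles H T L C"
  shows "x \<notin> L" "tree_with_cycles G T (insert x L) (C(x := cycle_of G vs))"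
proof -
  have HG: "signed_graph H" using H by (simp add: signed_subgraph_def)
  have T: "signed_tree T" "L \<subseteq> leaves T"
    and cyc: "\<And>v. v \<in> L \<Longrightarrow> \<exists>n. signed_cycle n (C v)" "\<And>v. v \<in> L \<Longrightarrow> verts T \<inter> verts (C v) = {v}"
    and disj: "\<And>v w. v \<in> L \<Longrightarrow> w \<in> L \<Longrightarrow> v \<noteq> w \<Longrightarrow> verts (C v) \<inter> verts (C w) = {}"
    and un: "\<And>K. K \<in> insert T (C ` L) \<Longrightarrow> signed_subgraph K H"
      "verts H = verts T \<union> (\<Union>v\<in>L. verts (C v))" "edges H = edges T \<union> (\<Union>v\<in>L. edges (C v))"
    using tw by (auto simp: tree_with_cycles_def is_union_def)
  have xT: "x \<in> leaves T" "x \<notin> L" using leaf tree_with_cycles_leaves[OF HG tw] by auto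
  then have xV: "x \<in> verts T" by (simp add: leaves_def)
  show "x \<notin> L" by (rule xT(2))
  have xC: "verts (C v) \<inter> set vs = {}" if v: "v \<in> L" for v
  proof -
    have "verts (C v) \<inter> set vs \<subseteq> {x}" unfolding int[symmetric] using un(2) v by blast
    moreover have "x \<notin> verts (C v)" using cyc(2)[OF v] xV xT(2) v by (metis IntI singletonD)
    ultimately show ?thesis by blast
  qed
  have Tx: "verts T \<inter> set vs = {x}" using int un(2) xV by blast
  let ?C = "C(x := cycle_of G vs)"
  have C': "?C v = C v" if "v \<in> L" for v using that xT(2) by auto
  have "?C ` L = C ` L" by (rule image_cong) (use C' in auto)
  then have image: "?C ` insert x L = insert (cycle_of G vs) (C ` L)"
    unfolding image_insert by simp
  show "tree_with_cycles G T (insert x L) ?C"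
    unfolding tree_with_cycles_def
  proof (intro conjI ballI impI)
    show "signed_tree T" by (rule T(1))
    show "insert x L \<subseteq> leaves T" using T(2) xT(1) by blast
    show "\<exists>n. signed_cycle n (?C v)" if "v \<in> insert x L" for v
      using that cycle_of_signed_cycle(1)[OF G vs] cyc(1)[of v] C'[of v] by (cases "v = x") auto
    show "verts T \<inter> verts (?C v) = {v}" if "v \<in> insert x L" for v
      using that Tx cyc(2)[of v] C'[of v] by (cases "v = x") auto
    show "verts (?C v) \<inter> verts (?C w) = {}" if "v \<in> insert x L" "w \<in> insert x L" "v \<noteq> w" for v w
      using that xC[of v] xC[of w] disj[of v w] by (auto simp: Int_commute)
    have "signed_subgraph K G" if "K \<in> insert T (C ` L)" for K
      using un(1)[OF that] H by (rule signed_subgraph_trans)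
    moreover have "(\<Union>K\<in>insert T (?C ` insert x L). verts K) = verts G"
      unfolding image V un(2) by auto
    moreover have "(\<Union>K\<in>insert T (?C ` insert x L). edges K) = edges G"
      unfolding image E un(3) by auto
    ultimately show "is_union G (insert T (?C ` insert x L))"
      using cycle_of_signed_cycle(2)[OF G vs] unfolding is_union_def image by auto
  qed
qed

lemma signed_tree_if_sptree:
  assumes "signed_graph G" "connected_graph G" "sptree (verts G) (edges G)"
  shows "signed_tree G"
proof -
  have False if "signed_cycle n C" "signed_subgraph C G" for n C
    using signed_cycle_subgraph[OF that] sptree_no_cycle[OF assms(3)] by metis
  then show ?thesis using assms by (auto simp: signed_tree_def)
qed

text \<open>The condition \<open>leaves G = {}\<close> in the second alternative is there for the
  induction: it rules that alternative out for a graph from which a pendant cycle has been cut off.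
  For c = 0 the graph is the tree itself, with no cycle attached.\<close>

lemma extremal_classification:
  assumes "extremal G c"
  shows "(\<exists>T L C. tree_with_cycles G T L C \<and> Suc (nullity T) = num_pendant T \<and> card L = c
      \<and> (\<forall>v\<in>L. nullity (C v) = 2))
    \<or> (leaves G = {} \<and> cycles_have_nullity_2 G
      \<and> ((\<exists>p q. infinity_graph p q G) \<or> (\<exists>p q l. theta_graph p q l G)))"
  using assms
proof (induction c arbitrary: G)
  case 0
  then interpret extremal G 0 .
  have "sptree V E" using finV neV pairs connE cyclomatic by (auto simp: sptree_def)
  then have "signed_tree G" by (rule signed_tree_if_sptree[OF signed connected])
  moreover have "signed_subgraph G G" using signed by (simp add: signed_subgraph_def)
  ultimately have "tree_with_cycles G G {} C" for C
    by (simp add: tree_with_cycles_def is_union_def)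
  moreover have "Suc (nullity G) = num_pendant G" using equality by simp
  ultimately show ?case by (metis card.empty empty_iff)
next
  case (Suc c)
  interpret extremal G "Suc c" by (rule Suc.prems)
  obtain us where us: "is_cycle E us"
    using cycle_exists[OF finV neV pairs connE] cyclomatic by auto
  show ?case
  proof (cases "\<exists>x b. x \<in> set us \<and> {x, b} \<in> E - cycle_edges us \<and> conn V (E - {{x, b}})")
    case True
    then show ?thesis using nonbridge_case[OF us] by blast
  next
    case False
    then have nb: "\<not> conn V (E - {{x, b}})" if "x \<in> set us" "{x, b} \<in> E - cycle_edges us" for x b
      using that by blast
    obtain x b where xb: "x \<in> set us" "{x, b} \<in> E - cycle_edges us"
      using cycle_off_edge[OF connE pairs us not_cycle[OF us]] by metis
    obtain D where D: "branch G D x b" "D \<inter> set us = {}" using bridge_branch[OF us xb nb[OF xb]] .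
    have only': "{x, b} = {y, z}" if "y \<in> set us" "{y, z} \<in> E - cycle_edges us" for y z
      by (rule single_branch[OF us nb xb that])
    obtain vs where vs: "is_cycle E vs" "hd vs = x" "set vs = set us" "cycle_edges vs = cycle_edges us"
      using is_cycle_rotate[OF us xb(1)] by metis
    have only: "{y, z} = {hd vs, b}" if "y \<in> set vs" "{y, z} \<in> E - cycle_edges vs" for y z
      using only'[of y z] that vs by simp
    have D': "branch G D (hd vs) b" "D \<inter> set vs = {}" using D vs by simp_all
    have bal: "balanced G (cycle_edges vs)" by (rule pendant_cycle_balanced[OF vs(1) D' refl only])
    have b: "{hd vs, b} \<in> E" "b \<notin> set vs" using D' by (auto simp: branch_def)
    note rem = pendant_cycle_removal[OF vs(1) b only bal]
    have "extremal (without vs) c" using rem(4) by simp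
    \<comment> \<open>By \<open>rem(3)\<close> the attaching vertex is a leaf of the remaining
      graph, so only the first alternative is possible.\<close>
    from Suc.IH[OF this] obtain T L C where tw: "tree_with_cycles (without vs) T L C"
      and T: "Suc (nullity T) = num_pendant T" "card L = c" "\<forall>v\<in>L. nullity (C v) = 2"
      using rem(3) by auto
    note ins = tree_with_cycles_insert[OF signed vs(1) rem(1,2,3,5,6) tw]
    have "finite L"
      using tw by (auto simp: tree_with_cycles_def signed_tree_def signed_graph_def leaves_def intro: finite_subset)
    then have "card (insert (hd vs) L) = Suc c" using ins(1) T(2) by simp
    moreover have "\<forall>v\<in>insert (hd vs) L. nullity ((C(hd vs := cycle_of G vs)) v) = 2"
      using T(3) nullity_balanced_cycle[OF signed vs(1) bal] by simp
    ultimately show ?thesis using ins(2) T(1) by blast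
  qed
qed

theorem theorem5p4:
  fixes \<Gamma> :: "'a signed_graph"
  assumes "signed_graph \<Gamma>" and "connected_graph \<Gamma>" and "cyclomatic \<Gamma> \<ge> 1"
  shows "int (nullity \<Gamma>) = 2 * cyclomatic \<Gamma> + int (num_pendant \<Gamma>) - 1 \<longleftrightarrow>
    (\<exists>T L C. tree_with_cycles \<Gamma> T L C
        \<and> int (nullity T) = int (num_pendant T) - 1
        \<and> int (num_pendant T) \<ge> cyclomatic \<Gamma>
        \<and> int (card L) = cyclomatic \<Gamma>
        \<and> (\<forall>v\<in>L. nullity (C v) = 2))
    \<or> (\<exists>p q. infinity_graph p q \<Gamma> \<and> cycles_have_nullity_2 \<Gamma>)
    \<or> (\<exists>p q l. theta_graph p q l \<Gamma> \<and> cycles_have_nullity_2 \<Gamma>)"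
    (is "?eq \<longleftrightarrow> ?forms")
proof
  assume eq: ?eq
  define c where "c = nat (cyclomatic \<Gamma>)"
  have c: "cyclomatic \<Gamma> = int c" using assms(3) by (simp add: c_def)
  have "extremal \<Gamma> c"
    by unfold_locales (use assms(1,2) eq c cyclomatic_connected[OF assms(2)] in auto)
  from extremal_classification[OF this] show ?forms
  proof (elim disjE)
    assume "\<exists>T L C. tree_with_cycles \<Gamma> T L C \<and> Suc (nullity T) = num_pendant T \<and> card L = c
      \<and> (\<forall>v\<in>L. nullity (C v) = 2)"
    then obtain T L C where tw: "tree_with_cycles \<Gamma> T L C" and T: "Suc (nullity T) = num_pendant T"
      "card L = c" "\<forall>v\<in>L. nullity (C v) = 2"
      by blast
    have "L \<subseteq> leaves T" "finite (leaves T)"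
      using tw by (auto simp: tree_with_cycles_def signed_tree_def signed_graph_def leaves_def)
    then have "card L \<le> num_pendant T" unfolding num_pendant_def by (intro card_mono)
    then have "int (num_pendant T) \<ge> cyclomatic \<Gamma>" "int (card L) = cyclomatic \<Gamma>"
      using T(2) c by simp_all
    moreover have "int (nullity T) = int (num_pendant T) - 1" using T(1) by linarith
    ultimately show ?forms using tw T(3) by blast
  qed blast
next
  assume ?forms
  then show ?eq
    using tree_with_cycles_equality[OF assms(1)] infinity_graph_equality[OF assms(2)]
      theta_graph_equality[OF assms(2)] by blast
qed

end
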